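(* Let $V\subseteq L^2(\mathbb{R}^d)$ be a finitely generated shift-invariant space and $L:V\to V$ a bounded shift-preserving operator which is invertible. If $L$ is $s$-diagonalizable, then $L^{-1}$ is $s$-diagonalizable. Furthermore, if $(a_1,\dots,a_m)$ is an $s$-diagonalization of $L$, then $(b_1,\dots,b_m)$ is an $s$-diagonalization of $L^{-1}$ with $\hat b_j(\omega)=(\hat a_j(\omega))^{-1}$ for a.e. $\omega\in[0,1)^d$ and $V_{b_j}=\ker(L^{-1}-\Lambda_{b_j})=V_{a_j}$ for $j=1,\dots,m$, where $V_{a_j}=\ker(L-\Lambda_{a_j})$.
   Context: For $k\in\mathbb{Z}^d$, $T_kf(x)=f(x-k)$. A closed subspace $V\subseteq L^2(\mathbb{R}^d)$ is shift invariant if $T_kf\in V$ for all $f\in V$, $k\in\mathbb{Z}^d$; it is finitely generated if $V=\overline{\mathrm{span}}\{T_k\varphi:\varphi\in\Phi,\ k\in\mathbb{Z}^d\}$ for some finite $\Phi\subset L^2(\mathbb{R}^d)$. A bounded linear operator $L:V\to V$ is shift preserving if $LT_k=T_kL$ for all $k\in\mathbb{Z}^d$. The inverse of an invertible shift-preserving operator $L:V\to V$ is again bounded and shift preserving. Let $\hat f(\omega)=\int f(x)e^{-2\pi i\langle\omega,x\rangle}dx$ denote the Fourier transform (extended to $L^2(\mathbb{R}^d)$), and let $\mathcal{T}:L^2(\mathbb{R}^d)\to L^2([0,1)^d,\ell^2(\mathbb{Z}^d))$ be the isometric isomorphism $\mathcal{T}f(\omega)=\{\hat f(\omega+k)\}_{k\in\mathbb{Z}^d}$.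 A sequence $a=\{a_k\}\in\ell^2(\mathbb{Z}^d)$ is of bounded spectrum if $\hat a\in L^\infty([0,1)^d)$, where $\hat a(\omega)=\sum_{k\in\mathbb{Z}^d} a_ke^{-2\pi i\langle\omega,k\rangle}$. For such $a$, $\Lambda_a$ (formally $\sum_{k\in\mathbb{Z}^d} a_kT_k$) is the bounded operator on $L^2(\mathbb{R}^d)$ determined by $\mathcal{T}(\Lambda_af)(\omega)=\hat a(\omega)\,\mathcal{T}f(\omega)$ for a.e. $\omega\in[0,1)^d$. For a bounded shift-preserving operator $L:V\to V$ and a sequence $a$ of bounded spectrum, $\Lambda_a$ is an $s$-eigenvalue of $L$ if $V_a:=\ker(L-\Lambda_a)=\{f\in V:Lf=\Lambda_af\}\neq\{0\}$; $V_a$ is a shift-invariant subspace of $V$, called the $s$-eigenspace associated to $\Lambda_a$. When $V$ is finitely generated, $L$ is $s$-diagonalizable if there is a finite number of sequences of bounded spectrum $a_1,\dots,a_m$ such that $\Lambda_{a_1},\dots,\Lambda_{a_m}$ are $s$-eigenvalues of $L$ and $V=V_{a_1}\oplus\dots\oplus V_{a_m}$ (direct sum, not necessarily orthogonal); in that case $(a_1,\dots,a_m)$ is called an $s$-diagonalization of $L$. The same definitions apply to $L^{-1}$ in place of $L$.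
   Formalization: The identity for b̂_j a.e. on [0,1)^d is claimed only when 1/â_j is essentially bounded (as literally stated it can fail); otherwise b_j exists with V_{b_j}=V_{a_j} and b̂_j=1/â_j a.e. where fibers of V_{a_j} are nonzero. Any b of bounded spectrum with b̂_j=1/â_j a.e. also works. *)

theory Defs
  imports "HOL-Analysis.Analysis"
begin

section \<open>The space of square integrable functions\<close>

definition square_integrable :: "(real^'n \<Rightarrow> complex) \<Rightarrow> bool" where
  "square_integrable f \<longleftrightarrow>
     f \<in> borel_measurable lborel \<and> integrable lborel (\<lambda>x. (norm (f x))\<^sup>2)"

definition L2_eq :: "(real^'n \<Rightarrow> complex) \<Rightarrow> (real^'n \<Rightarrow> complex) \<Rightarrow> bool" where
  "L2_eq f g \<longleftrightarrow> square_integrable f \<and> square_integrable g \<and> (AE x in lborel. f x = g x)"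

lemma square_integrable_zero: "square_integrable (\<lambda>_. 0)"
  by (simp add: square_integrable_def)

lemma square_integrable_add:
  assumes "square_integrable f" "square_integrable g"
  shows "square_integrable (\<lambda>x. f x + g x)"
proof -
  have [measurable]: "f \<in> borel_measurable lborel" "g \<in> borel_measurable lborel"
    using assms by (auto simp: square_integrable_def)
  have "integrable lborel (\<lambda>x. (norm (f x + g x))\<^sup>2)"
  proof (rule Bochner_Integration.integrable_bound)
    show "integrable lborel (\<lambda>x. 2 * (norm (f x))\<^sup>2 + 2 * (norm (g x))\<^sup>2)"
      using assms by (auto simp: square_integrable_def)
    have "(norm (u + v))\<^sup>2 \<le> 2 * (norm u)\<^sup>2 + 2 * (norm v)\<^sup>2" for u v :: complex
    proof -
      have "(norm (u + v))\<^sup>2 \<le> (norm u + norm v)\<^sup>2"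
        by (intro power_mono norm_triangle_ineq) auto
      also have "\<dots> \<le> 2 * (norm u)\<^sup>2 + 2 * (norm v)\<^sup>2"
        using sum_squares_bound[of "norm u" "norm v"] by (simp add: power2_sum)
      finally show ?thesis .
    qed
    then show "AE x in lborel. norm ((norm (f x + g x))\<^sup>2)
                 \<le> norm (2 * (norm (f x))\<^sup>2 + 2 * (norm (g x))\<^sup>2)"
      by auto
  qed measurable
  then show ?thesis by (simp add: square_integrable_def)
qed

lemma square_integrable_cmult:
  "square_integrable f \<Longrightarrow> square_integrable (\<lambda>x. c * f x)"
  by (auto simp: square_integrable_def norm_mult power_mult_distrib)

lemma square_integrable_shift:
  assumes "square_integrable f"
  shows "square_integrable (\<lambda>x. f (x - a))"
proof -
  have [measurable]: "f \<in> borel_measurable borel"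
    using assms by (auto simp: square_integrable_def)
  have "integrable (distr lborel borel (\<lambda>x. - a + x)) (\<lambda>x. (norm (f x))\<^sup>2)"
    using assms unfolding lborel_distr_plus by (simp add: square_integrable_def)
  then have "integrable lborel (\<lambda>x. (norm (f (- a + x)))\<^sup>2)"
    by (subst (asm) integrable_distr_eq) auto
  then show ?thesis by (simp add: square_integrable_def)
qed

lemma AE_lborel_shift:
  fixes a :: "'a::euclidean_space"
  assumes "AE x in lborel. P x"
  shows "AE x in lborel. P (x - a)"
proof -
  obtain N where N: "N \<in> null_sets lborel" "{x. \<not> P x} \<subseteq> N"
    using assms unfolding eventually_ae_filter by auto
  have N': "N \<in> null_sets (distr lborel borel (\<lambda>x. - a + x))"
    using N(1) unfolding lborel_distr_plus .
  have "(+) (- a) -` N \<in> null_sets lborel"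
    using N' by (subst (asm) null_sets_distr_iff) auto
  moreover have "(+) (- a) -` N = (\<lambda>x. x - a) -` N"
    by (auto simp: vimage_def)
  ultimately have "(\<lambda>x. x - a) -` N \<in> null_sets lborel"
    by simp
  then show ?thesis
    by (rule AE_I') (use N(2) in \<open>auto\<close>)
qed

lemma integrable_inner_square_integrable:
  assumes "square_integrable f" "square_integrable g"
  shows "integrable lborel (\<lambda>x. f x \<bullet> g x)"
proof (rule Bochner_Integration.integrable_bound)
  have [measurable]: "f \<in> borel_measurable lborel" "g \<in> borel_measurable lborel"
    using assms by (auto simp: square_integrable_def)
  show "(\<lambda>x. f x \<bullet> g x) \<in> borel_measurable lborel"
    by measurable
  show "integrable lborel (\<lambda>x. (norm (f x))\<^sup>2 + (norm (g x))\<^sup>2)"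
    using assms by (auto simp: square_integrable_def)
  have "\<bar>u \<bullet> v\<bar> \<le> (norm u)\<^sup>2 + (norm v)\<^sup>2" for u v :: complex
  proof -
    have "\<bar>u \<bullet> v\<bar> \<le> norm u * norm v" by (rule Cauchy_Schwarz_ineq2)
    moreover have "2 * (norm u * norm v) \<le> (norm u)\<^sup>2 + (norm v)\<^sup>2"
      using sum_squares_bound[of "norm u" "norm v"] by (simp add: mult_ac)
    moreover have "0 \<le> norm u * norm v" by simp
    ultimately show ?thesis by linarith
  qed
  then show "AE x in lborel. norm (f x \<bullet> g x) \<le> norm ((norm (f x))\<^sup>2 + (norm (g x))\<^sup>2)"
    by auto
qed

text \<open>
  \<open>'n L2\<close> is $L^2(\mathbb{R}^d)$ with \<open>d = CARD('n)\<close>, i.e. square integrable functions modulo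
  equality almost everywhere. Borel measurability of the representatives is no restriction,
  as every Lebesgue measurable function agrees almost everywhere with a Borel function.
\<close>

quotient_type (overloaded) 'n L2 = "real^'n::finite \<Rightarrow> complex" / partial: L2_eq
proof (rule part_equivpI)
  show "\<exists>f :: real^'n \<Rightarrow> complex. L2_eq f f"
    by (rule exI[of _ "\<lambda>_. 0"]) (simp add: L2_eq_def square_integrable_zero)
  show "symp (L2_eq :: (real^'n \<Rightarrow> complex) \<Rightarrow> _)"
    by (auto simp: symp_def L2_eq_def)
  show "transp (L2_eq :: (real^'n \<Rightarrow> complex) \<Rightarrow> _)"
    unfolding transp_def L2_eq_def by (auto elim: AE_mp)
qed

lift_definition cscale :: "complex \<Rightarrow> 'n::finite L2 \<Rightarrow> 'n L2" is "\<lambda>c f x. c * f x"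
  by (auto simp: L2_eq_def intro!: square_integrable_cmult)

instantiation L2 :: (finite) real_vector
begin

lift_definition zero_L2 :: "'a L2" is "\<lambda>_. 0"
  by (simp add: L2_eq_def square_integrable_zero)

lift_definition plus_L2 :: "'a L2 \<Rightarrow> 'a L2 \<Rightarrow> 'a L2" is "\<lambda>f g x. f x + g x"
  by (auto simp: L2_eq_def intro!: square_integrable_add)

definition uminus_L2 :: "'a L2 \<Rightarrow> 'a L2" where "uminus_L2 f = cscale (- 1) f"

definition minus_L2 :: "'a L2 \<Rightarrow> 'a L2 \<Rightarrow> 'a L2" where "minus_L2 f g = f + (- g)"

definition scaleR_L2 :: "real \<Rightarrow> 'a L2 \<Rightarrow> 'a L2" where "scaleR_L2 r f = cscale (of_real r) f"

instance
proof
  fix f g h :: "'a L2" and r s :: real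
  note eqs = L2_eq_def square_integrable_add square_integrable_cmult square_integrable_zero
  show "f + g + h = f + (g + h)"
    by transfer (auto simp: eqs add.assoc)
  show "f + g = g + f"
    by transfer (auto simp: eqs add.commute)
  show "0 + f = f"
    by transfer (auto simp: eqs)
  show "- f + f = 0"
    unfolding uminus_L2_def
    by transfer (use square_integrable_add square_integrable_cmult[where c = "- 1"] in \<open>auto simp: eqs\<close>)
  show "f - g = f + - g"
    by (simp add: minus_L2_def)
  show "r *\<^sub>R (f + g) = r *\<^sub>R f + r *\<^sub>R g"
    unfolding scaleR_L2_def by transfer (auto simp: eqs ring_distribs)
  show "(r + s) *\<^sub>R f = r *\<^sub>R f + s *\<^sub>R f"
    unfolding scaleR_L2_def by transfer (auto simp: eqs ring_distribs)
  show "r *\<^sub>R s *\<^sub>R f = (r * s) *\<^sub>R f"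
    unfolding scaleR_L2_def by transfer (auto simp: eqs mult.assoc)
  show "1 *\<^sub>R f = f"
    unfolding scaleR_L2_def by transfer (auto simp: eqs)
qed

end

text \<open>
  The real inner product below is the real part of the usual Hermitian one; it induces the
  usual norm and topology.
\<close>

instantiation L2 :: (finite) real_inner
begin

lift_definition inner_L2 :: "'a L2 \<Rightarrow> 'a L2 \<Rightarrow> real" is "\<lambda>f g. \<integral>x. f x \<bullet> g x \<partial>lborel"
  by (rule integral_cong_AE) (auto simp: L2_eq_def square_integrable_def)

definition norm_L2 :: "'a L2 \<Rightarrow> real" where "norm_L2 f = sqrt (f \<bullet> f)"

definition sgn_L2 :: "'a L2 \<Rightarrow> 'a L2" where "sgn_L2 f = f /\<^sub>R norm f"

definition dist_L2 :: "'a L2 \<Rightarrow> 'a L2 \<Rightarrow> real" where "dist_L2 f g = norm (f - g)"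

definition uniformity_L2 :: "('a L2 \<times> 'a L2) filter" where
  "uniformity_L2 = (INF e\<in>{0<..}. principal {(f, g). dist f g < e})"

definition open_L2 :: "'a L2 set \<Rightarrow> bool" where
  "open_L2 U \<longleftrightarrow> (\<forall>f\<in>U. \<forall>\<^sub>F (f', g) in uniformity. f' = f \<longrightarrow> g \<in> U)"

instance
proof
  fix f g h :: "'a L2" and r :: real and U :: "'a L2 set"
  show "dist f g = norm (f - g)" "sgn f = f /\<^sub>R norm f" "norm f = sqrt (f \<bullet> f)"
    by (simp_all only: dist_L2_def sgn_L2_def norm_L2_def)
  show "uniformity = (INF e\<in>{0<..}. principal {(x, y :: 'a L2). dist x y < e})"
    by (simp only: uniformity_L2_def)
  show "open U \<longleftrightarrow> (\<forall>f\<in>U. \<forall>\<^sub>F (f', g) in uniformity. f' = f \<longrightarrow> g \<in> U)"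
    by (simp only: open_L2_def)
  show "f \<bullet> g = g \<bullet> f"
    by transfer (simp add: inner_commute)
  show "(f + g) \<bullet> h = f \<bullet> h + g \<bullet> h"
    by transfer (simp add: L2_eq_def inner_add_left integrable_inner_square_integrable)
  show "(r *\<^sub>R f) \<bullet> g = r * (f \<bullet> g)"
    unfolding scaleR_L2_def
    by transfer (simp add: L2_eq_def scaleR_conv_of_real[symmetric] integrable_inner_square_integrable)
  show "0 \<le> f \<bullet> f"
    by transfer simp
  show "f \<bullet> f = 0 \<longleftrightarrow> f = 0"
  proof transfer
    fix f :: "real^'a \<Rightarrow> complex"
    assume "L2_eq f f"
    then have f: "square_integrable f" by (simp add: L2_eq_def)
    have "(\<integral>x. f x \<bullet> f x \<partial>lborel) = 0 \<longleftrightarrow> (AE x in lborel. f x \<bullet> f x = 0)"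
      by (rule integral_nonneg_eq_0_iff_AE)
        (use f in \<open>auto intro: integrable_inner_square_integrable\<close>)
    then show "(\<integral>x. f x \<bullet> f x \<partial>lborel) = 0 \<longleftrightarrow> L2_eq f (\<lambda>_. 0)"
      using f by (simp add: L2_eq_def square_integrable_zero)
  qed
qed

end

global_interpretation L2: vector_space "cscale :: complex \<Rightarrow> 'n::finite L2 \<Rightarrow> 'n L2"
proof
  fix a b :: complex and f g :: "'n L2"
  note eqs = L2_eq_def square_integrable_add square_integrable_cmult square_integrable_zero
  show "cscale a (f + g) = cscale a f + cscale a g"
    by transfer (auto simp: eqs ring_distribs)
  show "cscale (a + b) f = cscale a f + cscale b f"
    by transfer (auto simp: eqs ring_distribs)
  show "cscale a (cscale b f) = cscale (a * b) f"
    by transfer (auto simp: eqs mult.assoc)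
  show "cscale 1 f = f"
    by transfer (auto simp: eqs)
qed


section \<open>Integer shifts\<close>

definition of_int_vec :: "int^'n \<Rightarrow> real^'n" where
  "of_int_vec k = (\<chi> i. of_int (k $ i))"

lift_definition shift :: "int^'n::finite \<Rightarrow> 'n L2 \<Rightarrow> 'n L2" is "\<lambda>k f x. f (x - of_int_vec k)"
  unfolding L2_eq_def by (intro conjI square_integrable_shift AE_lborel_shift) auto

definition shift_invariant :: "'n::finite L2 set \<Rightarrow> bool" where
  "shift_invariant V \<longleftrightarrow> L2.subspace V \<and> closed V \<and> (\<forall>k. \<forall>f\<in>V. shift k f \<in> V)"

definition finitely_generated :: "'n::finite L2 set \<Rightarrow> bool" where
  "finitely_generated V \<longleftrightarrow>
     (\<exists>\<Phi>. finite \<Phi> \<and> V = closure (L2.span {shift k \<phi> | k \<phi>. \<phi> \<in> \<Phi>}))"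

text \<open>
  An operator on \<open>V\<close> is a function on all of \<open>L2\<close> of which only the values on \<open>V\<close> matter.
\<close>

definition shift_preserving :: "'n::finite L2 set \<Rightarrow> ('n L2 \<Rightarrow> 'n L2) \<Rightarrow> bool" where
  "shift_preserving V L \<longleftrightarrow>
     (\<forall>f\<in>V. L f \<in> V) \<and>
     (\<forall>f\<in>V. \<forall>g\<in>V. L (f + g) = L f + L g) \<and>
     (\<forall>c. \<forall>f\<in>V. L (cscale c f) = cscale c (L f)) \<and>
     (\<exists>C. \<forall>f\<in>V. norm (L f) \<le> C * norm f) \<and>
     (\<forall>k. \<forall>f\<in>V. L (shift k f) = shift k (L f))"


section \<open>Fourier transform and fibers\<close>

definition fourier_integral :: "(real^'n \<Rightarrow> complex) \<Rightarrow> real^'n \<Rightarrow> complex" where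
  "fourier_integral f \<omega> = (\<integral>x. f x * cis (- 2 * pi * (\<omega> \<bullet> x)) \<partial>lborel)"

text \<open>
  The Fourier transform on $L^2$ is the unique continuous map which is given by the Fourier
  integral on $L^1 \cap L^2$ (Plancherel).
\<close>

definition fourier :: "'n::finite L2 \<Rightarrow> 'n L2" where
  "fourier = (THE F. continuous_on UNIV F \<and>
     (\<forall>f. square_integrable f \<and> integrable lborel f \<longrightarrow>
        (AE \<omega> in lborel. rep_L2 (F (abs_L2 f)) \<omega> = fourier_integral f \<omega>)))"

text \<open>
  \<open>fiber f \<omega>\<close> is $\mathcal{T}f(\omega)$. As \<open>rep_L2\<close> chooses a representative, it is meaningful
  only for almost every \<open>\<omega>\<close>.
\<close>

definition fiber :: "'n::finite L2 \<Rightarrow> real^'n \<Rightarrow> int^'n \<Rightarrow> complex" where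
  "fiber f \<omega> k = rep_L2 (fourier f) (\<omega> + of_int_vec k)"

definition unit_cube :: "(real^'n) set" where
  "unit_cube = {\<omega>. \<forall>i. 0 \<le> \<omega> $ i \<and> \<omega> $ i < 1}"


section \<open>Sequences of bounded spectrum\<close>

definition l2_seq :: "(int^'n \<Rightarrow> complex) \<Rightarrow> bool" where
  "l2_seq a \<longleftrightarrow> (\<lambda>k. (norm (a k))\<^sup>2) summable_on UNIV"

text \<open>
  For \<open>a\<close> in $\ell^2$ the series defining $\hat a$ converges in $L^2([0,1)^d)$, in general not
  pointwise, so that \<open>seq_fourier a\<close> is determined almost everywhere on the cube only.
\<close>

definition seq_fourier :: "(int^'n \<Rightarrow> complex) \<Rightarrow> real^'n \<Rightarrow> complex" where
  "seq_fourier a = (SOME g. g \<in> borel_measurable lborel \<and>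
     ((\<lambda>K. \<integral>\<^sup>+\<omega>\<in>unit_cube. ennreal ((norm
          ((\<Sum>k\<in>K. a k * cis (- 2 * pi * (\<omega> \<bullet> of_int_vec k))) - g \<omega>))\<^sup>2) \<partial>lborel)
        \<longlongrightarrow> 0) (finite_subsets_at_top UNIV))"

definition ess_bounded :: "(real^'n \<Rightarrow> complex) \<Rightarrow> bool" where
  "ess_bounded g \<longleftrightarrow> (\<exists>C. AE \<omega> in lborel. \<omega> \<in> unit_cube \<longrightarrow> norm (g \<omega>) \<le> C)"

definition bounded_spectrum :: "(int^'n \<Rightarrow> complex) \<Rightarrow> bool" where
  "bounded_spectrum a \<longleftrightarrow> l2_seq a \<and> ess_bounded (seq_fourier a)"

definition Lambda :: "(int^'n \<Rightarrow> complex) \<Rightarrow> 'n::finite L2 \<Rightarrow> 'n L2" where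
  "Lambda a f = (THE h. AE \<omega> in lborel. \<omega> \<in> unit_cube \<longrightarrow>
     (\<forall>k. fiber h \<omega> k = seq_fourier a \<omega> * fiber f \<omega> k))"


section \<open>s-diagonalization\<close>

definition s_eigenspace ::
  "'n::finite L2 set \<Rightarrow> ('n L2 \<Rightarrow> 'n L2) \<Rightarrow> (int^'n \<Rightarrow> complex) \<Rightarrow> 'n L2 set" where
  "s_eigenspace V L a = {f \<in> V. L f = Lambda a f}"

definition s_eigenvalue ::
  "'n::finite L2 set \<Rightarrow> ('n L2 \<Rightarrow> 'n L2) \<Rightarrow> (int^'n \<Rightarrow> complex) \<Rightarrow> bool" where
  "s_eigenvalue V L a \<longleftrightarrow> bounded_spectrum a \<and> s_eigenspace V L a \<noteq> {0}"

definition direct_sum :: "'n::finite L2 set \<Rightarrow> nat \<Rightarrow> (nat \<Rightarrow> 'n L2 set) \<Rightarrow> bool" where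
  "direct_sum V m W \<longleftrightarrow>
     V = {\<Sum>j<m. f j | f. \<forall>j<m. f j \<in> W j} \<and>
     (\<forall>f. (\<forall>j<m. f j \<in> W j) \<and> (\<Sum>j<m. f j) = 0 \<longrightarrow> (\<forall>j<m. f j = 0))"

definition s_diagonalization ::
  "'n::finite L2 set \<Rightarrow> ('n L2 \<Rightarrow> 'n L2) \<Rightarrow> (int^'n \<Rightarrow> complex) list \<Rightarrow> bool" where
  "s_diagonalization V L a \<longleftrightarrow>
     (\<forall>j<length a. s_eigenvalue V L (a ! j)) \<and>
     direct_sum V (length a) (\<lambda>j. s_eigenspace V L (a ! j))"

definition s_diagonalizable :: "'n::finite L2 set \<Rightarrow> ('n L2 \<Rightarrow> 'n L2) \<Rightarrow> bool" where
  "s_diagonalizable V L \<longleftrightarrow> (\<exists>a. s_diagonalization V L a)"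

end

theory Submission
  imports "HOL-Probability.Characteristic_Functions" Defs
begin

text \<open>
  The Fourier transform turns everything into multiplication: \<open>Lambda a\<close> is the Fourier multiplier
  whose symbol is the periodic extension of \<open>seq_fourier a\<close>
  (\<open>Lambda_eq_fourier_multiplier\<close>). Shifts are multipliers by characters, and every bounded periodic
  symbol is almost everywhere the limit of uniformly bounded trigonometric polynomials; as \<open>V\<close> is closed and
  \<open>L\<close> is bounded, all multipliers with periodic symbol therefore preserve \<open>V\<close> and commute with \<open>L\<close>
  (\<open>fourier_multiplier_commutes\<close>).

  Let \<open>b\<close> have a symbol inverse to that of \<open>a\<close>, and write \<open>A\<close> and \<open>B\<close> for the two multipliers. On
  the eigenspace of \<open>a\<close> one has \<open>L f = A f\<close>, hence \<open>L (B f) = B (L f) = B (A f) = f\<close>, which says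
  that \<open>f\<close> is in the eigenspace of \<open>b\<close> for the inverse of \<open>L\<close>; the converse is similar. Where no fiber of
  the eigenspace lives, the symbol of \<open>b\<close> may vanish instead (\<open>eigenspace_inverse\<close>); in particular the convention
  that zero is its own inverse is harmless, because \<open>L\<close> is injective and so no fiber lives where the symbol of \<open>a\<close> vanishes. A diagonalization is a condition on the eigenspaces alone, so it carries over from \<open>L\<close>
  to its inverse.

  For the existence of \<open>b\<close> the inverse of \<open>seq_fourier a\<close> must be bounded where such fibers
  live. This is where bijectivity of \<open>L\<close> enters quantitatively: on the eigenspace \<open>L\<close> is multiplication by the
  symbol, and it would fail to be onto if the symbol came arbitrarily close to zero there
  (\<open>symbol_bounded_below_on_eigenspace\<close>, a gliding hump argument). The inverse
  is therefore cut off below this bound, and the resulting bounded function is the Fourier series of some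
  \<open>b\<close> (\<open>bounded_function_is_seq_fourier\<close>).

  The analytic foundations are completeness of \<open>L2\<close>, Plancherel's theorem together with surjectivity of
  the Fourier transform (\<open>Plancherel_L1_L2\<close>, \<open>fourier_adjoint\<close>), and convergence of Fourier
  series in the mean. Surjectivity follows since the transform and its adjoint are
  both isometries.
\<close>

section \<open>The Hilbert space of square integrable functions\<close>

lemma L2_eq_rep: "L2_eq (rep_L2 f) (rep_L2 f)"
  using Quotient3_L2 Quotient3_rep_reflp by fastforce

lemma square_integrable_rep: "square_integrable (rep_L2 f)"
  using L2_eq_rep[of f] by (simp add: L2_eq_def)

lemma rep_L2_measurable [measurable]: "rep_L2 f \<in> borel_measurable borel"
  using square_integrable_rep[of f] by (simp add: square_integrable_def)

lemma square_integrable_rep_integrable: "integrable lborel (\<lambda>x. (norm (rep_L2 f x))\<^sup>2)"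
  using square_integrable_rep[of f] by (simp add: square_integrable_def)

lemma abs_rep_L2 [simp]: "abs_L2 (rep_L2 f) = f"
  using Quotient3_L2 Quotient3_abs_rep by fastforce

lemma abs_L2_eq_iff:
  assumes "square_integrable f" "square_integrable g"
  shows "abs_L2 f = abs_L2 g \<longleftrightarrow> (AE x in lborel. f x = g x)"
proof -
  have "L2_eq f f" "L2_eq g g"
    using assms by (auto simp: L2_eq_def)
  then have "L2_eq f g \<longleftrightarrow> abs_L2 f = abs_L2 g"
    using Quotient3_rel[OF Quotient3_L2, of f g] by blast
  then show ?thesis
    using assms by (auto simp: L2_eq_def)
qed

lemma rep_abs_L2:
  assumes "square_integrable f"
  shows "AE x in lborel. rep_L2 (abs_L2 f) x = f x"
  using abs_L2_eq_iff[OF square_integrable_rep assms, of "abs_L2 f"] by simp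

lemma cscale_abs: "square_integrable f \<Longrightarrow> cscale c (abs_L2 f) = abs_L2 (\<lambda>x. c * f x)"
  by (rule cscale.abs_eq) (simp add: L2_eq_def)

lemma plus_abs:
  "square_integrable f \<Longrightarrow> square_integrable g \<Longrightarrow> abs_L2 f + abs_L2 g = abs_L2 (\<lambda>x. f x + g x)"
  by (rule plus_L2.abs_eq) (simp_all add: L2_eq_def)

lemma shift_abs: "square_integrable f \<Longrightarrow> shift k (abs_L2 f) = abs_L2 (\<lambda>x. f (x - of_int_vec k))"
  by (rule shift.abs_eq) (simp add: L2_eq_def)

lemma rep_cscale: "AE x in lborel. rep_L2 (cscale c f) x = c * rep_L2 f x"
  using rep_abs_L2[OF square_integrable_cmult[OF square_integrable_rep, of c f]]
    cscale_abs[OF square_integrable_rep, of c f] by simp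

lemma rep_add: "AE x in lborel. rep_L2 (f + g) x = rep_L2 f x + rep_L2 g x"
  using rep_abs_L2[OF square_integrable_add[OF square_integrable_rep square_integrable_rep, of f g]]
    plus_abs[OF square_integrable_rep square_integrable_rep, of f g] by simp

lemma uminus_cscale: "- f = cscale (- 1) (f :: 'n::finite L2)"
  by (fact uminus_L2_def)

lemma scaleR_cscale: "r *\<^sub>R f = cscale (of_real r) (f :: 'n::finite L2)"
  by (fact scaleR_L2_def)

lemma diff_cscale: "f - g = f + cscale (- 1) (g :: 'n::finite L2)"
  by (simp only: minus_L2_def uminus_cscale)

lemma rep_diff: "AE x in lborel. rep_L2 (f - g) x = rep_L2 f x - rep_L2 g x"
  unfolding diff_cscale using rep_add[of f "cscale (-1) g"] rep_cscale[of "-1" g]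
  by eventually_elim simp

lemma square_integrable_diff:
  "square_integrable f \<Longrightarrow> square_integrable g \<Longrightarrow> square_integrable (\<lambda>x. f x - g x)"
  using square_integrable_add[of f "\<lambda>x. (-1) * g x"] square_integrable_cmult[of g "-1"] by simp

lemma diff_abs:
  assumes "square_integrable f" "square_integrable g" 
  shows "abs_L2 f - abs_L2 g = abs_L2 (\<lambda>x. f x - g x)"
  unfolding diff_cscale cscale_abs[OF assms(2)]
  using plus_abs[OF assms(1) square_integrable_cmult[OF assms(2), of "- 1"]] by simp

lemma inner_abs:
  assumes "square_integrable f" "square_integrable g"
  shows "abs_L2 f \<bullet> abs_L2 g = (\<integral>x. f x \<bullet> g x \<partial>lborel)"
  by (rule inner_L2.abs_eq) (use assms in \<open>simp_all add: L2_eq_def\<close>)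

lemma norm_abs_sq:
  assumes "square_integrable f" 
  shows "(norm (abs_L2 f))\<^sup>2 = (\<integral>x. (norm (f x))\<^sup>2 \<partial>lborel)"
  using inner_abs[OF assms assms] by (simp add: power2_norm_eq_inner)

lemma nn_integral_norm_sq:
  assumes "square_integrable f"
  shows "(\<integral>\<^sup>+x. ennreal ((norm (f x))\<^sup>2) \<partial>lborel) = ennreal ((norm (abs_L2 f))\<^sup>2)"
  using assms unfolding norm_abs_sq[OF assms]
  by (intro nn_integral_eq_integral) (auto simp: square_integrable_def)

lemma norm_rep_sq: "(norm f)\<^sup>2 = (\<integral>x. (norm (rep_L2 f x))\<^sup>2 \<partial>lborel)"
  using norm_abs_sq[OF square_integrable_rep, of f] by simp

lemma nn_integral_rep_sq: "(\<integral>\<^sup>+x. ennreal ((norm (rep_L2 f x))\<^sup>2) \<partial>lborel) = ennreal ((norm f)\<^sup>2)"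
  using nn_integral_norm_sq[OF square_integrable_rep, of f] by simp

lemma square_integrableI_nn:
  assumes "f \<in> borel_measurable lborel" "(\<integral>\<^sup>+x. ennreal ((norm (f x))\<^sup>2) \<partial>lborel) < \<infinity>"
  shows "square_integrable f"
  using assms by (auto simp: square_integrable_def integrable_iff_bounded)

lemma norm_le_nn:
  assumes "square_integrable f" "(\<integral>\<^sup>+x. ennreal ((norm (f x))\<^sup>2) \<partial>lborel) \<le> ennreal (e\<^sup>2)" "e \<ge> 0"
  shows "norm (abs_L2 f) \<le> e"
  using assms(2,3) unfolding nn_integral_norm_sq[OF assms(1)]
  by (simp add: power2_le_iff_abs_le)

lemma norm_cscale: "norm (cscale c f) = norm c * norm (f :: 'n::finite L2)"
proof -
  have "cscale c f = abs_L2 (\<lambda>x. c * rep_L2 f x)"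
    using cscale_abs[OF square_integrable_rep, of c f] by simp
  then have "(norm (cscale c f))\<^sup>2 = (norm c * norm f)\<^sup>2"
    using norm_abs_sq[OF square_integrable_cmult[OF square_integrable_rep, of c f]] norm_rep_sq[of f]
    by (simp add: norm_mult power_mult_distrib)
  then show ?thesis by simp
qed

text \<open>
  Norm bounds pass to almost everywhere limits. Applied to differences, this turns a
  pointwise limit into a limit in \<open>L2\<close>.
\<close>

lemma L2_Fatou:
  fixes u :: "nat \<Rightarrow> real^'n::finite \<Rightarrow> complex"
  assumes u: "\<forall>\<^sub>F n in sequentially. square_integrable (u n) \<and> norm (abs_L2 (u n)) \<le> e"
    and lim: "AE x in lborel. (\<lambda>n. u n x) \<longlonglongrightarrow> g x"
    and [measurable]: "g \<in> borel_measurable borel"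
  shows "square_integrable g" "norm (abs_L2 g) \<le> e"
proof -
  obtain N where N: "\<And>n. n \<ge> N \<Longrightarrow> square_integrable (u n)" "\<And>n. n \<ge> N \<Longrightarrow> norm (abs_L2 (u n)) \<le> e"
    using u unfolding eventually_sequentially by blast
  have e: "e \<ge> 0" using N(2)[of N] norm_ge_zero order_trans by blast
  have [measurable]: "u (n + N) \<in> borel_measurable lborel" for n
    using N(1)[of "n+N"] by (simp add: square_integrable_def)
  have "(\<integral>\<^sup>+x. ennreal ((norm (g x))\<^sup>2) \<partial>lborel) 
      = (\<integral>\<^sup>+x. liminf (\<lambda>n. ennreal ((norm (u (n + N) x))\<^sup>2)) \<partial>lborel)"
  proof (rule nn_integral_cong_AE)
    show "AE x in lborel. ennreal ((norm (g x))\<^sup>2) = liminf (\<lambda>n. ennreal ((norm (u (n + N) x))\<^sup>2))"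
      using lim
    proof eventually_elim
      case (elim x)
      then have "(\<lambda>n. ennreal ((norm (u (n + N) x))\<^sup>2)) \<longlonglongrightarrow> ennreal ((norm (g x))\<^sup>2)"
        by (intro tendsto_intros) (rule LIMSEQ_ignore_initial_segment)
      then show ?case by (intro lim_imp_Liminf[symmetric]) simp_all
    qed
  qed
  also have "\<dots> \<le> liminf (\<lambda>n. \<integral>\<^sup>+x. ennreal ((norm (u (n + N) x))\<^sup>2) \<partial>lborel)"
    by (rule nn_integral_liminf) measurable
  also have "\<dots> \<le> ennreal (e\<^sup>2)"
  proof (rule Liminf_le)
    show "\<forall>\<^sub>F n in sequentially. (\<integral>\<^sup>+x. ennreal ((norm (u (n + N) x))\<^sup>2) \<partial>lborel) \<le> ennreal (e\<^sup>2)"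
      by (rule always_eventually)
        (auto simp: nn_integral_norm_sq[OF N(1)] intro!: ennreal_leI power_mono N(2))
  qed simp
  finally have *: "(\<integral>\<^sup>+x. ennreal ((norm (g x))\<^sup>2) \<partial>lborel) \<le> ennreal (e\<^sup>2)" .
  then show "square_integrable g"
    by (intro square_integrableI_nn) (auto intro: le_less_trans)
  then show "norm (abs_L2 g) \<le> e"
    using * e by (rule norm_le_nn)
qed

text \<open>
  The increments are summable almost everywhere: the integral of the sum of \<open>4\<^sup>n\<close> times the
  squared increments is finite, so that almost everywhere the increments are \<open>O(2\<^sup>-\<^sup>n)\<close>.
\<close>

lemma L2_fast_Cauchy_AE_convergent:
  fixes f :: "nat \<Rightarrow> 'n::finite L2"
  assumes f: "\<And>n. norm (f (Suc n) - f n) \<le> (1/4)^n"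
  shows "AE x in lborel. convergent (\<lambda>n. rep_L2 (f n) x)"
proof -
  have "(\<integral>\<^sup>+x. (\<Sum>n. ennreal (4^n * (norm (rep_L2 (f (Suc n) - f n) x))\<^sup>2)) \<partial>lborel)
      = (\<Sum>n. \<integral>\<^sup>+x. ennreal (4^n * (norm (rep_L2 (f (Suc n) - f n) x))\<^sup>2) \<partial>lborel)"
    by (rule nn_integral_suminf) measurable
  also have "\<dots> = (\<Sum>n. ennreal (4^n * (norm (f (Suc n) - f n))\<^sup>2))"
    by (simp add: ennreal_mult nn_integral_cmult nn_integral_rep_sq)
  also have "\<dots> \<le> (\<Sum>n. ennreal ((1/4)^n))"
  proof (intro suminf_le ennreal_leI)
    fix n
    have "4^n * (norm (f (Suc n) - f n))\<^sup>2 \<le> 4^n * ((1/4)^n)\<^sup>2"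
      by (intro mult_left_mono power_mono f) auto
    also have "\<dots> = (1/4::real)^n"
      by (simp add: power2_eq_square power_divide)
    finally show "4^n * (norm (f (Suc n) - f n))\<^sup>2 \<le> (1/4)^n" .
  qed auto
  also have "\<dots> < \<infinity>"
    by (subst suminf_ennreal_eq[OF _ geometric_sums]) auto
  finally have "AE x in lborel. (\<Sum>n. ennreal (4^n * (norm (rep_L2 (f (Suc n) - f n) x))\<^sup>2)) \<noteq> \<infinity>"
    by (intro nn_integral_PInf_AE) auto
  moreover have "AE x in lborel. \<forall>n. rep_L2 (f (Suc n) - f n) x = rep_L2 (f (Suc n)) x - rep_L2 (f n) x"
    by (simp add: AE_all_countable rep_diff)
  ultimately show ?thesis
  proof eventually_elim
    case (elim x)
    define d where "d n = norm (rep_L2 (f (Suc n)) x - rep_L2 (f n) x)" for n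
    define C where "C = enn2real (\<Sum>n. ennreal (4^n * (d n)\<^sup>2))"
    have C: "(\<Sum>n. ennreal (4^n * (d n)\<^sup>2)) = ennreal C"
      using elim by (simp add: C_def d_def less_top)
    have C0: "C \<ge> 0" by (simp add: C_def)
    have d: "d n \<le> sqrt C * (1/2)^n" for n
    proof -
      have "(\<Sum>k\<in>{n}. ennreal (4^k * (d k)\<^sup>2)) \<le> ennreal C"
        unfolding C[symmetric] by (rule sum_le_suminf) auto
      then have "4^n * (d n)\<^sup>2 \<le> C" using C0 by simp
      moreover have "(4::real)^n = (2^n)\<^sup>2" by (simp add: power2_eq_square flip: power_mult_distrib)
      ultimately have "(2^n * d n)\<^sup>2 \<le> C" by (simp add: power_mult_distrib)
      then have "2^n * d n \<le> sqrt C" using real_le_rsqrt by blast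
      then show ?thesis by (simp add: field_simps)
    qed
    have "summable (\<lambda>n. norm (rep_L2 (f (Suc n)) x - rep_L2 (f n) x))"
      by (rule summable_comparison_test'[of "\<lambda>n. sqrt C * (1/2)^n" 0])
        (use d in \<open>auto simp: d_def intro!: summable_mult summable_geometric\<close>)
    then have "summable (\<lambda>n. rep_L2 (f (Suc n)) x - rep_L2 (f n) x)"
      by (rule summable_norm_cancel)
    then have "convergent (\<lambda>n. rep_L2 (f n) x - rep_L2 (f 0) x)"
      unfolding summable_iff_convergent sum_lessThan_telescope[of "\<lambda>n. rep_L2 (f n) x"] .
    then show ?case
      using convergent_diff_const_right_iff by blast
  qed
qed

text \<open>
  A rapidly convergent subsequence of a Cauchy sequence has an almost everywhere limit, and
  Fatou's lemma shows that the whole sequence converges to it in norm (Riesz--Fischer).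
\<close>

instance L2 :: (finite) complete_space
proof
  fix X :: "nat \<Rightarrow> 'a L2"
  assume X: "Cauchy X"
  have "\<exists>N. \<forall>m\<ge>N. \<forall>k\<ge>N. norm (X m - X k) \<le> (1/4)^n" for n
    using CauchyD[OF X, of "(1/4)^n"] by (meson less_imp_le zero_less_divide_1_iff zero_less_numeral zero_less_power)
  then obtain N where N: "\<And>n m k. m \<ge> N n \<Longrightarrow> k \<ge> N n \<Longrightarrow> norm (X m - X k) \<le> (1/4)^n"
    by metis
  define M where "M n = (\<Sum>i\<le>n. N i)" for n
  have M: "M n \<ge> N n" "M (Suc n) \<ge> M n" for n
    by (auto simp: M_def intro: member_le_sum)
  have M': "M m \<ge> N n" if "m \<ge> n" for m n
    using M(1)[of n] lift_Suc_mono_le[of M, OF M(2) that] by simp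
  define f where "f n = X (M n)" for n
  have "norm (f (Suc n) - f n) \<le> (1/4)^n" for n
    unfolding f_def by (rule N) (auto intro: M')
  then have conv: "AE x in lborel. convergent (\<lambda>n. rep_L2 (f n) x)"
    by (rule L2_fast_Cauchy_AE_convergent)
  define g where "g x = lim (\<lambda>n. rep_L2 (f n) x)" for x
  have [measurable]: "g \<in> borel_measurable borel"
    unfolding g_def by (rule borel_measurable_lim_metric) measurable
  have lim: "AE x in lborel. (\<lambda>n. rep_L2 (f n) x) \<longlonglongrightarrow> g x"
    using conv by eventually_elim (simp add: g_def convergent_LIMSEQ_iff)
  have near: "square_integrable (\<lambda>x. g x - rep_L2 (X m) x)
      \<and> norm (abs_L2 (\<lambda>x. g x - rep_L2 (X m) x)) \<le> (1/4)^n" if "m \<ge> N n" for m n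
  proof -
    have ev: "\<forall>\<^sub>F k in sequentially. square_integrable (\<lambda>x. rep_L2 (f k) x - rep_L2 (X m) x) \<and>
        norm (abs_L2 (\<lambda>x. rep_L2 (f k) x - rep_L2 (X m) x)) \<le> (1/4)^n"
      using eventually_ge_at_top[of n]
    proof eventually_elim
      case (elim k)
      then show ?case
        using N[OF M' that, of k] 
        by (simp add: square_integrable_diff square_integrable_rep f_def flip: diff_abs)
    qed
    have "AE x in lborel. (\<lambda>k. rep_L2 (f k) x - rep_L2 (X m) x) \<longlonglongrightarrow> g x - rep_L2 (X m) x"
      using lim by eventually_elim (auto intro: tendsto_intros)
    then show ?thesis
      using L2_Fatou[OF ev] by simp
  qed
  have g: "square_integrable g"
    using square_integrable_add[OF conjunct1[OF near[OF order_refl, of 0]] square_integrable_rep[of "X (N 0)"]]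
    by simp
  have "X \<longlonglongrightarrow> abs_L2 g"
  proof (rule metric_LIMSEQ_I)
    fix e :: real assume "e > 0"
    then obtain n where n: "(1/4)^n < e"
      using real_arch_pow_inv[of e "1/4"] by auto
    have "dist (X m) (abs_L2 g) < e" if "m \<ge> N n" for m
      using near[OF that] n diff_abs[OF g square_integrable_rep, of "X m"]
      by (simp add: dist_norm norm_minus_commute)
    then show "\<exists>no. \<forall>m\<ge>no. dist (X m) (abs_L2 g) < e" by blast
  qed
  then show "convergent X" by (auto simp: convergent_def)
qed

section \<open>Approximation by continuous functions of bounded support\<close>

lemma L2_dominated_convergence:
  fixes u :: "nat \<Rightarrow> real^'n::finite \<Rightarrow> complex" and w :: "real^'n \<Rightarrow> real"
  assumes [measurable]: "\<And>n. u n \<in> borel_measurable borel" "f \<in> borel_measurable borel"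
    and w: "integrable lborel (\<lambda>x. (w x)\<^sup>2)"
    and bound: "\<And>n. AE x in lborel. norm (u n x) \<le> w x"
    and lim: "AE x in lborel. (\<lambda>n. u n x) \<longlonglongrightarrow> f x"
  shows "square_integrable (u n)" "square_integrable f"
    "(\<lambda>n. abs_L2 (u n)) \<longlonglongrightarrow> abs_L2 f"
proof -
  have u: "square_integrable (u n)" for n
    unfolding square_integrable_def
  proof (intro conjI Bochner_Integration.integrable_bound[OF w])
    show "AE x in lborel. norm ((norm (u n x))\<^sup>2) \<le> norm ((w x)\<^sup>2)"
      using bound[of n] by eventually_elim (auto intro!: power_mono)
  qed auto
  then show "square_integrable (u n)" .
  have fw: "AE x in lborel. norm (f x) \<le> w x"
  proof -
    have "AE x in lborel. \<forall>n. norm (u n x) \<le> w x"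
      using bound by (simp add: AE_all_countable)
    with lim show ?thesis
    proof eventually_elim
      case (elim x)
      show ?case
        by (rule tendsto_upperbound[OF tendsto_norm[OF elim(1)]]) (use elim(2) in auto)
    qed
  qed
  show f: "square_integrable f"
    unfolding square_integrable_def
  proof (intro conjI Bochner_Integration.integrable_bound[OF w])
    show "AE x in lborel. norm ((norm (f x))\<^sup>2) \<le> norm ((w x)\<^sup>2)"
      using fw by eventually_elim (auto intro!: power_mono)
  qed auto
  have "(\<lambda>n. \<integral>x. (norm (u n x - f x))\<^sup>2 \<partial>lborel) \<longlonglongrightarrow> (\<integral>x. 0 \<partial>(lborel :: (real^'n) measure))"
  proof (rule integral_dominated_convergence)
    show "integrable lborel (\<lambda>x. 4 * (w x)\<^sup>2)"
      using w by simp
    show "AE x in lborel. (\<lambda>n. (norm (u n x - f x))\<^sup>2) \<longlonglongrightarrow> 0"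
      using lim
    proof eventually_elim
      case (elim x)
      then have "(\<lambda>n. (norm (u n x - f x))\<^sup>2) \<longlonglongrightarrow> (norm (f x - f x))\<^sup>2"
        by (intro tendsto_intros)
      then show ?case by simp
    qed
    fix n
    show "AE x in lborel. norm ((norm (u n x - f x))\<^sup>2) \<le> 4 * (w x)\<^sup>2"
      using fw bound[of n]
    proof eventually_elim
      case (elim x)
      then have "norm (u n x - f x) \<le> 2 * w x"
        using norm_triangle_ineq4[of "u n x" "f x"] by linarith
      then have "(norm (u n x - f x))\<^sup>2 \<le> (2 * w x)\<^sup>2"
        by (intro power_mono) auto
      then show ?case by (simp add: power_mult_distrib)
    qed
  qed auto
  then have "(\<lambda>n. (norm (abs_L2 (u n) - abs_L2 f))\<^sup>2) \<longlonglongrightarrow> 0"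
    by (simp add: diff_abs u f norm_abs_sq square_integrable_diff)
  then have "(\<lambda>n. sqrt ((norm (abs_L2 (u n) - abs_L2 f))\<^sup>2)) \<longlonglongrightarrow> sqrt 0"
    by (rule tendsto_real_sqrt)
  then have "(\<lambda>n. norm (abs_L2 (u n) - abs_L2 f)) \<longlonglongrightarrow> 0"
    by simp
  then show "(\<lambda>n. abs_L2 (u n)) \<longlonglongrightarrow> abs_L2 f"
    by (simp add: LIM_zero_iff tendsto_norm_zero_iff)
qed

lemma L1_dominated_convergence:
  fixes u :: "nat \<Rightarrow> 'a::euclidean_space \<Rightarrow> complex"
  assumes [measurable]: "\<And>n. u n \<in> borel_measurable borel" "f \<in> borel_measurable borel"
    and w: "integrable lborel w"
    and bound: "\<And>n. AE x in lborel. norm (u n x) \<le> w x"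
    and lim: "AE x in lborel. (\<lambda>n. u n x) \<longlonglongrightarrow> f x"
  shows "integrable lborel (u n)" "(\<lambda>n. \<integral>x. norm (u n x - f x) \<partial>lborel) \<longlonglongrightarrow> 0"
proof -
  have fw: "AE x in lborel. norm (f x) \<le> w x"
  proof -
    have "AE x in lborel. \<forall>n. norm (u n x) \<le> w x"
      using bound by (simp add: AE_all_countable)
    with lim show ?thesis
    proof eventually_elim
      case (elim x)
      show ?case
        by (rule tendsto_upperbound[OF tendsto_norm[OF elim(1)]]) (use elim(2) in auto)
    qed
  qed
  show "integrable lborel (u n)"
    by (rule Bochner_Integration.integrable_bound[OF w]) (use bound[of n] in auto)
  have "(\<lambda>n. \<integral>x. norm (u n x - f x) \<partial>lborel) \<longlonglongrightarrow> (\<integral>x. 0 \<partial>(lborel :: 'a measure))"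
  proof (rule integral_dominated_convergence)
    show "integrable lborel (\<lambda>x. 2 * w x)"
      using w by simp
    show "AE x in lborel. (\<lambda>n. norm (u n x - f x)) \<longlonglongrightarrow> 0"
      using lim by eventually_elim (simp add: LIM_zero tendsto_norm_zero)
    fix n
    show "AE x in lborel. norm (norm (u n x - f x)) \<le> 2 * w x"
      using fw bound[of n]
    proof eventually_elim
      case (elim x)
      then show ?case
        using norm_triangle_ineq4[of "u n x" "f x"] by simp
    qed
  qed auto
  then show "(\<lambda>n. \<integral>x. norm (u n x - f x) \<partial>lborel) \<longlonglongrightarrow> 0"
    by simp
qed

text \<open>
  A measurable function is an almost everywhere limit of continuous ones. Composing these with the
  retraction onto a disc keeps the bound, which dominated convergence needs later.
\<close>

lemma bounded_measurable_AE_limit_continuous: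
  fixes f :: "'a::euclidean_space \<Rightarrow> complex"
  assumes f: "f \<in> borel_measurable borel" and C: "\<And>x. norm (f x) \<le> C"
  obtains g where "\<And>n. continuous_on UNIV (g n)" "\<And>n x. norm (g n x) \<le> C"
    "AE x in lborel. (\<lambda>n. g n x) \<longlonglongrightarrow> f x"
proof -
  have C0: "C \<ge> 0" using C[of undefined] norm_ge_zero order_trans by blast
  have "f \<in> borel_measurable lebesgue"
    using f by (simp add: measurable_completion)
  then have "f measurable_on UNIV"
    by (intro lebesgue_measurable_imp_measurable_on) auto
  then obtain N g where N: "negligible N" and g: "\<And>n. continuous_on UNIV (g n)"
    and lim: "\<And>x. x \<notin> N \<Longrightarrow> (\<lambda>n. g n x) \<longlonglongrightarrow> f x"
    unfolding measurable_on_def by auto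
  have cp: "continuous_on UNIV (closest_point (cball (0::complex) C))"
    by (rule continuous_on_closest_point) (use C0 in auto)
  let ?h = "\<lambda>n x. closest_point (cball 0 C) (g n x)"
  have "AE x in lebesgue. x \<notin> N"
    using N by (simp add: AE_not_in negligible_iff_null_sets)
  then have "AE x in lborel. x \<notin> N"
    by (simp add: AE_completion_iff)
  then have "AE x in lborel. (\<lambda>n. ?h n x) \<longlonglongrightarrow> f x"
  proof eventually_elim
    case (elim x)
    then have "(\<lambda>n. ?h n x) \<longlonglongrightarrow> closest_point (cball 0 C) (f x)"
      using cp lim by (intro isCont_tendsto_compose[of _ "closest_point (cball 0 C)"])
        (auto simp: continuous_on_eq_continuous_within)
    then show ?case using C[of x] by (simp add: closest_point_self)
  qed
  moreover have "norm (?h n x) \<le> C" for n x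
    using closest_point_in_set[of "cball (0::complex) C" "g n x"] C0 by auto
  moreover have "continuous_on UNIV (?h n)" for n
    by (rule continuous_on_compose2[OF cp g]) auto
  ultimately show ?thesis using that[of ?h] by blast
qed

definition bounded_support :: "('a::real_normed_vector \<Rightarrow> complex) \<Rightarrow> bool" where
  "bounded_support g \<longleftrightarrow> (\<exists>R. \<forall>x. norm x > R \<longrightarrow> g x = 0)"

lemma integrable_ball_const: "integrable lborel (\<lambda>x. c * indicator (cball 0 R) (x::'a::euclidean_space) :: real)"
  by (intro integrable_mult_right integrable_real_indicator) (auto simp: emeasure_bounded_finite[unfolded infinity_ennreal_def])

lemma L1_L2_approx_bounded:
  fixes f :: "real^'n::finite \<Rightarrow> complex"
  assumes [measurable]: "f \<in> borel_measurable borel" and C: "\<And>x. norm (f x) \<le> C"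
    and R: "\<And>x. norm x > R \<Longrightarrow> f x = 0" and e: "e > 0"
  obtains g where "continuous_on UNIV g" "bounded_support g" "square_integrable g" "integrable lborel g"
    "(\<integral>x. norm (g x - f x) \<partial>lborel) < e" "dist (abs_L2 g) (abs_L2 f) < e"
proof -
  obtain g where g: "\<And>n. continuous_on UNIV (g n)" "\<And>n x. norm (g n x) \<le> C"
    and lim: "AE x in lborel. (\<lambda>n. g n x) \<longlonglongrightarrow> f x"
    using bounded_measurable_AE_limit_continuous[OF assms(1) C] by metis
  \<comment> \<open>The cutoff makes the supports bounded without disturbing the limit, as \<open>f\<close> vanishes off the ball.\<close>
  define \<theta> where "\<theta> x = max 0 (min 1 (R + 1 - norm x))" for x :: "real^'n"
  define h where "h n x = \<theta> x *\<^sub>R g n x" for n x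
  have h: "continuous_on UNIV (h n)" for n
    unfolding h_def \<theta>_def by (intro continuous_intros g)
  then have [measurable]: "h n \<in> borel_measurable borel" for n
    by (rule borel_measurable_continuous_onI)
  have supp: "h n x = 0" if "norm x > R + 1" for n x
    using that by (simp add: h_def \<theta>_def)
  have hC: "norm (h n x) \<le> C * indicator (cball 0 (R+1)) x" for n x
  proof (cases "norm x > R + 1")
    case False
    have "\<bar>\<theta> x\<bar> * norm (g n x) \<le> 1 * C"
      by (intro mult_mono g) (auto simp: \<theta>_def)
    then show ?thesis using False by (simp add: h_def)
  qed (simp add: supp)
  have limh: "AE x in lborel. (\<lambda>n. h n x) \<longlonglongrightarrow> f x"
    using lim
  proof eventually_elim
    case (elim x)
    then have "(\<lambda>n. h n x) \<longlonglongrightarrow> \<theta> x *\<^sub>R f x"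
      unfolding h_def by (intro tendsto_intros)
    moreover have "\<theta> x *\<^sub>R f x = f x"
      using R[of x] by (cases "norm x > R") (auto simp: \<theta>_def)
    ultimately show ?case by simp
  qed
  have sq: "(\<lambda>x. (C * indicator (cball 0 (R+1)) x)\<^sup>2) = (\<lambda>x. C\<^sup>2 * indicator (cball 0 (R+1)) (x::real^'n) :: real)"
    by (auto simp: indicator_def)
  have w2: "integrable lborel (\<lambda>x::real^'n. (C * indicator (cball 0 (R+1)) x)\<^sup>2)"
    unfolding sq by (rule integrable_ball_const)
  note L1 = L1_dominated_convergence[of h f, OF _ _ integrable_ball_const AE_I2[OF hC] limh]
  note L2 = L2_dominated_convergence[of h f, OF _ _ w2 AE_I2[OF hC] limh]
  have "\<forall>\<^sub>F n in sequentially. (\<integral>x. norm (h n x - f x) \<partial>lborel) < e"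
    using L1(2) e by (intro order_tendstoD) auto
  moreover have "\<forall>\<^sub>F n in sequentially. dist (abs_L2 (h n)) (abs_L2 f) < e"
    using L2(3) e by (intro tendstoD) auto
  ultimately have "\<forall>\<^sub>F n in sequentially. (\<integral>x. norm (h n x - f x) \<partial>lborel) < e \<and> dist (abs_L2 (h n)) (abs_L2 f) < e"
    by eventually_elim simp
  then obtain n where n: "(\<integral>x. norm (h n x - f x) \<partial>lborel) < e" "dist (abs_L2 (h n)) (abs_L2 f) < e"
    by (auto simp: eventually_sequentially)
  show ?thesis
  proof (rule that[of "h n"])
    show "bounded_support (h n)" using supp by (auto simp: bounded_support_def)
    show "square_integrable (h n)" "integrable lborel (h n)"
      using L1(1) L2(1) by auto
  qed (use n h in auto)
qed

definition truncate :: "nat \<Rightarrow> ('a::real_normed_vector \<Rightarrow> complex) \<Rightarrow> 'a \<Rightarrow> complex" where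
  "truncate N f x = (if norm x \<le> N \<and> norm (f x) \<le> N then f x else 0)"

lemma truncate_measurable [measurable]:
  fixes f :: "'a::euclidean_space \<Rightarrow> complex"
  assumes [measurable]: "f \<in> borel_measurable borel"
  shows "truncate N f \<in> borel_measurable borel"
  unfolding truncate_def[abs_def] by measurable

lemma truncate_bounds:
  "norm (truncate N f x) \<le> norm (f x)" "norm (truncate N f x) \<le> N"
  "norm x > N \<Longrightarrow> truncate N f x = 0"
  by (auto simp: truncate_def)

lemma truncate_tendsto: "(\<lambda>N. truncate N f x) \<longlonglongrightarrow> f x"
proof (rule tendsto_eventually)
  show "\<forall>\<^sub>F N in sequentially. truncate N f x = f x"
    using eventually_ge_at_top[of "nat \<lceil>max (norm x) (norm (f x))\<rceil>"]
  proof eventually_elim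
    case (elim N)
    then have "norm x \<le> N" "norm (f x) \<le> N" by linarith+
    then show ?case by (simp add: truncate_def)
  qed
qed

lemma truncate_L1_L2:
  fixes f :: "real^'n::finite \<Rightarrow> complex"
  assumes "f \<in> borel_measurable borel"
  shows "square_integrable (truncate N f)" "integrable lborel (truncate N f)"
proof -
  note [measurable] = assms
  have b: "norm (truncate N f x) \<le> real N * indicator (cball 0 (real N)) x" for x
    using truncate_bounds[where f=f and N=N and x=x] by (cases "norm x > N") auto
  show "integrable lborel (truncate N f)"
    by (rule Bochner_Integration.integrable_bound[OF integrable_ball_const[of "real N" "real N"]])
      (auto simp del: of_bool_eq indicator_simps simp: abs_mult intro!: AE_I2 order_trans[OF b])
  have b2: "(norm (truncate N f x))\<^sup>2 \<le> (real N)\<^sup>2 * indicator (cball 0 (real N)) x" for x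
    using truncate_bounds[where f=f and N=N and x=x] by (cases "norm x > N") (auto intro: power_mono)
  show "square_integrable (truncate N f)"
    unfolding square_integrable_def
  proof (intro conjI Bochner_Integration.integrable_bound[OF integrable_ball_const[of "(real N)\<^sup>2" "real N"]])
    show "AE x in lborel. norm ((norm (truncate N f x))\<^sup>2) \<le> norm ((real N)\<^sup>2 * indicator (cball 0 (real N)) x)"
      using b2 by (auto simp del: of_bool_eq indicator_simps simp: abs_mult intro!: AE_I2)
  qed auto
qed

lemma truncate_tendsto_L2:
  fixes f :: "real^'n::finite \<Rightarrow> complex"
  assumes "square_integrable f"
  shows "(\<lambda>N. abs_L2 (truncate N f)) \<longlonglongrightarrow> abs_L2 f"
proof -
  have [measurable]: "f \<in> borel_measurable borel"
    using assms by (simp add: square_integrable_def)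
  show ?thesis
    by (rule L2_dominated_convergence(3)[where w = "\<lambda>x. norm (f x)"])
      (use assms in \<open>auto simp: square_integrable_def truncate_bounds truncate_tendsto\<close>)
qed

text \<open>
  The approximation has to be good in both norms at once: the first controls the Fourier integral
  pointwise, the second in the mean.
\<close>

lemma L1_L2_approx_continuous:
  fixes f :: "real^'n::finite \<Rightarrow> complex"
  assumes f: "square_integrable f" and fi: "integrable lborel f" and e: "e > 0"
  obtains g where "continuous_on UNIV g" "bounded_support g" "square_integrable g" "integrable lborel g"
    "(\<integral>x. norm (g x - f x) \<partial>lborel) < e" "dist (abs_L2 g) (abs_L2 f) < e"
proof -
  have [measurable]: "f \<in> borel_measurable borel"
    using f by (simp add: square_integrable_def)
  have "(\<lambda>N. \<integral>x. norm (truncate N f x - f x) \<partial>lborel) \<longlonglongrightarrow> 0"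
    by (rule L1_dominated_convergence(2)[where w = "\<lambda>x. norm (f x)"])
      (use fi in \<open>auto simp: truncate_bounds truncate_tendsto\<close>)
  then have "\<forall>\<^sub>F N in sequentially. (\<integral>x. norm (truncate N f x - f x) \<partial>lborel) < e/2"
    using e by (intro order_tendstoD) auto
  moreover have "\<forall>\<^sub>F N in sequentially. dist (abs_L2 (truncate N f)) (abs_L2 f) < e/2"
    using truncate_tendsto_L2[OF f] e by (intro tendstoD) auto
  ultimately have "\<forall>\<^sub>F N in sequentially. (\<integral>x. norm (truncate N f x - f x) \<partial>lborel) < e/2
      \<and> dist (abs_L2 (truncate N f)) (abs_L2 f) < e/2"
    by eventually_elim simp
  then obtain N where N: "(\<integral>x. norm (truncate N f x - f x) \<partial>lborel) < e/2"
    "dist (abs_L2 (truncate N f)) (abs_L2 f) < e/2"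
    by (auto simp: eventually_sequentially)
  obtain g where g: "continuous_on UNIV g" "bounded_support g" "square_integrable g" "integrable lborel g"
    "(\<integral>x. norm (g x - truncate N f x) \<partial>lborel) < e/2" "dist (abs_L2 g) (abs_L2 (truncate N f)) < e/2"
    by (rule L1_L2_approx_bounded[of "truncate N f" N N "e/2"])
      (use e truncate_bounds in \<open>auto\<close>)
  have "(\<integral>x. norm (g x - f x) \<partial>lborel) \<le> (\<integral>x. norm (g x - truncate N f x) + norm (truncate N f x - f x) \<partial>lborel)"
    using g fi truncate_L1_L2[of f N]
    by (intro integral_mono) (auto intro: norm_triangle_le_diff simp: norm_diff_triangle_ineq
        intro!: norm_diff_triangle_le[OF order_refl order_refl])
  also have "\<dots> = (\<integral>x. norm (g x - truncate N f x) \<partial>lborel) + (\<integral>x. norm (truncate N f x - f x) \<partial>lborel)"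
    using g fi truncate_L1_L2[of f N] by (intro Bochner_Integration.integral_add) auto
  finally show ?thesis
    using that[OF g(1-4)] g(5,6) N dist_triangle_half_l[of "abs_L2 g" "abs_L2 (truncate N f)" e "abs_L2 f"]
    by (auto simp: dist_commute intro: dist_triangle_lt)
qed

section \<open>The Fourier integral\<close>

lemma lborel_eq_affine:
  fixes t :: "'a::euclidean_space"
  assumes "c \<noteq> 0"
  shows "lborel = density (distr lborel borel (\<lambda>x. t + c *\<^sub>R x)) (\<lambda>_. ennreal (\<bar>c\<bar>^DIM('a)))"
  using lborel_affine[OF assms, of t] by (simp add: ennreal_power)

lemma integral_affine:
  fixes f :: "'a::euclidean_space \<Rightarrow> 'b::{banach, second_countable_topology}"
  assumes [measurable]: "f \<in> borel_measurable borel" and c: "c \<noteq> 0"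
  shows "(\<integral>x. f x \<partial>lborel) = \<bar>c\<bar>^DIM('a) *\<^sub>R (\<integral>x. f (t + c *\<^sub>R x) \<partial>lborel)"
  by (subst lborel_eq_affine[OF c, of t]) (simp add: integral_density integral_distr)

lemma integrable_affine:
  fixes f :: "'a::euclidean_space \<Rightarrow> 'b::{banach, second_countable_topology}"
  assumes f: "integrable lborel f" and c: "c \<noteq> 0"
  shows "integrable lborel (\<lambda>x. f (t + c *\<^sub>R x))"
proof -
  have [measurable]: "f \<in> borel_measurable borel"
    using borel_measurable_integrable[OF f] by simp
  have "integrable (density (distr lborel borel (\<lambda>x. t + c *\<^sub>R x)) (\<lambda>_. ennreal (\<bar>c\<bar>^DIM('a)))) f"
    using f by (subst (asm) lborel_eq_affine[OF c, of t])
  then have "integrable lborel (\<lambda>x. \<bar>c\<bar>^DIM('a) *\<^sub>R f (t + c *\<^sub>R x))"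
    by (simp add: integrable_density integrable_distr_eq)
  then have "integrable lborel (\<lambda>x. inverse (\<bar>c\<bar>^DIM('a)) *\<^sub>R (\<bar>c\<bar>^DIM('a) *\<^sub>R f (t + c *\<^sub>R x)))"
    by (rule integrable_scaleR_right)
  then show ?thesis
    using c by simp
qed

text \<open>The normalization makes this function its own Fourier transform.\<close>

definition gaussian :: "'a::euclidean_space \<Rightarrow> real" where
  "gaussian x = exp (- pi * (norm x)\<^sup>2)"

lemma gaussian_measurable [measurable]: "gaussian \<in> borel_measurable borel"
  unfolding gaussian_def[abs_def] by measurable

lemma gaussian_bounds [simp]: "gaussian x \<ge> 0" "gaussian x \<le> 1"
  by (auto simp: gaussian_def)

text \<open>This is the characteristic function of the standard normal distribution, rescaled.\<close>

lemma gaussian_fourier_real: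
  fixes s :: real
  shows "integrable lborel (\<lambda>t. gaussian t * cis (- 2 * pi * (s * t)))"
    "(\<integral>t. gaussian t * cis (- 2 * pi * (s * t)) \<partial>lborel) = gaussian s"
proof -
  define r where "r = - sqrt (2 * pi) * s"
  have sq: "r\<^sup>2 / 2 = pi * s\<^sup>2"
    by (simp add: r_def power_mult_distrib)
  have int: "integrable lborel (\<lambda>x. std_normal_density x *\<^sub>R iexp (r * x))"
    by (rule Bochner_Integration.integrable_bound[OF integrable_std_normal_moment[of 0]]) auto
  have "char std_normal_distribution r = (\<integral>x. std_normal_density x *\<^sub>R iexp (r * x) \<partial>lborel)"
    unfolding char_def by (subst integral_density) auto
  then have val: "(\<integral>x. std_normal_density x *\<^sub>R iexp (r * x) \<partial>lborel) = gaussian s"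
    using sq by (simp add: char_std_normal_distribution gaussian_def)
  have c: "sqrt (2 * pi) \<noteq> 0" by simp
  have eq: "gaussian t * cis (- 2 * pi * (s * t)) =
      sqrt (2 * pi) *\<^sub>R (std_normal_density (sqrt (2 * pi) * t) *\<^sub>R iexp (r * (sqrt (2 * pi) * t)))" for t
  proof -
    have "r * (sqrt (2 * pi) * t) = - 2 * pi * (s * t)"
      by (simp add: r_def algebra_simps)
    moreover have "(sqrt (2 * pi) * t)\<^sup>2 / 2 = pi * t\<^sup>2"
      by (simp add: power_mult_distrib)
    ultimately show ?thesis
      by (simp add: std_normal_density_def gaussian_def cis_conv_exp scaleR_conv_of_real flip: of_real_mult)
  qed
  show "integrable lborel (\<lambda>t. gaussian t * cis (- 2 * pi * (s * t)))"
    unfolding eq using lborel_integrable_real_affine[OF int c, of 0] by (intro integrable_scaleR_right) simp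
  show "(\<integral>t. gaussian t * cis (- 2 * pi * (s * t)) \<partial>lborel) = gaussian s"
    unfolding eq integral_scaleR_right
    using lborel_integral_real_affine[OF c, of "\<lambda>x. std_normal_density x *\<^sub>R iexp (r * x)" 0] val by simp
qed

lemma gaussian_prod:
  fixes x :: "'a::euclidean_space"
  shows "gaussian x = (\<Prod>b\<in>Basis. gaussian (x \<bullet> b))"
proof -
  have "- pi * (norm x)\<^sup>2 = (\<Sum>b\<in>Basis. - pi * (norm (x \<bullet> b))\<^sup>2)"
    unfolding power2_norm_eq_inner by (subst euclidean_inner) (simp add: sum_distrib_left power2_eq_square)
  then show ?thesis
    unfolding gaussian_def by (simp add: exp_sum)
qed

lemma integral_prod_Basis:
  fixes h :: "'a::euclidean_space \<Rightarrow> real \<Rightarrow> complex"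
  assumes h: "\<And>b. b \<in> Basis \<Longrightarrow> integrable lborel (h b)"
  shows "integrable lborel (\<lambda>x. \<Prod>b\<in>Basis. h b (x \<bullet> b))"
    "(\<integral>x. (\<Prod>b\<in>Basis. h b (x \<bullet> b)) \<partial>lborel) = (\<Prod>b\<in>Basis. \<integral>t. h b t \<partial>lborel)"
proof -
  interpret product_sigma_finite "\<lambda>_::'a. lborel :: real measure"
    by standard
  have inner: "(\<Sum>b\<in>Basis. y b *\<^sub>R b) \<bullet> b' = y b'" if "b' \<in> Basis" for y and b' :: 'a
    using that by simp
  have m: "(\<lambda>y. \<Sum>b\<in>Basis. y b *\<^sub>R b) \<in> (\<Pi>\<^sub>M (b::'a)\<in>Basis. lborel) \<rightarrow>\<^sub>M borel"
    by measurable
  have mh: "(\<lambda>x. \<Prod>b\<in>Basis. h b (x \<bullet> b)) \<in> borel_measurable borel"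
    using borel_measurable_integrable[OF h] by measurable
  \<comment> \<open>Unfolding would not end here, because the product again involves \<open>lborel\<close>.\<close>
  show "integrable lborel (\<lambda>x. \<Prod>b\<in>Basis. h b (x \<bullet> b))"
    by (subst lborel_eq, subst integrable_distr_eq[OF m mh])
      (simp add: inner product_integrable_prod h cong: prod.cong)
  show "(\<integral>x. (\<Prod>b\<in>Basis. h b (x \<bullet> b)) \<partial>lborel) = (\<Prod>b\<in>Basis. \<integral>t. h b t \<partial>lborel)"
    by (subst lborel_eq, subst integral_distr[OF m mh])
      (simp add: inner product_integral_prod h cong: prod.cong)
qed

lemma gaussian_fourier:
  fixes w :: "'a::euclidean_space"
  shows "integrable lborel (\<lambda>x. gaussian x * cis (- 2 * pi * (w \<bullet> x)))"
    "(\<integral>x. gaussian x * cis (- 2 * pi * (w \<bullet> x)) \<partial>lborel) = gaussian w"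
proof -
  define h where "h b t = gaussian t * cis (- 2 * pi * ((w \<bullet> b) * t))" for b and t :: real
  have prod: "gaussian x * cis (- 2 * pi * (w \<bullet> x)) = (\<Prod>b\<in>Basis. h b (x \<bullet> b))" for x
  proof -
    have "gaussian x = (\<Prod>b\<in>Basis. gaussian (x \<bullet> b))"
      by (rule gaussian_prod)
    moreover have "cis (- 2 * pi * (w \<bullet> x)) = (\<Prod>b\<in>Basis. cis (- 2 * pi * ((w \<bullet> b) * (x \<bullet> b))))"
      unfolding cis_conv_exp by (subst euclidean_inner) (simp add: sum_distrib_left exp_sum flip: sum_negf)
    ultimately show ?thesis
      by (simp add: h_def prod.distrib)
  qed
  have h: "integrable lborel (h b)" "integral\<^sup>L lborel (h b) = gaussian (w \<bullet> b)" for b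
    unfolding h_def by (rule gaussian_fourier_real)+
  show "integrable lborel (\<lambda>x. gaussian x * cis (- 2 * pi * (w \<bullet> x)))"
    unfolding prod by (rule integral_prod_Basis(1)[OF h(1)])
  show "(\<integral>x. gaussian x * cis (- 2 * pi * (w \<bullet> x)) \<partial>lborel) = gaussian w"
    unfolding prod integral_prod_Basis(2)[OF h(1)] by (simp add: h(2) gaussian_prod[of w])
qed

lemma integrable_mult_bounded:
  fixes f b :: "'a::euclidean_space \<Rightarrow> complex"
  assumes "integrable lborel f" "b \<in> borel_measurable borel" "\<And>x. norm (b x) \<le> C"
  shows "integrable lborel (\<lambda>x. f x * b x)"
proof (rule Bochner_Integration.integrable_bound)
  show "integrable lborel (\<lambda>x. C * norm (f x))"
    using assms(1) by simp
  show "(\<lambda>x. f x * b x) \<in> borel_measurable lborel"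
    using assms borel_measurable_integrable[OF assms(1)] by simp
  have "norm (f x) * norm (b x) \<le> C * norm (f x)" for x
    using mult_left_mono[OF assms(3) norm_ge_zero, of "f x" x] by (simp add: mult.commute)
  then show "AE x in lborel. norm (f x * b x) \<le> norm (C * norm (f x))"
    by (intro AE_I2) (auto simp: norm_mult intro: order_trans[OF _ abs_ge_self])
qed

lemma cis_measurable [measurable]: "cis \<in> borel_measurable borel"
  by (intro borel_measurable_continuous_onI continuous_intros)

lemma cnj_measurable [measurable]: "cnj \<in> borel_measurable borel"
  by (intro borel_measurable_continuous_onI continuous_intros)

lemma integrable_fourier_kernel:
  fixes f :: "real^'n::finite \<Rightarrow> complex"
  assumes "integrable lborel f"
  shows "integrable lborel (\<lambda>x. f x * cis (- 2 * pi * (w \<bullet> x)))"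
  by (rule integrable_mult_bounded[OF assms, where C = 1]) auto

lemma fourier_integral_measurable [measurable]:
  fixes f :: "real^'n::finite \<Rightarrow> complex"
  assumes [measurable]: "f \<in> borel_measurable borel"
  shows "fourier_integral f \<in> borel_measurable borel"
proof -
  have "(\<lambda>w. \<integral>x. f x * cis (- 2 * pi * (w \<bullet> x)) \<partial>lborel) \<in> borel_measurable lborel"
    by (rule lborel.borel_measurable_lebesgue_integral) measurable
  then show ?thesis
    by (simp add: fourier_integral_def[abs_def])
qed

lemma norm_fourier_integral_le:
  fixes f :: "real^'n::finite \<Rightarrow> complex"
  shows "norm (fourier_integral f w) \<le> (\<integral>x. norm (f x) \<partial>lborel)"
  unfolding fourier_integral_def
  by (rule order_trans[OF integral_norm_bound]) (simp add: norm_mult)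

lemma fourier_integral_add:
  fixes f g :: "real^'n::finite \<Rightarrow> complex"
  assumes "integrable lborel f" "integrable lborel g"
  shows "fourier_integral (\<lambda>x. f x + g x) w = fourier_integral f w + fourier_integral g w"
  unfolding fourier_integral_def distrib_right
  by (intro Bochner_Integration.integral_add integrable_fourier_kernel assms)

lemma fourier_integral_cmult:
  fixes f :: "real^'n::finite \<Rightarrow> complex"
  shows "fourier_integral (\<lambda>x. c * f x) w = c * fourier_integral f w"
  unfolding fourier_integral_def by (simp add: mult.assoc)

lemma fourier_integral_diff:
  fixes f g :: "real^'n::finite \<Rightarrow> complex"
  assumes "integrable lborel f" "integrable lborel g"
  shows "fourier_integral (\<lambda>x. f x - g x) w = fourier_integral f w - fourier_integral g w"
  unfolding fourier_integral_def left_diff_distrib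
  by (intro Bochner_Integration.integral_diff integrable_fourier_kernel assms)

lemma fourier_integral_cong_AE:
  fixes f g :: "real^'n::finite \<Rightarrow> complex"
  assumes "AE x in lborel. f x = g x" "f \<in> borel_measurable borel" "g \<in> borel_measurable borel"
  shows "fourier_integral f = fourier_integral g"
  unfolding fourier_integral_def[abs_def]
  using assms by (intro ext integral_cong_AE) auto

lemma fourier_integral_shift:
  fixes f :: "real^'n::finite \<Rightarrow> complex"
  assumes [measurable]: "f \<in> borel_measurable borel"
  shows "fourier_integral (\<lambda>x. f (x - a)) w = cis (- 2 * pi * (w \<bullet> a)) * fourier_integral f w"
proof -
  have "fourier_integral (\<lambda>x. f (x - a)) w
      = (\<integral>x. f x * cis (- 2 * pi * (w \<bullet> (a + x))) \<partial>lborel)"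
    unfolding fourier_integral_def by (subst integral_affine[of _ 1 a]) auto
  also have "\<dots> = (\<integral>x. cis (- 2 * pi * (w \<bullet> a)) * (f x * cis (- 2 * pi * (w \<bullet> x))) \<partial>lborel)"
    unfolding inner_add_right distrib_left cis_mult[symmetric] by (simp only: mult_ac)
  finally show ?thesis
    by (simp add: fourier_integral_def)
qed

lemma fourier_integral_cnj:
  fixes f :: "real^'n::finite \<Rightarrow> complex"
  shows "cnj (fourier_integral f w) = fourier_integral (\<lambda>x. cnj (f x)) (- w)"
  unfolding fourier_integral_def Bochner_Integration.integral_cnj[symmetric]
  by (rule Bochner_Integration.integral_cong[OF refl]) (simp add: cis_cnj)

text \<open>Both sides are the same double integral, with the order of integration exchanged.\<close>

lemma fourier_multiplication_formula:
  fixes f g :: "real^'n::finite \<Rightarrow> complex"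
  assumes f: "integrable lborel f" and g: "integrable lborel g"
  shows "(\<integral>w. fourier_integral f w * g w \<partial>lborel) = (\<integral>x. f x * fourier_integral g x \<partial>lborel)"
proof -
  note [measurable] = borel_measurable_integrable[OF f, simplified] borel_measurable_integrable[OF g, simplified]
  have "integrable (lborel \<Otimes>\<^sub>M lborel) (\<lambda>(x, w). f x * cis (- 2 * pi * (w \<bullet> x)) * g w)"
  proof (rule lborel_pair.Fubini_integrable)
    show "integrable lborel (\<lambda>x. \<integral>w. norm (case (x, w) of (x, w) \<Rightarrow> f x * cis (- 2 * pi * (w \<bullet> x)) * g w) \<partial>lborel)"
      using f by (simp add: norm_mult)
    show "AE x in lborel. integrable lborel (\<lambda>w. case (x, w) of (x, w) \<Rightarrow> f x * cis (- 2 * pi * (w \<bullet> x)) * g w)"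
    proof (rule AE_I2)
      fix x
      have "integrable lborel (\<lambda>w. g w * (f x * cis (- 2 * pi * (w \<bullet> x))))"
        by (rule integrable_mult_bounded[OF g, where C = "norm (f x)"]) (auto simp: norm_mult)
      then show "integrable lborel (\<lambda>w. case (x, w) of (x, w) \<Rightarrow> f x * cis (- 2 * pi * (w \<bullet> x)) * g w)"
        by (simp add: mult_ac)
    qed
  qed measurable
  then have "(\<integral>w. \<integral>x. f x * cis (- 2 * pi * (w \<bullet> x)) * g w \<partial>lborel \<partial>lborel)
      = (\<integral>x. \<integral>w. f x * cis (- 2 * pi * (w \<bullet> x)) * g w \<partial>lborel \<partial>lborel)"
    by (rule lborel_pair.Fubini_integral)
  moreover have "(\<integral>x. f x * cis (- 2 * pi * (w \<bullet> x)) * g w \<partial>lborel) = fourier_integral f w * g w" for w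
    unfolding fourier_integral_def by simp
  moreover have "(\<integral>w. f x * cis (- 2 * pi * (w \<bullet> x)) * g w \<partial>lborel) = f x * fourier_integral g x" for x
    unfolding fourier_integral_def integral_mult_right_zero[symmetric]
    by (simp only: inner_commute[of x] mult_ac)
  ultimately show ?thesis by (simp only:)
qed

subsection \<open>Plancherel's theorem\<close>

lemma integrable_gaussian_scaled:
  assumes "c \<noteq> 0"
  shows "integrable lborel (\<lambda>w :: real^'n::finite. complex_of_real (gaussian (c *\<^sub>R w)))"
  using integrable_affine[OF gaussian_fourier(1)[of "0 :: real^'n"] assms, of 0] by simp

lemma integral_gaussian: "(\<integral>x. gaussian x \<partial>(lborel :: (real^'n::finite) measure)) = 1"
proof -
  have "complex_of_real (\<integral>x. gaussian x \<partial>(lborel :: (real^'n) measure)) = 1"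
    using gaussian_fourier(2)[of "0::real^'n"] by (simp add: gaussian_def)
  then show ?thesis by (simp only: of_real_eq_1_iff)
qed

lemma fourier_gaussian_scaled:
  fixes c :: real and h :: "real^'n::finite \<Rightarrow> complex"
  assumes c: "c > 0" and h: "integrable lborel h"
  shows "(\<integral>w. gaussian (c *\<^sub>R w) * fourier_integral h w \<partial>lborel) = (\<integral>v. gaussian v * h (c *\<^sub>R v) \<partial>lborel)"
proof -
  let ?d = "DIM(real^'n)"
  note [measurable] = borel_measurable_integrable[OF h, simplified]
  have gc: "fourier_integral (\<lambda>w. gaussian (c *\<^sub>R w)) (c *\<^sub>R v) = complex_of_real (inverse c ^ ?d * gaussian v)"
    for v :: "real^'n"
  proof -
    let ?f = "\<lambda>x. gaussian x * cis (- 2 * pi * (v \<bullet> x))"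
    have "complex_of_real (gaussian v) = c ^ ?d *\<^sub>R (\<integral>w. ?f (0 + c *\<^sub>R w) \<partial>lborel)"
      unfolding gaussian_fourier(2)[of v, symmetric]
      using integral_affine[of ?f c 0] c by simp
    also have "(\<integral>w. ?f (0 + c *\<^sub>R w) \<partial>lborel) = fourier_integral (\<lambda>w. gaussian (c *\<^sub>R w)) (c *\<^sub>R v)"
      unfolding fourier_integral_def by simp
    finally show ?thesis
      using c by (simp add: scaleR_conv_of_real field_simps power_inverse)
  qed
  have "(\<integral>w. gaussian (c *\<^sub>R w) * fourier_integral h w \<partial>lborel)
      = (\<integral>x. h x * fourier_integral (\<lambda>w. gaussian (c *\<^sub>R w)) x \<partial>lborel)"
    using fourier_multiplication_formula[OF h integrable_gaussian_scaled, of c] c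
    by (simp add: mult.commute)
  also have "\<dots> = c ^ ?d *\<^sub>R (\<integral>v. h (c *\<^sub>R v) * fourier_integral (\<lambda>w. gaussian (c *\<^sub>R w)) (c *\<^sub>R v) \<partial>lborel)"
    using c by (subst integral_affine[of _ c 0]) auto
  also have "\<dots> = (\<integral>v. c ^ ?d *\<^sub>R (h (c *\<^sub>R v) * fourier_integral (\<lambda>w. gaussian (c *\<^sub>R w)) (c *\<^sub>R v)) \<partial>lborel)"
    by simp
  also have "\<dots> = (\<integral>v. gaussian v * h (c *\<^sub>R v) \<partial>lborel)"
    unfolding gc using c by (intro Bochner_Integration.integral_cong) (auto simp: scaleR_conv_of_real field_simps)
  finally show ?thesis .
qed

text \<open>
  The energy of the Fourier transform of \<open>g\<close>, damped by a wide Gaussian, is by two applications of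
  the multiplication formula the correlation of \<open>g\<close> with its average over a narrow Gaussian.
\<close>

lemma gaussian_damped_energy:
  fixes g :: "real^'n::finite \<Rightarrow> complex"
  assumes c: "c > 0" and g: "integrable lborel g"
  shows "complex_of_real (\<integral>w. gaussian (c *\<^sub>R w) * (norm (fourier_integral g w))\<^sup>2 \<partial>lborel)
    = (\<integral>x. g x * (\<integral>v. gaussian v * cnj (g (x - c *\<^sub>R v)) \<partial>lborel) \<partial>lborel)" (is "?l = ?r")
proof -
  note [measurable] = borel_measurable_integrable[OF g, simplified]
  define \<phi> where "\<phi> w = gaussian (c *\<^sub>R w) * cnj (fourier_integral g w)" for w
  have \<phi>: "integrable lborel \<phi>"
    unfolding \<phi>_def using c
    by (intro integrable_mult_bounded[OF integrable_gaussian_scaled, where C = "\<integral>x. norm (g x) \<partial>lborel"])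
      (auto simp: norm_fourier_integral_le)
  have hat: "fourier_integral \<phi> x = (\<integral>v. gaussian v * cnj (g (x - c *\<^sub>R v)) \<partial>lborel)" for x
  proof -
    define h where "h u = cnj (g (x - u))" for u
    have refl: "integrable lborel (\<lambda>u. g (x + (-1) *\<^sub>R u))"
      by (rule integrable_affine[OF g]) simp
    then have h: "integrable lborel h"
      unfolding h_def by simp
    have "cnj (fourier_integral g w) * cis (- 2 * pi * (x \<bullet> w)) = fourier_integral h w" for w
    proof -
      have "cnj (fourier_integral g w) * cis (- 2 * pi * (x \<bullet> w))
          = (\<integral>y. cnj (g y) * cis (2 * pi * (w \<bullet> y)) * cis (- 2 * pi * (x \<bullet> w)) \<partial>lborel)"
        unfolding fourier_integral_cnj unfolding fourier_integral_def by simp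
      also have "\<dots> = (\<integral>u. cnj (g (x + (-1) *\<^sub>R u)) * cis (2 * pi * (w \<bullet> (x + (-1) *\<^sub>R u))) * cis (- 2 * pi * (x \<bullet> w)) \<partial>lborel)"
        by (subst integral_affine[of _ "-1" x]) auto
      also have "\<dots> = fourier_integral h w"
        unfolding fourier_integral_def h_def
        by (intro Bochner_Integration.integral_cong)
          (auto simp: cis_mult mult.assoc inner_diff_right inner_commute algebra_simps)
      finally show ?thesis .
    qed
    then have "fourier_integral \<phi> x = (\<integral>w. gaussian (c *\<^sub>R w) * fourier_integral h w \<partial>lborel)"
      unfolding fourier_integral_def[of \<phi>] \<phi>_def mult.assoc by simp
    then show ?thesis
      using fourier_gaussian_scaled[OF c h] by (simp add: h_def)
  qed
  have "?l = (\<integral>w. fourier_integral g w * \<phi> w \<partial>lborel)"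
    unfolding integral_complex_of_real[symmetric] of_real_mult complex_norm_square \<phi>_def
    by (simp only: mult_ac)
  also have "\<dots> = ?r"
    unfolding fourier_multiplication_formula[OF g \<phi>] hat ..
  finally show ?thesis .
qed

lemma gaussian_average_tendsto:
  fixes g :: "real^'n::finite \<Rightarrow> complex"
  assumes cont: "continuous_on UNIV g" and B: "\<And>x. norm (g x) \<le> B"
    and c: "c \<longlonglongrightarrow> 0"
  shows "(\<lambda>n. \<integral>v. gaussian v * cnj (g (x - c n *\<^sub>R v)) \<partial>lborel) \<longlonglongrightarrow> cnj (g x)"
proof -
  have [measurable]: "g \<in> borel_measurable borel"
    using cont by (rule borel_measurable_continuous_onI)
  have gint: "integrable lborel (\<lambda>v :: real^'n. complex_of_real (gaussian v))"
    using integrable_gaussian_scaled[of 1, where 'n = 'n] by simp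
  have "(\<lambda>n. \<integral>v. gaussian v * cnj (g (x - c n *\<^sub>R v)) \<partial>lborel) \<longlonglongrightarrow> (\<integral>v. gaussian v * cnj (g x) \<partial>(lborel :: (real^'n) measure))"
  proof (rule integral_dominated_convergence)
    show "integrable lborel (\<lambda>v :: real^'n. B * gaussian v)"
      using gint by (intro integrable_mult_right) (simp only: complex_of_real_integrable_eq)
    show "AE v in lborel. (\<lambda>n. gaussian v * cnj (g (x - c n *\<^sub>R v))) \<longlonglongrightarrow> gaussian v * cnj (g x)"
    proof (rule AE_I2)
      fix v
      have "(\<lambda>n. x - c n *\<^sub>R v) \<longlonglongrightarrow> x - 0 *\<^sub>R v"
        by (intro tendsto_intros c)
      then have "(\<lambda>n. g (x - c n *\<^sub>R v)) \<longlonglongrightarrow> g x"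
        using cont by (intro isCont_tendsto_compose[of x g]) (auto simp: continuous_on_eq_continuous_within)
      then show "(\<lambda>n. gaussian v * cnj (g (x - c n *\<^sub>R v))) \<longlonglongrightarrow> gaussian v * cnj (g x)"
        by (intro tendsto_intros)
    qed
    show "AE v in lborel. norm (gaussian v * cnj (g (x - c n *\<^sub>R v))) \<le> B * gaussian v" for n
      using B by (intro AE_I2) (auto simp: norm_mult mult.commute[of B] intro: mult_left_mono)
  qed auto
  also have "(\<integral>v. gaussian v * cnj (g x) \<partial>(lborel :: (real^'n) measure)) = cnj (g x)"
    using integral_gaussian[where 'n = 'n] by simp
  finally show ?thesis .
qed

lemma bounded_of_bounded_support:
  fixes g :: "real^'n::finite \<Rightarrow> complex"
  assumes "continuous_on UNIV g" "bounded_support g"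
  obtains B where "\<And>x. norm (g x) \<le> B"
proof -
  obtain R where R: "\<And>x. norm x > R \<Longrightarrow> g x = 0"
    using assms(2) by (auto simp: bounded_support_def)
  have "bounded (g ` cball 0 R)"
    using assms(1) by (intro compact_imp_bounded compact_continuous_image)
      (auto intro: continuous_on_subset)
  then obtain B where "\<forall>y \<in> g ` cball 0 R. norm y \<le> B"
    unfolding bounded_iff by blast
  then have B: "norm (g x) \<le> B" if "x \<in> cball 0 R" for x
    using that by blast
  show ?thesis
  proof (rule that)
    fix x
    show "norm (g x) \<le> max B 0"
      using B[of x] R[of x] by (cases "norm x > R") auto
  qed
qed

text \<open>
  As the damping is removed, the correlation of \<open>g\<close> with its Gaussian averages tends to the energy of \<open>g\<close>,
  by continuity. Fatou's lemma first gives that the undamped energy of the transform is finite, and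
  dominated convergence then that it is the limit.
\<close>

lemma Plancherel_continuous_bounded_support:
  fixes g :: "real^'n::finite \<Rightarrow> complex"
  assumes cont: "continuous_on UNIV g" and supp: "bounded_support g"
    and sq: "square_integrable g" and int: "integrable lborel g"
  shows "square_integrable (fourier_integral g)" "norm (abs_L2 (fourier_integral g)) = norm (abs_L2 g)"
proof -
  have [measurable]: "g \<in> borel_measurable borel"
    using cont by (rule borel_measurable_continuous_onI)
  obtain B where B: "\<And>x. norm (g x) \<le> B"
    using bounded_of_bounded_support[OF cont supp] by blast
  define c where "c n = inverse (real (Suc n))" for n
  have c: "c \<longlonglongrightarrow> 0" "c n > 0" for n
    unfolding c_def by (rule LIMSEQ_inverse_real_of_nat) simp
  define a where "a n x = (\<integral>v. gaussian v * cnj (g (x - c n *\<^sub>R v)) \<partial>lborel)" for n x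
  have a_meas [measurable]: "a n \<in> borel_measurable borel" for n
  proof -
    have "a n \<in> borel_measurable lborel"
      unfolding a_def[abs_def] by (rule lborel.borel_measurable_lebesgue_integral) measurable
    then show ?thesis by simp
  qed
  have gint: "integrable lborel (gaussian :: real^'n \<Rightarrow> real)"
    using integrable_gaussian_scaled[of 1, where 'n = 'n] by (simp only: complex_of_real_integrable_eq) simp
  have a_bd: "norm (a n x) \<le> B" for n x
  proof -
    have "norm (a n x) \<le> (\<integral>v. B * gaussian (v :: real^'n) \<partial>lborel)"
      unfolding a_def
    proof (rule Bochner_Integration.integral_norm_bound_integral)
      show "integrable lborel (\<lambda>v :: real^'n. B * gaussian v)"
        using gint by simp
      show "integrable lborel (\<lambda>v. complex_of_real (gaussian v) * cnj (g (x - c n *\<^sub>R v)))"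
        using integrable_gaussian_scaled[of 1, where 'n = 'n] B
        by (intro integrable_mult_bounded[where C = B]) auto
    qed (use B in \<open>auto simp: norm_mult mult.commute[of B] intro: mult_left_mono\<close>)
    also have "\<dots> = B" by (simp add: integral_gaussian)
    finally show ?thesis .
  qed
  define E where "E n = (\<integral>w. gaussian (c n *\<^sub>R w) * (norm (fourier_integral g w))\<^sup>2 \<partial>lborel)" for n
  have "(\<lambda>n. \<integral>x. g x * a n x \<partial>lborel) \<longlonglongrightarrow> (\<integral>x. g x * cnj (g x) \<partial>lborel)"
  proof (rule integral_dominated_convergence)
    show "integrable lborel (\<lambda>x. B * norm (g x))"
      using int by simp
    show "AE x in lborel. (\<lambda>n. g x * a n x) \<longlonglongrightarrow> g x * cnj (g x)"
      unfolding a_def by (intro AE_I2 tendsto_intros gaussian_average_tendsto[OF cont B c(1)])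
    show "AE x in lborel. norm (g x * a n x) \<le> B * norm (g x)" for n
      using a_bd by (intro AE_I2) (auto simp: norm_mult mult.commute[of B] intro: mult_left_mono)
  qed auto
  moreover have "(\<integral>x. g x * a n x \<partial>lborel) = complex_of_real (E n)" for n
    unfolding a_def E_def by (rule gaussian_damped_energy[OF c(2) int, symmetric])
  moreover have "(\<integral>x. g x * cnj (g x) \<partial>lborel) = complex_of_real ((norm (abs_L2 g))\<^sup>2)"
    unfolding norm_abs_sq[OF sq] integral_complex_of_real[symmetric] complex_norm_square ..
  ultimately have E: "E \<longlonglongrightarrow> (norm (abs_L2 g))\<^sup>2"
    by (simp only: tendsto_of_real_iff)
  have lim: "(\<lambda>n. gaussian (c n *\<^sub>R w) * (norm (fourier_integral g w))\<^sup>2) \<longlonglongrightarrow> (norm (fourier_integral g w))\<^sup>2" for w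
  proof -
    have "(\<lambda>n. gaussian (c n *\<^sub>R w) * (norm (fourier_integral g w))\<^sup>2)
        \<longlonglongrightarrow> exp (- pi * (norm (0 *\<^sub>R w))\<^sup>2) * (norm (fourier_integral g w))\<^sup>2"
      unfolding gaussian_def by (intro tendsto_intros c)
    then show ?thesis by simp
  qed
  have damped: "integrable lborel (\<lambda>w. gaussian (c n *\<^sub>R w) * (norm (fourier_integral g w))\<^sup>2)" for n
  proof -
    have "integrable lborel (\<lambda>w. complex_of_real (gaussian (c n *\<^sub>R w)) * complex_of_real ((norm (fourier_integral g w))\<^sup>2))"
      using c(2)[of n]
      by (intro integrable_mult_bounded[OF integrable_gaussian_scaled, where C = "(\<integral>x. norm (g x) \<partial>lborel)\<^sup>2"])
        (auto simp: norm_power intro!: power_mono norm_fourier_integral_le)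
    then have "integrable lborel (\<lambda>w. complex_of_real (gaussian (c n *\<^sub>R w) * (norm (fourier_integral g w))\<^sup>2))"
      by simp
    then show ?thesis by (simp only: complex_of_real_integrable_eq)
  qed
  have "(\<integral>\<^sup>+w. ennreal ((norm (fourier_integral g w))\<^sup>2) \<partial>lborel)
      = (\<integral>\<^sup>+w. liminf (\<lambda>n. ennreal (gaussian (c n *\<^sub>R w) * (norm (fourier_integral g w))\<^sup>2)) \<partial>lborel)"
    by (intro nn_integral_cong lim_imp_Liminf[symmetric] tendsto_ennrealI lim) simp
  also have "\<dots> \<le> liminf (\<lambda>n. \<integral>\<^sup>+w. ennreal (gaussian (c n *\<^sub>R w) * (norm (fourier_integral g w))\<^sup>2) \<partial>lborel)"
    by (rule nn_integral_liminf) measurable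
  also have "\<dots> = liminf (\<lambda>n. ennreal (E n))"
    unfolding E_def by (subst nn_integral_eq_integral[OF damped]) auto
  also have "\<dots> = ennreal ((norm (abs_L2 g))\<^sup>2)"
    by (intro lim_imp_Liminf tendsto_ennrealI E) simp
  finally have "(\<integral>\<^sup>+w. ennreal ((norm (fourier_integral g w))\<^sup>2) \<partial>lborel) \<le> ennreal ((norm (abs_L2 g))\<^sup>2)" .
  then show sqF: "square_integrable (fourier_integral g)"
    by (intro square_integrableI_nn) (auto intro: le_less_trans)
  have "E \<longlonglongrightarrow> (\<integral>w. (norm (fourier_integral g w))\<^sup>2 \<partial>lborel)"
    unfolding E_def
  proof (rule integral_dominated_convergence)
    show "integrable lborel (\<lambda>w. (norm (fourier_integral g w))\<^sup>2)"
      using sqF by (simp add: square_integrable_def)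
    show "AE w in lborel. norm (gaussian (c n *\<^sub>R w) * (norm (fourier_integral g w))\<^sup>2) \<le> (norm (fourier_integral g w))\<^sup>2" for n
      by (intro AE_I2) (auto simp: abs_mult intro: mult_left_le_one_le)
  qed (use lim in auto)
  then have "(norm (abs_L2 g))\<^sup>2 = (norm (abs_L2 (fourier_integral g)))\<^sup>2"
    unfolding norm_abs_sq[OF sqF] using E LIMSEQ_unique by blast
  then show "norm (abs_L2 (fourier_integral g)) = norm (abs_L2 g)"
    by simp
qed

text \<open>
  Approximation by continuous functions \<open>g n\<close> in the mean makes the transforms converge pointwise, so that
  Fatou's lemma yields a contraction. As the norm
  is preserved for \<open>g\<close>, applying the contraction to \<open>g - f\<close> shows that it is preserved for \<open>f\<close>.
\<close>

lemma Plancherel_L1_L2: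
  fixes f :: "real^'n::finite \<Rightarrow> complex"
  assumes sq: "square_integrable f" and int: "integrable lborel f"
  shows "square_integrable (fourier_integral f)" "norm (abs_L2 (fourier_integral f)) = norm (abs_L2 f)"
proof -
  have contraction: "square_integrable (fourier_integral f) \<and> norm (abs_L2 (fourier_integral f)) \<le> norm (abs_L2 f)"
    if sq: "square_integrable f" and int: "integrable lborel f" for f :: "real^'n \<Rightarrow> complex"
  proof -
    have [measurable]: "f \<in> borel_measurable borel"
      using sq by (simp add: square_integrable_def)
    have "\<forall>n. \<exists>g. continuous_on UNIV g \<and> bounded_support g \<and> square_integrable g \<and> integrable lborel g \<and>
        (\<integral>x. norm (g x - f x) \<partial>lborel) < inverse (real (Suc n)) \<and> dist (abs_L2 g) (abs_L2 f) < inverse (real (Suc n))"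
      by (intro allI, rule L1_L2_approx_continuous[OF sq int]) (auto intro: positive_imp_inverse_positive)
    from choice[OF this] obtain g where g: "\<And>n. continuous_on UNIV (g n)" "\<And>n. bounded_support (g n)"
      "\<And>n. square_integrable (g n)" "\<And>n. integrable lborel (g n)"
      and L1: "\<And>n. (\<integral>x. norm (g n x - f x) \<partial>lborel) < inverse (real (Suc n))"
      and L2: "\<And>n. dist (abs_L2 (g n)) (abs_L2 f) < inverse (real (Suc n))"
      by auto
    note P = Plancherel_continuous_bounded_support[OF g]
    have lim: "(\<lambda>n. fourier_integral (g n) w) \<longlonglongrightarrow> fourier_integral f w" for w
    proof (rule LIM_zero_cancel, rule Lim_null_comparison)
      show "(\<lambda>n. inverse (real (Suc n))) \<longlonglongrightarrow> 0"
        by (rule LIMSEQ_inverse_real_of_nat)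
      show "\<forall>\<^sub>F n in sequentially. norm (fourier_integral (g n) w - fourier_integral f w) \<le> inverse (real (Suc n))"
        unfolding fourier_integral_diff[OF g(4) int, symmetric]
        by (intro always_eventually allI order_trans[OF norm_fourier_integral_le] less_imp_le L1)
    qed
    have norm: "\<forall>\<^sub>F n in sequentially. square_integrable (fourier_integral (g n)) \<and>
        norm (abs_L2 (fourier_integral (g n))) \<le> norm (abs_L2 f) + e" if "e > 0" for e
      using order_tendstoD(2)[OF LIMSEQ_inverse_real_of_nat that]
    proof eventually_elim
      case (elim n)
      then have "norm (abs_L2 (g n)) \<le> norm (abs_L2 f) + e"
        using L2[of n] norm_triangle_sub[of "abs_L2 (g n)" "abs_L2 f"] by (simp add: dist_norm)
      then show ?case using P by simp
    qed
    show ?thesis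
    proof
      show "square_integrable (fourier_integral f)"
        by (rule L2_Fatou(1)[OF norm[of 1]]) (auto simp: lim)
      show "norm (abs_L2 (fourier_integral f)) \<le> norm (abs_L2 f)"
        by (rule field_le_epsilon) (rule L2_Fatou(2)[OF norm]; auto simp: lim)
    qed
  qed
  show sqF: "square_integrable (fourier_integral f)"
    using contraction[OF sq int] by simp
  have "norm (abs_L2 f) \<le> norm (abs_L2 (fourier_integral f))"
  proof (rule field_le_epsilon)
    fix e :: real assume "e > 0"
    then obtain g where g: "continuous_on UNIV g" "bounded_support g" "square_integrable g" "integrable lborel g"
      and d: "dist (abs_L2 g) (abs_L2 f) < e/2"
      using L1_L2_approx_continuous[OF sq int, of "e/2"] by (metis half_gt_zero)
    note P = Plancherel_continuous_bounded_support[OF g]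
    have "norm (abs_L2 (fourier_integral g) - abs_L2 (fourier_integral f))
        = norm (abs_L2 (fourier_integral (\<lambda>x. g x - f x)))"
      by (simp add: diff_abs P sqF fourier_integral_diff[OF g(4) int, abs_def])
    also have "\<dots> \<le> norm (abs_L2 (\<lambda>x. g x - f x))"
      using contraction[OF square_integrable_diff[OF g(3) sq]] g(4) int by simp
    also have "\<dots> \<le> e/2"
      using d by (simp add: diff_abs g sq dist_norm)
    finally have "norm (abs_L2 (fourier_integral g) - abs_L2 (fourier_integral f)) \<le> e/2" .
    then show "norm (abs_L2 f) \<le> norm (abs_L2 (fourier_integral f)) + e"
      using d P(2) norm_triangle_sub[of "abs_L2 (fourier_integral g)" "abs_L2 (fourier_integral f)"]
        norm_triangle_sub[of "abs_L2 f" "abs_L2 g"]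
      by (simp add: dist_norm norm_minus_commute)
  qed
  then show "norm (abs_L2 (fourier_integral f)) = norm (abs_L2 f)"
    using contraction[OF sq int] by simp
qed

section \<open>The Fourier transform as a unitary operator\<close>

lemma L2_bounded_linearI:
  fixes T :: "'n::finite L2 \<Rightarrow> 'm::finite L2"
  assumes "\<And>f g. T (f + g) = T f + T g" "\<And>c f. T (cscale c f) = cscale c (T f)"
    "\<And>f. norm (T f) \<le> C * norm f"
  shows "bounded_linear T"
  by (rule bounded_linear_intro[where K = C]) (use assms in \<open>auto simp: scaleR_cscale mult.commute\<close>)

lemma bounded_linear_cscale: "bounded_linear (cscale c :: 'n::finite L2 \<Rightarrow> 'n L2)"
  by (rule L2_bounded_linearI[where C = "norm c"])
    (auto simp: L2.scale_right_distrib norm_cscale mult.commute)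

lemma shift_add: "shift k (f + g) = shift k f + shift k g"
  by transfer (simp add: L2_eq_def square_integrable_add square_integrable_shift)

lemma shift_cscale: "shift k (cscale c f) = cscale c (shift k f)"
  by transfer (simp add: L2_eq_def square_integrable_cmult square_integrable_shift)

lemma norm_shift: "norm (shift k f) = norm f"
proof -
  have "(norm (shift k f))\<^sup>2 = (norm (abs_L2 (\<lambda>x. rep_L2 f (x - of_int_vec k))))\<^sup>2"
    using shift_abs[OF square_integrable_rep, of k f] by simp
  also have "\<dots> = (\<integral>x. (norm (rep_L2 f (x - of_int_vec k)))\<^sup>2 \<partial>lborel)"
    by (rule norm_abs_sq) (rule square_integrable_shift[OF square_integrable_rep])
  also have "\<dots> = (\<integral>x. (norm (rep_L2 f x))\<^sup>2 \<partial>lborel)"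
    by (subst integral_affine[of _ 1 "of_int_vec k"]) auto
  also have "\<dots> = (norm f)\<^sup>2"
    by (simp add: norm_rep_sq)
  finally show ?thesis by simp
qed

lemma bounded_linear_shift: "bounded_linear (shift k)"
  by (rule L2_bounded_linearI[where C = 1]) (auto simp: shift_add shift_cscale norm_shift)

lemma L1_dense_induct:
  fixes P :: "'n::finite L2 \<Rightarrow> bool"
  assumes "closed {u. P u}"
    and P: "\<And>f. square_integrable f \<Longrightarrow> integrable lborel f \<Longrightarrow> P (abs_L2 f)"
  shows "P u"
proof -
  have lim: "(\<lambda>N. abs_L2 (truncate N (rep_L2 u))) \<longlonglongrightarrow> u"
    using truncate_tendsto_L2[OF square_integrable_rep, of u] by simp
  have "u \<in> {u. P u}"
    by (rule closed_sequentially[OF assms(1) _ lim]) (auto intro!: P truncate_L1_L2)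
  then show ?thesis by simp
qed

text \<open>
  On the dense set of classes of integrable functions the Fourier integral is an isometry by
  Plancherel's theorem, hence it extends continuously to all of \<open>L2\<close>, which is complete.
\<close>

lemma fourier_exists:
  "\<exists>F :: 'n::finite L2 \<Rightarrow> 'n L2. continuous_on UNIV F \<and>
     (\<forall>f. square_integrable f \<and> integrable lborel f \<longrightarrow> F (abs_L2 f) = abs_L2 (fourier_integral f))"
proof -
  define D where "D = {u :: 'n L2. integrable lborel (rep_L2 u)}"
  define F where "F u = abs_L2 (fourier_integral (rep_L2 u))" for u :: "'n L2"
  have iso: "dist (F u) (F v) = dist u v" if "u \<in> D" "v \<in> D" for u v
  proof -
    have int: "integrable lborel (rep_L2 u)" "integrable lborel (rep_L2 v)"
      using that by (auto simp: D_def)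
    note sq = square_integrable_rep[of u] square_integrable_rep[of v]
    have "dist (F u) (F v) = norm (abs_L2 (fourier_integral (\<lambda>x. rep_L2 u x - rep_L2 v x)))"
      unfolding F_def dist_norm
      by (subst diff_abs) (auto simp: Plancherel_L1_L2 sq int fourier_integral_diff[OF int, abs_def])
    also have "\<dots> = norm (abs_L2 (\<lambda>x. rep_L2 u x - rep_L2 v x))"
      using sq int by (intro Plancherel_L1_L2 square_integrable_diff) auto
    also have "\<dots> = dist u v"
      by (simp add: dist_norm sq flip: diff_abs)
    finally show ?thesis .
  qed
  have "uniformly_continuous_on D F"
    unfolding uniformly_continuous_on_def using iso by metis
  then obtain G where G: "uniformly_continuous_on (closure D) G" "\<And>u. u \<in> D \<Longrightarrow> F u = G u"
    by (rule uniformly_continuous_on_extension_on_closure) blast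
  have D: "abs_L2 f \<in> D \<and> F (abs_L2 f) = abs_L2 (fourier_integral f)"
    if "square_integrable f" "integrable lborel f" for f
  proof -
    have [measurable]: "f \<in> borel_measurable borel"
      using that by (simp add: square_integrable_def)
    note ae = rep_abs_L2[OF that(1)]
    have "integrable lborel (rep_L2 (abs_L2 f))"
      using that(2) integrable_cong_AE[OF _ _ ae] by simp
    then show ?thesis
      unfolding D_def F_def using fourier_integral_cong_AE[OF ae] by simp
  qed
  have "u \<in> closure D" for u
    by (rule L1_dense_induct[of "\<lambda>u. u \<in> closure D"]) (use D closure_subset in auto)
  then have "closure D = UNIV" by blast
  then have "continuous_on UNIV G"
    using uniformly_continuous_imp_continuous[OF G(1)] by simp
  moreover have "G (abs_L2 f) = abs_L2 (fourier_integral f)"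
    if "square_integrable f" "integrable lborel f" for f
    using D[OF that] G(2)[of "abs_L2 f"] by simp
  ultimately show ?thesis by blast
qed

lemma fourier_unique:
  fixes F G :: "'n::finite L2 \<Rightarrow> 'n L2"
  assumes "continuous_on UNIV F" "continuous_on UNIV G"
    and "\<And>f. square_integrable f \<Longrightarrow> integrable lborel f \<Longrightarrow> F (abs_L2 f) = G (abs_L2 f)"
  shows "F = G"
proof
  fix u
  show "F u = G u"
    by (rule L1_dense_induct[of "\<lambda>u. F u = G u"]) (use assms in \<open>auto intro: closed_Collect_eq\<close>)
qed

lemma fourier_characterization:
  "continuous_on UNIV (fourier :: 'n::finite L2 \<Rightarrow> 'n L2)"
  "square_integrable (f :: real^'n \<Rightarrow> complex) \<Longrightarrow> integrable lborel f \<Longrightarrow>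
     fourier (abs_L2 f) = abs_L2 (fourier_integral f)"
proof -
  let ?P = "\<lambda>F :: 'n L2 \<Rightarrow> 'n L2. continuous_on UNIV F \<and>
     (\<forall>f. square_integrable f \<and> integrable lborel f \<longrightarrow>
        (AE \<omega> in lborel. rep_L2 (F (abs_L2 f)) \<omega> = fourier_integral f \<omega>))"
  have eq: "(AE \<omega> in lborel. rep_L2 u \<omega> = fourier_integral f \<omega>) \<longleftrightarrow> u = abs_L2 (fourier_integral f)"
    if "square_integrable f" "integrable lborel f" for f and u :: "'n L2"
    using abs_L2_eq_iff[OF square_integrable_rep Plancherel_L1_L2(1)[OF that], of u] by simp
  obtain F where F: "?P F"
    using fourier_exists[where 'n = 'n] eq by metis
  have "G = F" if "?P G" for G
    by (rule fourier_unique) (use F that eq in auto)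
  then have "?P (THE F. ?P F)"
    by (rule theI[of ?P, OF F])
  then have P: "?P fourier"
    unfolding fourier_def .
  then show "continuous_on UNIV (fourier :: 'n::finite L2 \<Rightarrow> 'n L2)" by blast
  show "fourier (abs_L2 f) = abs_L2 (fourier_integral f)"
    if "square_integrable f" "integrable lborel f" for f :: "real^'n \<Rightarrow> complex"
    using P eq[OF that] that by blast
qed

lemmas fourier_abs = fourier_characterization(2)

lemma continuous_on_fourier [continuous_intros]:
  "continuous_on S f \<Longrightarrow> continuous_on S (\<lambda>x. fourier (f x))"
  by (rule continuous_on_compose2[OF fourier_characterization(1)]) auto

lemma continuous_on_cscale [continuous_intros]:
  "continuous_on S f \<Longrightarrow> continuous_on S (\<lambda>x. cscale c (f x))"
  by (rule bounded_linear.continuous_on[OF bounded_linear_cscale])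

lemma continuous_on_shift [continuous_intros]:
  "continuous_on S f \<Longrightarrow> continuous_on S (\<lambda>x. shift k (f x))"
  by (rule bounded_linear.continuous_on[OF bounded_linear_shift])

lemma norm_fourier: "norm (fourier f) = norm f"
proof (rule L1_dense_induct[of "\<lambda>f. norm (fourier f) = norm f"])
  show "closed {f :: 'a L2. norm (fourier f) = norm f}"
    by (intro closed_Collect_eq continuous_intros)
qed (simp add: fourier_abs Plancherel_L1_L2)

lemma fourier_cscale: "fourier (cscale c f) = cscale c (fourier f)"
proof (rule L1_dense_induct[of "\<lambda>f. fourier (cscale c f) = cscale c (fourier f)"])
  show "closed {f. fourier (cscale c f) = cscale c (fourier f)}"
    by (intro closed_Collect_eq continuous_intros)
qed (simp add: fourier_abs Plancherel_L1_L2 cscale_abs square_integrable_cmult fourier_integral_cmult[abs_def])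

lemma fourier_add: "fourier (f + g) = fourier f + fourier g"
proof (rule L1_dense_induct[of "\<lambda>f. fourier (f + g) = fourier f + fourier g"])
  show "closed {f. fourier (f + g) = fourier f + fourier g}"
    by (intro closed_Collect_eq continuous_intros)
  fix u :: "real^'a \<Rightarrow> complex" assume u: "square_integrable u" "integrable lborel u"
  show "fourier (abs_L2 u + g) = fourier (abs_L2 u) + fourier g"
  proof (rule L1_dense_induct[of "\<lambda>g. fourier (abs_L2 u + g) = fourier (abs_L2 u) + fourier g"])
    show "closed {g. fourier (abs_L2 u + g) = fourier (abs_L2 u) + fourier g}"
      by (intro closed_Collect_eq continuous_intros)
    fix v :: "real^'a \<Rightarrow> complex" assume v: "square_integrable v" "integrable lborel v"
    show "fourier (abs_L2 u + abs_L2 v) = fourier (abs_L2 u) + fourier (abs_L2 v)"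
      using u v
      by (simp add: fourier_abs Plancherel_L1_L2 plus_abs square_integrable_add fourier_integral_add[OF u(2) v(2), abs_def])
  qed
qed

lemma bounded_linear_fourier: "bounded_linear fourier"
  by (rule L2_bounded_linearI[where C = 1]) (auto simp: fourier_add fourier_cscale norm_fourier)

lemma inner_isometry:
  fixes T :: "'a::real_inner \<Rightarrow> 'b::real_inner"
  assumes "linear T" "\<And>x. norm (T x) = norm x"
  shows "T x \<bullet> T y = x \<bullet> y"
  using assms(2)[of "x + y"] assms(2)[of x] assms(2)[of y]
  by (simp add: linear_add[OF assms(1)] norm_eq_sqrt_inner inner_add inner_commute)

lemma inner_fourier: "fourier f \<bullet> fourier g = f \<bullet> g"
  by (rule inner_isometry) (auto simp: norm_fourier bounded_linear_fourier bounded_linear.linear)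

definition L2_cnj :: "'n::finite L2 \<Rightarrow> 'n L2" where
  "L2_cnj f = abs_L2 (\<lambda>x. cnj (rep_L2 f x))"

lemma square_integrable_cnj: "square_integrable f \<Longrightarrow> square_integrable (\<lambda>x. cnj (f x))"
  by (auto simp: square_integrable_def)

lemma L2_cnj_abs:
  assumes "square_integrable f"
  shows "L2_cnj (abs_L2 f) = abs_L2 (\<lambda>x. cnj (f x))"
  unfolding L2_cnj_def using rep_abs_L2[OF assms]
  by (subst abs_L2_eq_iff) (auto intro: square_integrable_cnj square_integrable_rep assms)

lemma L2_cnj_cnj [simp]: "L2_cnj (L2_cnj f) = f"
  using L2_cnj_abs[OF square_integrable_cnj[OF square_integrable_rep[of f]]]
  by (simp add: L2_cnj_def)

lemma L2_cnj_add: "L2_cnj (f + g) = L2_cnj f + L2_cnj g"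
  using L2_cnj_abs[OF square_integrable_rep, of f] L2_cnj_abs[OF square_integrable_rep, of g]
    L2_cnj_abs[OF square_integrable_add[OF square_integrable_rep square_integrable_rep], of f g]
    plus_abs[OF square_integrable_rep square_integrable_rep, of f g]
    plus_abs[OF square_integrable_cnj[OF square_integrable_rep] square_integrable_cnj[OF square_integrable_rep], of f g]
  by simp

lemma L2_cnj_cscale: "L2_cnj (cscale c f) = cscale (cnj c) (L2_cnj f)"
  using L2_cnj_abs[OF square_integrable_rep, of f]
    L2_cnj_abs[OF square_integrable_cmult[OF square_integrable_rep], of c f]
    cscale_abs[OF square_integrable_rep, of c f]
    cscale_abs[OF square_integrable_cnj[OF square_integrable_rep], of "cnj c" f]
  by simp

lemma norm_L2_cnj: "norm (L2_cnj f) = norm f"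
proof -
  have "(norm (L2_cnj f))\<^sup>2 = (norm f)\<^sup>2"
    unfolding L2_cnj_def norm_abs_sq[OF square_integrable_cnj[OF square_integrable_rep]] norm_rep_sq[of f]
    by simp
  then show ?thesis by simp
qed

lemma bounded_linear_L2_cnj: "bounded_linear L2_cnj"
  by (rule bounded_linear_intro[where K = 1])
    (auto simp: L2_cnj_add scaleR_cscale L2_cnj_cscale norm_L2_cnj)

lemma continuous_on_L2_cnj [continuous_intros]:
  "continuous_on S f \<Longrightarrow> continuous_on S (\<lambda>x. L2_cnj (f x))"
  by (rule bounded_linear.continuous_on[OF bounded_linear_L2_cnj])

text \<open>
  The inverse transform has the kernel of opposite sign. Conjugation reduces it to \<open>fourier\<close>, and the
  multiplication formula identifies it as the adjoint of \<open>fourier\<close>.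
\<close>

definition fourier_inv :: "'n::finite L2 \<Rightarrow> 'n L2" where
  "fourier_inv f = L2_cnj (fourier (L2_cnj f))"

lemma continuous_on_fourier_inv [continuous_intros]:
  "continuous_on S f \<Longrightarrow> continuous_on S (\<lambda>x. fourier_inv (f x))"
  unfolding fourier_inv_def by (intro continuous_intros)

lemma fourier_inv_add: "fourier_inv (f + g) = fourier_inv f + fourier_inv g"
  by (simp add: fourier_inv_def L2_cnj_add fourier_add)

lemma fourier_inv_cscale: "fourier_inv (cscale c f) = cscale c (fourier_inv f)"
  by (simp add: fourier_inv_def L2_cnj_cscale fourier_cscale)

lemma norm_fourier_inv: "norm (fourier_inv f) = norm f"
  by (simp add: fourier_inv_def norm_L2_cnj norm_fourier)

lemma inner_fourier_inv: "fourier_inv f \<bullet> fourier_inv g = f \<bullet> g"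
proof (rule inner_isometry)
  show "linear (fourier_inv :: 'a L2 \<Rightarrow> 'a L2)"
    by (intro bounded_linear.linear L2_bounded_linearI[where C = 1])
      (auto simp: fourier_inv_add fourier_inv_cscale norm_fourier_inv)
qed (rule norm_fourier_inv)

lemma fourier_adjoint_L1:
  fixes f g :: "real^'n::finite \<Rightarrow> complex"
  assumes f: "square_integrable f" "integrable lborel f" and g: "square_integrable g" "integrable lborel g"
  shows "fourier (abs_L2 f) \<bullet> L2_cnj (abs_L2 g) = abs_L2 f \<bullet> L2_cnj (fourier (abs_L2 g))"
proof -
  have [measurable]: "f \<in> borel_measurable borel" "g \<in> borel_measurable borel"
    using f g by (auto simp: square_integrable_def)
  have inner_cnj: "a \<bullet> cnj b = Re (a * b)" for a b :: complex
    by (simp add: inner_complex_def)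
  have "integrable lborel (\<lambda>w. g w * fourier_integral f w)"
    by (rule integrable_mult_bounded[OF g(2) _ norm_fourier_integral_le]) simp
  then have 1: "integrable lborel (\<lambda>w. fourier_integral f w * g w)"
    by (simp add: mult.commute)
  have 2: "integrable lborel (\<lambda>w. f w * fourier_integral g w)"
    by (rule integrable_mult_bounded[OF f(2) _ norm_fourier_integral_le]) simp
  have "fourier (abs_L2 f) \<bullet> L2_cnj (abs_L2 g) = Re (\<integral>w. fourier_integral f w * g w \<partial>lborel)"
    using integral_Re[OF 1]
    by (simp add: fourier_abs f g L2_cnj_abs inner_abs Plancherel_L1_L2 square_integrable_cnj inner_cnj)
  also have "\<dots> = Re (\<integral>w. f w * fourier_integral g w \<partial>lborel)"
    by (simp add: fourier_multiplication_formula f g)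
  also have "\<dots> = abs_L2 f \<bullet> L2_cnj (fourier (abs_L2 g))"
    using integral_Re[OF 2]
    by (simp add: fourier_abs f g L2_cnj_abs inner_abs Plancherel_L1_L2 square_integrable_cnj inner_cnj)
  finally show ?thesis .
qed

lemma fourier_adjoint: "fourier f \<bullet> g = f \<bullet> fourier_inv g"
proof -
  have "fourier f \<bullet> L2_cnj h = f \<bullet> L2_cnj (fourier h)" for h :: "'a L2"
  proof (rule L1_dense_induct[of "\<lambda>f. fourier f \<bullet> L2_cnj h = f \<bullet> L2_cnj (fourier h)"])
    show "closed {f. fourier f \<bullet> L2_cnj h = f \<bullet> L2_cnj (fourier h)}"
      by (intro closed_Collect_eq continuous_intros)
    fix u :: "real^'a \<Rightarrow> complex" assume u: "square_integrable u" "integrable lborel u"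
    show "fourier (abs_L2 u) \<bullet> L2_cnj h = abs_L2 u \<bullet> L2_cnj (fourier h)"
    proof (rule L1_dense_induct[of "\<lambda>h. fourier (abs_L2 u) \<bullet> L2_cnj h = abs_L2 u \<bullet> L2_cnj (fourier h)"])
      show "closed {h. fourier (abs_L2 u) \<bullet> L2_cnj h = abs_L2 u \<bullet> L2_cnj (fourier h)}"
        by (intro closed_Collect_eq continuous_intros)
    qed (rule fourier_adjoint_L1[OF u])
  qed
  from this[of "L2_cnj g"] show ?thesis
    by (simp add: fourier_inv_def)
qed

lemma inner_ext: "(\<And>g. f \<bullet> g = h \<bullet> g) \<Longrightarrow> f = (h :: 'a::real_inner)"
  using vector_eq_ldot[of f h] by (metis inner_commute vector_eq_ldot)

text \<open>
  Both \<open>fourier\<close> and its adjoint are isometries, so each is a left inverse of the other.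
\<close>

lemma fourier_inv_fourier [simp]: "fourier_inv (fourier f) = f"
  by (rule inner_ext) (metis fourier_adjoint inner_commute inner_fourier)

lemma fourier_fourier_inv [simp]: "fourier (fourier_inv f) = f"
  by (rule inner_ext) (metis fourier_adjoint inner_fourier_inv)

lemma fourier_eq_iff: "fourier f = fourier g \<longleftrightarrow> f = g"
  using fourier_inv_fourier by metis

section \<open>Fourier multipliers\<close>

definition ess_bounded_by :: "real \<Rightarrow> (real^'n::finite \<Rightarrow> complex) \<Rightarrow> bool" where
  "ess_bounded_by C m \<longleftrightarrow> m \<in> borel_measurable borel \<and> (AE x in lborel. norm (m x) \<le> C)"

lemma ess_bounded_byD:
  assumes "ess_bounded_by C m"
  shows "m \<in> borel_measurable borel" "AE x in lborel. norm (m x) \<le> C"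
  using assms by (auto simp: ess_bounded_by_def)

lemma ess_bounded_by_mult:
  assumes m: "ess_bounded_by C m" and m': "ess_bounded_by C' m'"
  shows "ess_bounded_by (C * C') (\<lambda>x. m x * m' x)"
  unfolding ess_bounded_by_def
proof
  show "(\<lambda>x. m x * m' x) \<in> borel_measurable borel"
    using m m' by (auto dest!: ess_bounded_byD(1))
  show "AE x in lborel. norm (m x * m' x) \<le> C * C'"
    using ess_bounded_byD(2)[OF m] ess_bounded_byD(2)[OF m']
  proof eventually_elim
    case (elim x)
    then show ?case
      unfolding norm_mult by (intro mult_mono order_trans[OF norm_ge_zero elim(1)]) auto
  qed
qed

definition mult_op :: "(real^'n::finite \<Rightarrow> complex) \<Rightarrow> 'n L2 \<Rightarrow> 'n L2" where
  "mult_op m f = abs_L2 (\<lambda>x. m x * rep_L2 f x)"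

lemma square_integrable_mult:
  assumes m: "ess_bounded_by C m" and f: "square_integrable f"
  shows "square_integrable (\<lambda>x. m x * f x)"
  unfolding square_integrable_def
proof
  note [measurable] = ess_bounded_byD(1)[OF m]
  have [measurable]: "f \<in> borel_measurable borel"
    using f by (simp add: square_integrable_def)
  show "(\<lambda>x. m x * f x) \<in> borel_measurable lborel"
    by measurable
  show "integrable lborel (\<lambda>x. (norm (m x * f x))\<^sup>2)"
  proof (rule Bochner_Integration.integrable_bound)
    show "integrable lborel (\<lambda>x. C\<^sup>2 * (norm (f x))\<^sup>2)"
      using f by (simp add: square_integrable_def)
    show "AE x in lborel. norm ((norm (m x * f x))\<^sup>2) \<le> norm (C\<^sup>2 * (norm (f x))\<^sup>2)"
      using ess_bounded_byD(2)[OF m]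
      by eventually_elim (auto simp: norm_mult power_mult_distrib intro!: mult_right_mono power_mono)
  qed measurable
qed

lemma mult_op_abs:
  assumes m: "ess_bounded_by C m" and f: "square_integrable f"
  shows "mult_op m (abs_L2 f) = abs_L2 (\<lambda>x. m x * f x)"
  unfolding mult_op_def using rep_abs_L2[OF f]
  by (subst abs_L2_eq_iff) (auto intro!: square_integrable_mult[OF m] square_integrable_rep f)

lemma rep_mult_op:
  assumes m: "ess_bounded_by C m"
  shows "AE x in lborel. rep_L2 (mult_op m f) x = m x * rep_L2 f x"
  unfolding mult_op_def by (rule rep_abs_L2[OF square_integrable_mult[OF m square_integrable_rep]])

lemma mult_op_cong_AE:
  assumes "ess_bounded_by C m" "ess_bounded_by C' m'"
    and "AE x in lborel. rep_L2 f x \<noteq> 0 \<longrightarrow> m x = m' x"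
  shows "mult_op m f = mult_op m' f"
  unfolding mult_op_def using assms
  by (subst abs_L2_eq_iff) (auto intro!: square_integrable_mult square_integrable_rep)

lemma mult_op_mult_op:
  assumes m: "ess_bounded_by C m" and m': "ess_bounded_by C' m'"
  shows "mult_op m (mult_op m' f) = mult_op (\<lambda>x. m x * m' x) f"
  using mult_op_abs[OF m square_integrable_mult[OF m' square_integrable_rep[of f]]]
  by (simp add: mult_op_def[of m' f] mult_op_def[of "\<lambda>x. m x * m' x"] mult.assoc)

lemma mult_op_add:
  assumes m: "ess_bounded_by C m"
  shows "mult_op m (f + g) = mult_op m f + mult_op m g"
  using mult_op_abs[OF m square_integrable_add[OF square_integrable_rep square_integrable_rep], of f g]
    plus_abs[OF square_integrable_rep square_integrable_rep, of f g]
    plus_abs[OF square_integrable_mult[OF m square_integrable_rep] square_integrable_mult[OF m square_integrable_rep], of f g]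
  by (simp add: mult_op_def[of m f] mult_op_def[of m g] distrib_left)

lemma mult_op_cscale:
  assumes m: "ess_bounded_by C m"
  shows "mult_op m (cscale c f) = cscale c (mult_op m f)"
  using mult_op_abs[OF m square_integrable_cmult[OF square_integrable_rep], of c f]
    cscale_abs[OF square_integrable_rep, of c f]
    cscale_abs[OF square_integrable_mult[OF m square_integrable_rep], of c f]
  by (simp add: mult_op_def[of m f] mult.left_commute)

lemma norm_mult_op_le:
  assumes m: "ess_bounded_by C m" and C: "C \<ge> 0"
  shows "norm (mult_op m f) \<le> C * norm f"
proof -
  note [measurable] = ess_bounded_byD(1)[OF m]
  have "(norm (mult_op m f))\<^sup>2 = (\<integral>x. (norm (m x * rep_L2 f x))\<^sup>2 \<partial>lborel)"
    unfolding mult_op_def by (rule norm_abs_sq[OF square_integrable_mult[OF m square_integrable_rep]])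
  also have "\<dots> \<le> (\<integral>x. C\<^sup>2 * (norm (rep_L2 f x))\<^sup>2 \<partial>lborel)"
  proof (rule integral_mono_AE)
    show "integrable lborel (\<lambda>x. (norm (m x * rep_L2 f x))\<^sup>2)"
      using square_integrable_mult[OF m square_integrable_rep] by (simp add: square_integrable_def)
    show "AE x in lborel. (norm (m x * rep_L2 f x))\<^sup>2 \<le> C\<^sup>2 * (norm (rep_L2 f x))\<^sup>2"
      using ess_bounded_byD(2)[OF m]
      by eventually_elim (auto simp: norm_mult power_mult_distrib intro!: mult_right_mono power_mono)
  qed (use square_integrable_rep_integrable in auto)
  also have "\<dots> = (C * norm f)\<^sup>2"
    by (simp add: norm_rep_sq[of f] power_mult_distrib)
  finally show ?thesis
    using C by (auto dest!: power2_le_imp_le)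
qed

lemma bounded_linear_mult_op: "ess_bounded_by C m \<Longrightarrow> C \<ge> 0 \<Longrightarrow> bounded_linear (mult_op m)"
  by (rule L2_bounded_linearI[where C = C]) (simp_all add: mult_op_add mult_op_cscale norm_mult_op_le)

lemma mult_op_tendsto:
  assumes m: "\<And>n. ess_bounded_by C (m n)" and m': "m' \<in> borel_measurable borel"
    and lim: "AE x in lborel. (\<lambda>n. m n x) \<longlonglongrightarrow> m' x"
  shows "(\<lambda>n. mult_op (m n) f) \<longlonglongrightarrow> mult_op m' f"
proof -
  note [measurable] = ess_bounded_byD(1)[OF m] m'
  show ?thesis
    unfolding mult_op_def
  proof (rule L2_dominated_convergence(3)[where w = "\<lambda>x. C * norm (rep_L2 f x)"])
    show "integrable lborel (\<lambda>x. (C * norm (rep_L2 f x))\<^sup>2)"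
      unfolding power_mult_distrib by (intro integrable_mult_right square_integrable_rep_integrable)
    show "AE x in lborel. norm (m n x * rep_L2 f x) \<le> C * norm (rep_L2 f x)" for n
      using ess_bounded_byD(2)[OF m, of n] by eventually_elim (auto simp: norm_mult intro: mult_right_mono)
    show "AE x in lborel. (\<lambda>n. m n x * rep_L2 f x) \<longlonglongrightarrow> m' x * rep_L2 f x"
      using lim by eventually_elim (intro tendsto_intros)
  qed measurable
qed

definition fourier_multiplier :: "(real^'n::finite \<Rightarrow> complex) \<Rightarrow> 'n L2 \<Rightarrow> 'n L2" where
  "fourier_multiplier m f = fourier_inv (mult_op m (fourier f))"

lemma fourier_multiplier: "fourier (fourier_multiplier m f) = mult_op m (fourier f)"
  by (simp add: fourier_multiplier_def)

lemma fourier_multiplier_mult: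
  assumes "ess_bounded_by C m" "ess_bounded_by C' m'"
  shows "fourier_multiplier m (fourier_multiplier m' f) = fourier_multiplier (\<lambda>x. m x * m' x) f"
  using mult_op_mult_op[OF assms] by (simp add: fourier_multiplier_def)

lemma fourier_multiplier_add:
  "ess_bounded_by C m \<Longrightarrow> fourier_multiplier m (f + g) = fourier_multiplier m f + fourier_multiplier m g"
  by (simp add: fourier_multiplier_def fourier_add mult_op_add fourier_inv_add)

lemma fourier_multiplier_cscale:
  "ess_bounded_by C m \<Longrightarrow> fourier_multiplier m (cscale c f) = cscale c (fourier_multiplier m f)"
  by (simp add: fourier_multiplier_def fourier_cscale mult_op_cscale fourier_inv_cscale)

lemma norm_fourier_multiplier_le:
  "ess_bounded_by C m \<Longrightarrow> C \<ge> 0 \<Longrightarrow> norm (fourier_multiplier m f) \<le> C * norm f"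
  using norm_mult_op_le[of C m "fourier f"] by (simp add: fourier_multiplier_def norm_fourier norm_fourier_inv)

lemma fourier_multiplier_tendsto:
  assumes "\<And>n. ess_bounded_by C (m n)" "m' \<in> borel_measurable borel"
    and "AE x in lborel. (\<lambda>n. m n x) \<longlonglongrightarrow> m' x"
  shows "(\<lambda>n. fourier_multiplier (m n) f) \<longlonglongrightarrow> fourier_multiplier m' f"
  unfolding fourier_multiplier_def
  by (rule continuous_on_tendsto_compose[OF continuous_on_fourier_inv[OF continuous_on_id[of UNIV]]
        mult_op_tendsto[OF assms]]) auto

definition character :: "int^'n \<Rightarrow> real^'n \<Rightarrow> complex" where
  "character k w = cis (- 2 * pi * (w \<bullet> of_int_vec k))"

lemma ess_bounded_by_character: "ess_bounded_by 1 (character k)"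
  by (simp add: ess_bounded_by_def character_def[abs_def])

lemma continuous_on_mult_op_character [continuous_intros]:
  "continuous_on S f \<Longrightarrow> continuous_on S (\<lambda>x. mult_op (character k) (f x))"
  by (rule bounded_linear.continuous_on[OF bounded_linear_mult_op[OF ess_bounded_by_character]]) simp_all

text \<open>
  Translation becomes modulation under the Fourier transform. This is how shift preserving operators are
  tied to multipliers with a periodic symbol.
\<close>

lemma shift_eq_fourier_multiplier: "shift k f = fourier_multiplier (character k) f"
proof -
  have "fourier (shift k f) = mult_op (character k) (fourier f)"
  proof (rule L1_dense_induct[of "\<lambda>f. fourier (shift k f) = mult_op (character k) (fourier f)"])
    show "closed {f. fourier (shift k f) = mult_op (character k) (fourier f)}"
      by (intro closed_Collect_eq continuous_intros)
    fix u :: "real^'a \<Rightarrow> complex" assume u: "square_integrable u" "integrable lborel u"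
    then have um: "u \<in> borel_measurable borel"
      by (simp add: square_integrable_def)
    have int: "integrable lborel (\<lambda>x. u (x - of_int_vec k))"
      using integrable_affine[OF u(2), of 1 "- of_int_vec k"] by simp
    show "fourier (shift k (abs_L2 u)) = mult_op (character k) (fourier (abs_L2 u))"
      unfolding shift_abs[OF u(1)] fourier_abs[OF u] fourier_abs[OF square_integrable_shift[OF u(1)] int]
        mult_op_abs[OF ess_bounded_by_character Plancherel_L1_L2(1)[OF u]]
      by (simp add: fourier_integral_shift[OF um, abs_def] character_def[abs_def])
  qed
  then show ?thesis
    unfolding fourier_multiplier_def by (metis fourier_inv_fourier)
qed

section \<open>Periodic functions and trigonometric polynomials\<close>

definition floor_vec :: "real^'n \<Rightarrow> int^'n" where
  "floor_vec x = (\<chi> i. \<lfloor>x $ i\<rfloor>)"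

definition frac_vec :: "real^'n \<Rightarrow> real^'n" where
  "frac_vec x = (\<chi> i. frac (x $ i))"

lemma frac_floor_vec: "frac_vec x + of_int_vec (floor_vec x) = x"
  by (simp add: vec_eq_iff frac_vec_def floor_vec_def of_int_vec_def frac_def)

lemma frac_vec_in_cube: "frac_vec x \<in> unit_cube"
  by (simp add: unit_cube_def frac_vec_def frac_lt_1)

lemma frac_vec_cube_add: "w \<in> unit_cube \<Longrightarrow> frac_vec (w + of_int_vec k) = w"
  by (auto simp: vec_eq_iff frac_vec_def of_int_vec_def unit_cube_def frac_eq)

lemma frac_vec_cube: "w \<in> unit_cube \<Longrightarrow> frac_vec w = w"
  by (auto simp: vec_eq_iff frac_vec_def unit_cube_def frac_eq)

lemma frac_vec_measurable [measurable]: "frac_vec \<in> borel_measurable borel"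
proof -
  have comp: "(\<lambda>x :: real^'n. x $ i) \<in> borel_measurable borel" for i
    by (intro borel_measurable_continuous_onI continuous_intros)
  have frac: "(frac :: real \<Rightarrow> real) \<in> borel_measurable borel"
    unfolding frac_def[abs_def] using borel_measurable_real_floor by measurable
  have "(\<lambda>x :: real^'n. \<Sum>i\<in>UNIV. frac (x $ i) *\<^sub>R (axis i 1 :: real^'n)) \<in> borel_measurable borel"
    by (intro borel_measurable_sum borel_measurable_scaleR measurable_compose[OF comp frac] borel_measurable_const)
  also have "(\<lambda>x :: real^'n. \<Sum>i\<in>UNIV. frac (x $ i) *\<^sub>R (axis i 1 :: real^'n)) = frac_vec"
    by (auto simp: fun_eq_iff vec_eq_iff frac_vec_def axis_def if_distrib cong: if_cong)
  finally show ?thesis .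
qed

lemma of_int_vec_add: "of_int_vec (k + l) = of_int_vec k + of_int_vec l"
  by (simp add: vec_eq_iff of_int_vec_def)

lemma of_int_vec_minus: "of_int_vec (- k) = - of_int_vec k"
  by (simp add: vec_eq_iff of_int_vec_def)

lemma of_int_vec_0 [simp]: "of_int_vec 0 = 0"
  by (simp add: vec_eq_iff of_int_vec_def)

text \<open>
  Properties of the fibers over almost every point of the cube are properties of almost every point of
  the whole space, because the countably many integer translates of the cube tile the space.
\<close>

lemma AE_unit_cube_iff:
  fixes P :: "real^'n::finite \<Rightarrow> real^'n \<Rightarrow> bool"
  shows "(AE w\<in>unit_cube in lborel. (\<forall>k. P w (w + of_int_vec k)))
    \<longleftrightarrow> (AE x in lborel. P (frac_vec x) x)"
proof
  assume "AE w\<in>unit_cube in lborel. (\<forall>k. P w (w + of_int_vec k))"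
  then have "AE x in lborel. \<forall>j. x - of_int_vec j \<in> unit_cube \<longrightarrow> (\<forall>k. P (x - of_int_vec j) (x - of_int_vec j + of_int_vec k))"
    unfolding AE_all_countable by (intro allI AE_lborel_shift)
  then show "AE x in lborel. P (frac_vec x) x"
  proof eventually_elim
    case (elim x)
    have "x - of_int_vec (floor_vec x) = frac_vec x"
      using frac_floor_vec[of x] by (simp add: algebra_simps)
    then show ?case
      using spec[OF elim, of "floor_vec x"] frac_vec_in_cube[of x] by (metis frac_floor_vec)
  qed
next
  assume *: "AE x in lborel. P (frac_vec x) x"
  have "AE w in lborel. \<forall>k. P (frac_vec (w - - of_int_vec k)) (w - - of_int_vec k)"
    unfolding AE_all_countable using AE_lborel_shift[OF *] by blast
  then show "AE w\<in>unit_cube in lborel. (\<forall>k. P w (w + of_int_vec k))"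
    by eventually_elim (auto simp: frac_vec_cube_add)
qed

lemma AE_frac_vec_iff:
  fixes P :: "real^'n::finite \<Rightarrow> bool"
  shows "(AE x in lborel. P (frac_vec x)) \<longleftrightarrow> (AE w\<in>unit_cube in lborel. P w)"
  using AE_unit_cube_iff[of "\<lambda>w x. P w"] by simp

lemma character_measurable [measurable]: "character k \<in> borel_measurable borel"
  using ess_bounded_by_character ess_bounded_byD(1) by blast

lemma norm_character [simp]: "norm (character k w) = 1"
  by (simp add: character_def)

lemma character_0 [simp]: "character 0 w = 1"
  by (simp add: character_def)

lemma character_add: "character (k + l) w = character k w * character l w"
  by (simp add: character_def of_int_vec_add inner_add_right cis_mult algebra_simps)

lemma character_minus: "character (- k) w = cnj (character k w)"
  by (simp add: character_def of_int_vec_minus cis_cnj)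

lemma character_periodic: "character k (w + of_int_vec j) = character k w"
proof -
  have "of_int_vec j \<bullet> of_int_vec k = real_of_int (\<Sum>i\<in>UNIV. j $ i * k $ i)"
    by (simp add: inner_vec_def of_int_vec_def)
  then have "cis (- 2 * pi * (of_int_vec j \<bullet> of_int_vec k)) = cis (2 * pi * of_int (- (\<Sum>i\<in>UNIV. j $ i * k $ i)))"
    by simp
  also have "\<dots> = 1"
    by (rule cis_multiple_2pi[OF Ints_of_int])
  finally have 1: "cis (- 2 * pi * (of_int_vec j \<bullet> of_int_vec k)) = 1" .
  have "character k (w + of_int_vec j) = character k w * cis (- 2 * pi * (of_int_vec j \<bullet> of_int_vec k))"
    unfolding character_def inner_add_left distrib_left cis_mult ..
  then show ?thesis by (simp only: 1 mult_1_right)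
qed

lemma character_frac_vec: "character k (frac_vec w) = character k w"
  using character_periodic[of k "frac_vec w" "floor_vec w"] by (simp add: frac_floor_vec)

definition trig_poly :: "(real^'n \<Rightarrow> complex) \<Rightarrow> bool" where
  "trig_poly p \<longleftrightarrow> (\<exists>K a. finite K \<and> p = (\<lambda>w. \<Sum>k\<in>K. a k * character k w))"

lemma trig_polyI: "finite K \<Longrightarrow> trig_poly (\<lambda>w. \<Sum>k\<in>K. a k * character k w)"
  unfolding trig_poly_def by blast

lemma trig_polyE:
  assumes "trig_poly p"
  obtains K a where "finite K" "\<And>w. p w = (\<Sum>k\<in>K. a k * character k w)"
  using assms unfolding trig_poly_def by blast

lemma trig_poly_cmult_character: "trig_poly (\<lambda>w. c * character k w)"
  using trig_polyI[of "{k}" "\<lambda>_. c"] by simp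

lemma trig_poly_const: "trig_poly (\<lambda>w. c)"
  using trig_poly_cmult_character[of c 0] by simp

lemma trig_poly_add:
  assumes "trig_poly p" "trig_poly q"
  shows "trig_poly (\<lambda>w. p w + q w)"
proof -
  obtain K a where K: "finite K" "\<And>w. p w = (\<Sum>k\<in>K. a k * character k w)"
    using trig_polyE[OF assms(1)] by blast
  obtain J b where J: "finite J" "\<And>w. q w = (\<Sum>k\<in>J. b k * character k w)"
    using trig_polyE[OF assms(2)] by blast
  let ?a = "\<lambda>k. if k \<in> K then a k else 0" and ?b = "\<lambda>k. if k \<in> J then b k else 0"
  have "p w = (\<Sum>k\<in>K \<union> J. ?a k * character k w)" "q w = (\<Sum>k\<in>K \<union> J. ?b k * character k w)" for w
    unfolding K J using K(1) J(1) by (auto intro!: sum.mono_neutral_cong_left)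
  then have "p w + q w = (\<Sum>k\<in>K \<union> J. (?a k + ?b k) * character k w)" for w
    by (simp only: distrib_right sum.distrib)
  then show ?thesis
    using trig_polyI[of "K \<union> J" "\<lambda>k. ?a k + ?b k"] K(1) J(1) by simp
qed

lemma trig_poly_sum: "(\<And>i. i \<in> I \<Longrightarrow> trig_poly (p i)) \<Longrightarrow> trig_poly (\<lambda>w. \<Sum>i\<in>I. p i w)"
  by (induction I rule: infinite_finite_induct) (auto intro: trig_poly_add trig_poly_const)

lemma trig_poly_mult:
  assumes "trig_poly p" "trig_poly q"
  shows "trig_poly (\<lambda>w. p w * q w)"
proof -
  obtain K a where K: "finite K" "\<And>w. p w = (\<Sum>k\<in>K. a k * character k w)"
    using trig_polyE[OF assms(1)] by blast
  obtain J b where J: "finite J" "\<And>w. q w = (\<Sum>k\<in>J. b k * character k w)"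
    using trig_polyE[OF assms(2)] by blast
  have "trig_poly (\<lambda>w. \<Sum>k\<in>K. \<Sum>l\<in>J. a k * b l * character (k + l) w)"
    by (intro trig_poly_sum trig_poly_cmult_character)
  also have "(\<lambda>w. \<Sum>k\<in>K. \<Sum>l\<in>J. a k * b l * character (k + l) w) = (\<lambda>w. p w * q w)"
    by (simp add: K J sum_product character_add mult_ac)
  finally show ?thesis .
qed

lemma trig_poly_cmult: "trig_poly p \<Longrightarrow> trig_poly (\<lambda>w. c * p w)"
  by (intro trig_poly_mult trig_poly_const)

lemma trig_poly_measurable:
  assumes "trig_poly p" shows "p \<in> borel_measurable borel"
proof -
  obtain K a where "finite K" "\<And>w. p w = (\<Sum>k\<in>K. a k * character k w)"
    using trig_polyE[OF assms] by blast
  then have "p = (\<lambda>w. \<Sum>k\<in>K. a k * character k w)" by blast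
  then show ?thesis by simp
qed

lemma trig_poly_frac_vec: "trig_poly p \<Longrightarrow> p (frac_vec w) = p w"
  by (erule trig_polyE) (simp add: character_frac_vec)

definition torus_map :: "real^'n \<Rightarrow> complex^'n" where
  "torus_map w = (\<chi> i. cis (2 * pi * w $ i))"

lemma trig_poly_cos_sin:
  fixes i :: "'n::finite"
  shows "trig_poly (\<lambda>w :: real^'n. complex_of_real (cos (2 * pi * w $ i)))"
    "trig_poly (\<lambda>w :: real^'n. complex_of_real (sin (2 * pi * w $ i)))"
proof -
  have ch: "character (axis i 1) w = cis (- (2 * pi * w $ i))" for w :: "real^'n"
  proof -
    have "of_int_vec (axis i 1) = (axis i 1 :: real^'n)"
      by (simp add: vec_eq_iff of_int_vec_def axis_def)
    then show ?thesis by (simp add: character_def inner_axis)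
  qed
  have "(\<lambda>w :: real^'n. complex_of_real (cos (2 * pi * w $ i)))
      = (\<lambda>w. 1/2 * character (axis i 1) w + 1/2 * character (- axis i 1) w)"
    by (auto simp: character_minus ch complex_eq_iff)
  then show "trig_poly (\<lambda>w :: real^'n. complex_of_real (cos (2 * pi * w $ i)))"
    by (simp only: trig_poly_add trig_poly_cmult_character)
  have "(\<lambda>w :: real^'n. complex_of_real (sin (2 * pi * w $ i)))
      = (\<lambda>w. \<i>/2 * character (axis i 1) w + (- \<i>/2) * character (- axis i 1) w)"
    by (auto simp: character_minus ch complex_eq_iff)
  then show "trig_poly (\<lambda>w :: real^'n. complex_of_real (sin (2 * pi * w $ i)))"
    by (simp only: trig_poly_add trig_poly_cmult_character)
qed

lemma trig_poly_real_polynomial_torus: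
  fixes f :: "complex^'n::finite \<Rightarrow> real"
  assumes "real_polynomial_function f"
  shows "trig_poly (\<lambda>w. complex_of_real (f (torus_map w)))"
  using assms
proof induction
  case (linear f)
  have lin: "linear f" by (rule bounded_linear.linear[OF linear])
  have "f (\<Sum>b\<in>Basis. (z \<bullet> b) *\<^sub>R b) = (\<Sum>b\<in>Basis. (z \<bullet> b) * f b)" for z
    by (simp add: linear_sum[OF lin] linear_scale[OF lin] del: euclidean_representation)
  then have "f (torus_map w) = (\<Sum>b\<in>Basis. (torus_map w \<bullet> b) * f b)" for w
    unfolding euclidean_representation .
  moreover have "trig_poly (\<lambda>w. complex_of_real (f b) * complex_of_real (torus_map w \<bullet> b))"
    if "b \<in> Basis" for b :: "complex^'n"
  proof -
    obtain i u where b: "b = axis i u" "u = 1 \<or> u = \<i>"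
      using \<open>b \<in> Basis\<close> by (auto simp: Basis_vec_def Basis_complex_def)
    then have "(\<lambda>w. complex_of_real (torus_map w \<bullet> b)) = (\<lambda>w. complex_of_real (cos (2 * pi * w $ i)))
        \<or> (\<lambda>w. complex_of_real (torus_map w \<bullet> b)) = (\<lambda>w. complex_of_real (sin (2 * pi * w $ i)))"
      by (auto simp: inner_axis torus_map_def inner_complex_def)
    then show ?thesis
      using trig_poly_cos_sin[of i] by (intro trig_poly_cmult) auto
  qed
  ultimately show ?case
    by (simp add: mult.commute trig_poly_sum)
next
  case (const c)
  then show ?case by (rule trig_poly_const)
next
  case (add f g)
  then show ?case by (simp add: trig_poly_add)
next
  case (mult f g)
  then show ?case by (simp add: trig_poly_mult)
qed

lemma continuous_on_compact_image:
  fixes e :: "'a::t2_space \<Rightarrow> 'b::t2_space" and h :: "'b \<Rightarrow> 'c::topological_space"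
  assumes K: "compact K" and e: "continuous_on K e" and he: "continuous_on K (h \<circ> e)"
  shows "continuous_on (e ` K) h"
  unfolding continuous_on_closed_vimage[OF compact_imp_closed[OF compact_continuous_image[OF e K]]]
proof (intro allI impI)
  fix B :: "'c set" assume "closed B"
  then have "closed ((h \<circ> e) -` B \<inter> K)"
    using he continuous_on_closed_vimage[OF compact_imp_closed[OF K]] by blast
  then have "compact ((h \<circ> e) -` B \<inter> K)"
    by (metis K compact_Int_closed inf.right_idem inf_commute)
  then have "compact (e ` ((h \<circ> e) -` B \<inter> K))"
    by (intro compact_continuous_image continuous_on_subset[OF e]) auto
  moreover have "e ` ((h \<circ> e) -` B \<inter> K) = h -` B \<inter> e ` K"
    by auto
  ultimately show "closed (h -` B \<inter> e ` K)"
    using compact_imp_closed by metis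
qed

text \<open>
  A continuous function that vanishes on the boundary of the cube descends to a continuous function on
  the torus, where the Stone--Weierstrass theorem applies.
\<close>

lemma trig_poly_approx_continuous:
  fixes h :: "real^'n::finite \<Rightarrow> complex"
  assumes cont: "continuous_on UNIV h" and bd: "\<And>x i. x $ i = 0 \<or> x $ i = 1 \<Longrightarrow> h x = 0" and e: "e > 0"
  obtains p where "trig_poly p" "\<And>x. x \<in> unit_cube \<Longrightarrow> norm (h x - p x) < e"
proof -
  define K where "K = {x :: real^'n. \<forall>i. 0 \<le> x $ i \<and> x $ i \<le> 1}"
  have "K = cbox (\<chi> i. 0) (\<chi> i. 1)"
    by (auto simp: K_def mem_box_cart)
  then have K: "compact K" by simp
  define H where "H z = h (\<chi> i. Arg2pi (z $ i) / (2 * pi))" for z :: "complex^'n"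
  have Arg1: "Arg2pi 1 = 0"
    using Arg2pi_of_real[of 1] by simp
  have Arg: "Arg2pi (cis (2 * pi * t)) = (if t = 1 then 0 else 2 * pi * t)" if "0 \<le> t" "t \<le> 1" for t
  proof (cases "t = 1")
    case True
    then show ?thesis using Arg1 by simp
  next
    case False
    then show ?thesis
      using that by (intro Arg2pi_unique[of 1, simplified]) (auto simp: cis_conv_exp)
  qed
  have H: "H (torus_map x) = h x" if "x \<in> K" for x
  proof (cases "\<exists>i. x $ i = 1")
    case True
    then obtain i where i: "x $ i = 1" by blast
    then have "(\<chi> i. Arg2pi (torus_map x $ i) / (2 * pi)) $ i = 0"
      by (simp add: torus_map_def Arg1)
    then show ?thesis
      using bd i unfolding H_def by metis
  next
    case False
    then have "(\<chi> i. Arg2pi (torus_map x $ i) / (2 * pi)) = x"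
      using that by (simp add: vec_eq_iff torus_map_def Arg K_def)
    then show ?thesis by (simp add: H_def)
  qed
  have t: "continuous_on K torus_map"
    unfolding torus_map_def by (intro continuous_intros)
  have "continuous_on K h"
    using cont by (rule continuous_on_subset) auto
  then have "continuous_on K (H \<circ> torus_map)"
    by (rule continuous_on_eq) (simp add: H)
  then have "continuous_on (torus_map ` K) H"
    by (rule continuous_on_compact_image[OF K t])
  then obtain q where q: "polynomial_function q" "\<And>z. z \<in> torus_map ` K \<Longrightarrow> norm (H z - q z) < e"
    using Stone_Weierstrass_polynomial_function[OF compact_continuous_image[OF t K] _ e, of H] by blast
  have "real_polynomial_function (Re \<circ> q)" "real_polynomial_function (Im \<circ> q)"
    using q(1) bounded_linear_Re bounded_linear_Im unfolding polynomial_function_def by auto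
  then have "trig_poly (\<lambda>w. complex_of_real ((Re \<circ> q) (torus_map w)) + \<i> * complex_of_real ((Im \<circ> q) (torus_map w)))"
    by (intro trig_poly_add trig_poly_cmult trig_poly_real_polynomial_torus)
  then have "trig_poly (\<lambda>w. q (torus_map w))"
    by (simp flip: complex_eq)
  moreover have "norm (h x - q (torus_map x)) < e" if "x \<in> unit_cube" for x
  proof -
    have "x \<in> K" using that by (auto simp: K_def unit_cube_def less_imp_le)
    then show ?thesis using q(2)[of "torus_map x"] by (simp add: H)
  qed
  ultimately show ?thesis using that by blast
qed

text \<open>
  Approximate \<open>g\<close> by continuous functions, cut these off near the boundary of the cube, and approximate the results
  uniformly on the torus. This serves both for the completeness of the characters and for the commutation of
  multipliers with shift preserving operators.
\<close>

lemma bounded_measurable_AE_limit_trig_poly: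
  fixes g :: "real^'n::finite \<Rightarrow> complex"
  assumes g: "g \<in> borel_measurable borel" and C: "\<And>x. norm (g x) \<le> C"
  obtains p where "\<And>n. trig_poly (p n)" "\<And>n x. norm (p n x) \<le> C + 1"
    "AE x in lborel. (\<lambda>n. p n x) \<longlonglongrightarrow> g (frac_vec x)"
proof -
  obtain u where u: "\<And>n. continuous_on UNIV (u n)" "\<And>n x. norm (u n x) \<le> C"
    "AE x in lborel. (\<lambda>n. u n x) \<longlonglongrightarrow> g x"
    using bounded_measurable_AE_limit_continuous[OF g C] by metis
  \<comment> \<open>The factor \<open>\<theta> n\<close> vanishes on the boundary of the cube and tends to one inside.\<close>
  define \<pi> where "\<pi> x = (\<Prod>i\<in>UNIV. max 0 (x $ i * (1 - x $ i)))" for x :: "real^'n"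
  define \<theta> where "\<theta> n x = min 1 (real n * \<pi> x)" for n x
  define h where "h n x = \<theta> n x *\<^sub>R u n x" for n x
  have \<pi>0: "\<pi> x \<ge> 0" for x
    by (auto simp: \<pi>_def intro: prod_nonneg)
  have h: "continuous_on UNIV (h n)" for n
    unfolding h_def \<theta>_def \<pi>_def by (intro continuous_intros u)
  have h0: "h n x = 0" if "x $ i = 0 \<or> x $ i = 1" for n x i
  proof -
    have "max 0 (x $ i * (1 - x $ i)) = 0" using that by auto
    then have "\<pi> x = 0"
      unfolding \<pi>_def by (intro prod_zero) auto
    then show ?thesis by (simp add: h_def \<theta>_def)
  qed
  have hC: "norm (h n x) \<le> C" for n x
  proof -
    have "\<bar>\<theta> n x\<bar> * norm (u n x) \<le> 1 * C"
      using \<pi>0[of x] by (intro mult_mono u) (auto simp: \<theta>_def)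
    then show ?thesis by (simp add: h_def)
  qed
  have "\<exists>p. trig_poly p \<and> (\<forall>x\<in>unit_cube. norm (h n x - p x) < inverse (real (Suc n)))" for n
    by (rule trig_poly_approx_continuous[OF h h0, where e = "inverse (real (Suc n))"]) auto
  then obtain p where p: "\<And>n. trig_poly (p n)"
    and near: "\<And>n x. x \<in> unit_cube \<Longrightarrow> norm (h n x - p n x) < inverse (real (Suc n))"
    by metis
  have bound: "norm (p n x) \<le> C + 1" for n x
  proof -
    have "inverse (real (Suc n)) \<le> 1"
      by (simp add: field_simps)
    then have "norm (h n (frac_vec x) - p n (frac_vec x)) \<le> 1"
      using near[OF frac_vec_in_cube, of n x] by linarith
    then have "norm (p n (frac_vec x)) \<le> C + 1"
      using hC[of n "frac_vec x"] norm_triangle_sub[of "p n (frac_vec x)" "h n (frac_vec x)"]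
      by (simp add: norm_minus_commute)
    then show ?thesis by (simp add: trig_poly_frac_vec p)
  qed
  have "AE x in (lborel :: (real^'n) measure). \<forall>i. x $ i \<noteq> 0"
  proof -
    have "AE x in (lborel :: (real^'n) measure). x $ i \<noteq> 0" for i
    proof -
      have "negligible {x :: real^'n. x \<bullet> axis i 1 = 0}"
        by (rule negligible_standard_hyperplane) (simp add: axis_in_Basis_iff)
      then have "AE x in lebesgue. x \<notin> {x :: real^'n. x \<bullet> axis i 1 = 0}"
        by (intro AE_not_in) (simp add: negligible_iff_null_sets)
      then show ?thesis
        by (simp add: AE_completion_iff inner_axis)
    qed
    then show ?thesis by (simp add: AE_all_countable)
  qed
  with u(3) have "AE x\<in>unit_cube in lborel. (\<lambda>n. p n x) \<longlonglongrightarrow> g x"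
  proof eventually_elim
    case (elim x)
    show ?case
    proof
      assume x: "x \<in> unit_cube"
      have "\<pi> x > 0"
        unfolding \<pi>_def using x elim(2)
        by (intro prod_pos ballI) (auto simp: unit_cube_def less_max_iff_disj order.not_eq_order_implies_strict intro!: mult_pos_pos)
      have "(\<lambda>n. h n x) \<longlonglongrightarrow> 1 *\<^sub>R g x"
        unfolding h_def
      proof (intro tendsto_intros elim(1))
        show "(\<lambda>n. \<theta> n x) \<longlonglongrightarrow> 1"
        proof (rule tendsto_eventually)
          obtain N where N: "1 / \<pi> x \<le> real N"
            using real_arch_simple by blast
          show "\<forall>\<^sub>F n in sequentially. \<theta> n x = 1"
            using eventually_ge_at_top[of N]
          proof eventually_elim
            case (elim n)
            then have "1 / \<pi> x \<le> real n" using N by linarith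
            then have "1 \<le> real n * \<pi> x" using \<open>\<pi> x > 0\<close> by (simp add: field_simps)
            then show ?case by (simp add: \<theta>_def)
          qed
        qed
      qed
      moreover have "(\<lambda>n. p n x - h n x) \<longlonglongrightarrow> 0"
        by (rule Lim_null_comparison[OF always_eventually LIMSEQ_inverse_real_of_nat])
          (use near[OF x] in \<open>auto simp: norm_minus_commute intro: less_imp_le simp del: of_nat_Suc\<close>)
      ultimately have "(\<lambda>n. p n x - h n x + h n x) \<longlonglongrightarrow> 0 + 1 *\<^sub>R g x"
        by (intro tendsto_add)
      then show "(\<lambda>n. p n x) \<longlonglongrightarrow> g x" by simp
    qed
  qed
  then have "AE x in lborel. (\<lambda>n. p n (frac_vec x)) \<longlonglongrightarrow> g (frac_vec x)"
    by (subst AE_frac_vec_iff)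
  then have "AE x in lborel. (\<lambda>n. p n x) \<longlonglongrightarrow> g (frac_vec x)"
    by (simp add: trig_poly_frac_vec p)
  then show ?thesis
    using that p bound by blast
qed

section \<open>Fourier series on the cube\<close>

lemma unit_cube_measurable [measurable]: "(unit_cube :: (real^'n::finite) set) \<in> sets borel"
proof -
  have [measurable]: "(\<lambda>x :: real^'n. x $ i) \<in> borel_measurable borel" for i
    by (intro borel_measurable_continuous_onI continuous_intros)
  show ?thesis
    unfolding unit_cube_def by measurable
qed

lemma indicator_unit_cube:
  "indicator unit_cube w = (\<Prod>b\<in>Basis. indicator {0..<1} (w \<bullet> b) :: complex)" for w :: "real^'n::finite"
proof (cases "w \<in> unit_cube")
  case True
  then have "w \<bullet> b \<in> {0..<1}" if "b \<in> Basis" for b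
    using that by (auto simp: unit_cube_def Basis_vec_def inner_axis)
  then show ?thesis using True by simp
next
  case False
  then obtain i where i: "w $ i \<notin> {0..<1}"
    by (auto simp: unit_cube_def)
  have "indicator {0..<1} (w \<bullet> axis i 1) = (0 :: complex)"
    using i by (simp add: inner_axis indicator_def)
  moreover have "axis i 1 \<in> (Basis :: (real^'n) set)"
    by (simp add: axis_in_Basis_iff)
  ultimately have "(\<Prod>b\<in>Basis. indicator {0..<1} (w \<bullet> b) :: complex) = 0"
    by (intro prod_zero) auto
  then show ?thesis using False by simp
qed

lemma integral_cis_unit_interval:
  "integrable lborel (\<lambda>t. indicator {0..<1} t * cis (- 2 * pi * (of_int n * t)))"
  "(\<integral>t. indicator {0..<1} t * cis (- 2 * pi * (of_int n * t)) \<partial>lborel) = (if n = 0 then 1 else 0)"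
proof -
  let ?f = "\<lambda>t. cis (- 2 * pi * (of_int n * t))"
  define F where "F t = (if n = 0 then of_real t else cis (- 2 * pi * (of_int n * t)) / (- 2 * pi * of_int n * \<i>))"
    for t :: real
  have "has_bochner_integral lborel (\<lambda>t. indicator {0..1} t *\<^sub>R ?f t) (F 1 - F 0)"
  proof (rule has_bochner_integral_FTC_Icc)
    show "continuous_on {0..1} ?f"
      by (intro continuous_intros)
    fix t :: real
    show "(F has_vector_derivative ?f t) (at t within {0..1})"
    proof (cases "n = 0")
      case True
      then show ?thesis
        unfolding F_def by (auto intro!: derivative_eq_intros simp: has_vector_derivative_def scaleR_conv_of_real fun_eq_iff)
    next
      case False
      have "((\<lambda>t. cis (- 2 * pi * (of_int n * t))) has_vector_derivative (- 2 * pi * of_int n * \<i>) * ?f t) (at t within {0..1})"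
        unfolding cis_conv_exp
        by (rule has_vector_derivative_real_field derivative_eq_intros refl | simp)+
      from has_vector_derivative_divide[OF this, of "- 2 * pi * of_int n * \<i>"] False
      show ?thesis unfolding F_def by simp
    qed
  qed simp
  moreover have "F 1 - F 0 = (if n = 0 then 1 else 0)"
    using cis_multiple_2pi[of "of_int (- n)"] by (simp add: F_def)
  ultimately have *: "has_bochner_integral lborel (\<lambda>t. indicator {0..1} t *\<^sub>R ?f t) (if n = 0 then 1 else 0)"
    by simp
  have ae: "AE t in lborel. indicator {0..1} t *\<^sub>R ?f t = indicator {0..<1} t * ?f t"
    using AE_lborel_singleton[of 1] by eventually_elim (auto simp: indicator_def)
  have "has_bochner_integral lborel (\<lambda>t. indicator {0..<1} t * ?f t) (if n = 0 then 1 else 0)"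
    using * by (subst (asm) has_bochner_integral_cong_AE[OF _ _ ae]) auto
  then show "integrable lborel (\<lambda>t. indicator {0..<1} t * ?f t)"
    "(\<integral>t. indicator {0..<1} t * ?f t \<partial>lborel) = (if n = 0 then 1 else 0)"
    by (auto simp: has_bochner_integral_iff)
qed

lemma integral_character_unit_cube:
  fixes k :: "int^'n::finite"
  shows "integrable lborel (\<lambda>w. indicator unit_cube w * character k w)"
    "(\<integral>w. indicator unit_cube w * character k w \<partial>lborel) = (if k = 0 then 1 else 0)"
proof -
  define n where "n b = \<lfloor>of_int_vec k \<bullet> b\<rfloor>" for b :: "real^'n"
  have n_axis: "n (axis i 1) = k $ i" for i
    by (simp add: n_def inner_axis of_int_vec_def)
  have n: "of_int (n b) = of_int_vec k \<bullet> b" if "b \<in> Basis" for b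
    using that n_axis by (auto simp: Basis_vec_def inner_axis of_int_vec_def)
  let ?h = "\<lambda>b t. indicator {0..<1} t * cis (- 2 * pi * (of_int (n b) * t))"
  have eq: "indicator unit_cube w * character k w = (\<Prod>b\<in>Basis. ?h b (w \<bullet> b))" for w
  proof -
    have "character k w = (\<Prod>b\<in>Basis. cis (- 2 * pi * ((of_int_vec k \<bullet> b) * (w \<bullet> b))))"
      unfolding character_def cis_conv_exp
      by (subst euclidean_inner) (simp add: sum_distrib_left exp_sum mult.commute flip: sum_negf)
    also have "\<dots> = (\<Prod>b\<in>Basis. cis (- 2 * pi * (of_int (n b) * (w \<bullet> b))))"
      by (simp add: n)
    finally show ?thesis
      by (simp only: indicator_unit_cube prod.distrib)
  qed
  show "integrable lborel (\<lambda>w. indicator unit_cube w * character k w)"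
    unfolding eq by (intro integral_prod_Basis(1) integral_cis_unit_interval)
  have "(\<integral>w. indicator unit_cube w * character k w \<partial>lborel) = (\<Prod>b\<in>Basis. if n b = 0 then 1 else 0)"
    unfolding eq by (subst integral_prod_Basis(2)) (simp_all only: integral_cis_unit_interval)
  also have "\<dots> = (if k = 0 then 1 else 0)"
  proof (cases "k = 0")
    case True
    then show ?thesis by (simp add: n_def)
  next
    case False
    then obtain i where "k $ i \<noteq> 0" by (auto simp: vec_eq_iff)
    then have "n (axis i 1) \<noteq> 0" by (simp add: n_axis)
    then have "(\<Prod>b\<in>Basis. if n b = 0 then 1 else 0) = (0 :: complex)"
      by (intro prod_zero bexI[of _ "axis i 1"]) (auto simp: axis_in_Basis_iff)
    then show ?thesis using False by simp
  qed
  finally show "(\<integral>w. indicator unit_cube w * character k w \<partial>lborel) = (if k = 0 then 1 else 0)" .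
qed

definition on_cube :: "(real^'n \<Rightarrow> complex) \<Rightarrow> real^'n \<Rightarrow> complex" where
  "on_cube g w = (if w \<in> unit_cube then g w else 0)"

lemma on_cube_indicator: "on_cube g w = indicator unit_cube w * g w"
  by (simp add: on_cube_def)

lemma on_cube_measurable [measurable]:
  "g \<in> borel_measurable borel \<Longrightarrow> on_cube g \<in> borel_measurable (borel :: (real^'n::finite) measure)"
  unfolding on_cube_indicator[abs_def] by measurable

lemma integrable_cube_const: "integrable lborel (\<lambda>w. C * indicator unit_cube (w :: real^'n::finite) :: real)"
proof -
  have "integrable lborel (\<lambda>w :: real^'n. indicator unit_cube w :: complex)"
    using integral_character_unit_cube(1)[of "0 :: int^'n"] by simp
  then have "integrable lborel (\<lambda>w :: real^'n. norm (indicator unit_cube w :: complex))"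
    by (rule integrable_norm)
  then have "integrable lborel (\<lambda>w :: real^'n. indicator unit_cube w :: real)"
    by (rule Bochner_Integration.integrable_bound) (auto simp: indicator_def)
  then show ?thesis by (rule integrable_mult_right)
qed

lemma integrable_cube_const_sq: "integrable lborel (\<lambda>w. (C * indicator unit_cube (w :: real^'n::finite) :: real)\<^sup>2)"
proof -
  have "(\<lambda>w :: real^'n. (C * indicator unit_cube w)\<^sup>2) = (\<lambda>w. C\<^sup>2 * indicator unit_cube w)"
    by (auto simp: indicator_def)
  then show ?thesis by (simp only: integrable_cube_const)
qed

lemma square_integrable_on_cube:
  fixes g :: "real^'n::finite \<Rightarrow> complex"
  assumes [measurable]: "g \<in> borel_measurable borel"
    and C: "AE w\<in>unit_cube in lborel. norm (g w) \<le> C"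
  shows "square_integrable (on_cube g)"
  by (rule L2_dominated_convergence(2)[where u = "\<lambda>_. on_cube g", OF _ _ integrable_cube_const_sq])
    (use C in \<open>auto simp: on_cube_def elim: eventually_mono\<close>)

definition cube_character :: "int^'n \<Rightarrow> 'n::finite L2" where
  "cube_character k = abs_L2 (on_cube (character k))"

lemma square_integrable_on_cube_trig: "square_integrable (on_cube (\<lambda>w. \<Sum>k\<in>K. a k * character k w))"
proof (rule square_integrable_on_cube)
  show "AE w\<in>unit_cube in lborel. norm (\<Sum>k\<in>K. a k * character k w) \<le> (\<Sum>k\<in>K. norm (a k))"
    by (intro AE_I2 impI order_trans[OF norm_sum]) (simp add: norm_mult)
qed simp

lemma square_integrable_on_cube_character: "square_integrable (on_cube (character k))"
  using square_integrable_on_cube_trig[of "\<lambda>_. 1" "{k}"] by simp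

lemma sum_cube_character:
  "(\<Sum>k\<in>K. cscale (a k) (cube_character k)) = abs_L2 (on_cube (\<lambda>w. \<Sum>k\<in>K. a k * character k w))"
proof (induction K rule: infinite_finite_induct)
  case (insert k K)
  have "cscale (a k) (cube_character k) = abs_L2 (\<lambda>w. a k * on_cube (character k) w)"
    unfolding cube_character_def by (rule cscale_abs[OF square_integrable_on_cube_character])
  then have "(\<Sum>k\<in>insert k K. cscale (a k) (cube_character k))
      = abs_L2 (\<lambda>w. a k * on_cube (character k) w) + abs_L2 (on_cube (\<lambda>w. \<Sum>k\<in>K. a k * character k w))"
    using insert by simp
  also have "\<dots> = abs_L2 (\<lambda>w. a k * on_cube (character k) w + on_cube (\<lambda>w. \<Sum>k\<in>K. a k * character k w) w)"
    by (intro plus_abs square_integrable_cmult square_integrable_on_cube_character square_integrable_on_cube_trig)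
  also have "(\<lambda>w. a k * on_cube (character k) w + on_cube (\<lambda>w. \<Sum>k\<in>K. a k * character k w) w)
      = on_cube (\<lambda>w. \<Sum>k\<in>insert k K. a k * character k w)"
    using insert by (auto simp: on_cube_def)
  finally show ?case .
qed (auto simp: on_cube_def[abs_def] zero_L2.abs_eq)

lemma inner_cube_character:
  "cscale a (cube_character k) \<bullet> cscale b (cube_character l) = (if k = l then Re (a * cnj b) else 0)"
proof -
  have inner: "x \<bullet> y = Re (x * cnj y)" for x y :: complex
    by (simp add: inner_complex_def)
  let ?I = "\<lambda>w. a * cnj b * (indicator unit_cube w * character (k - l) w)"
  have int: "integrable lborel ?I"
    by (intro integrable_mult_right integral_character_unit_cube)
  have "character (k - l) w = character k w * cnj (character l w)" for w
    using character_add[of k "- l" w] by (simp add: character_minus)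
  then have "(a * on_cube (character k) w) \<bullet> (b * on_cube (character l) w) = Re (?I w)" for w
    unfolding inner by (simp add: on_cube_indicator indicator_def mult_ac)
  then have "cscale a (cube_character k) \<bullet> cscale b (cube_character l) = (\<integral>w. Re (?I w) \<partial>lborel)"
    unfolding cube_character_def
    by (simp only: cscale_abs square_integrable_on_cube_character inner_abs square_integrable_cmult)
  also have "\<dots> = Re (a * cnj b * (if k = l then 1 else 0))"
    unfolding integral_Re[OF int] by (simp add: integral_character_unit_cube)
  finally show ?thesis by simp
qed

lemma inner_sum_cube_character:
  assumes "finite K"
  shows "(\<Sum>k\<in>K. cscale (a k) (cube_character k)) \<bullet> (\<Sum>k\<in>K. cscale (b k) (cube_character k))
    = (\<Sum>k\<in>K. Re (a k * cnj (b k)))"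
  using assms by (simp add: inner_sum_left inner_sum_right inner_cube_character)

lemma norm_sum_cube_character:
  assumes "finite K"
  shows "(norm (\<Sum>k\<in>K. cscale (a k) (cube_character k)))\<^sup>2 = (\<Sum>k\<in>K. (norm (a k))\<^sup>2)"
  unfolding power2_norm_eq_inner[of "sum _ _"] inner_sum_cube_character[OF assms]
  by (simp add: complex_mult_cnj cmod_power2)

text \<open>
  By orthonormality the tails of the expansion are as small as the tails of the squared coefficients, so the
  partial sums are Cauchy.
\<close>

lemma l2_seq_summable_cube_character:
  assumes "l2_seq a"
  shows "(\<lambda>k. cscale (a k) (cube_character k)) summable_on UNIV"
proof -
  let ?S = "\<lambda>K. \<Sum>k\<in>K. cscale (a k) (cube_character k)" and ?n = "\<lambda>K. \<Sum>k\<in>K. (norm (a k))\<^sup>2"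
  obtain s where s: "((\<lambda>k. (norm (a k))\<^sup>2) has_sum s) UNIV"
    using assms unfolding l2_seq_def summable_on_def by blast
  have "cauchy_filter (filtermap ?S (finite_subsets_at_top UNIV))"
    unfolding cauchy_filter_metric_filtermap
  proof (intro allI impI)
    fix e :: real assume e: "e > 0"
    have "\<forall>\<^sub>F K in finite_subsets_at_top UNIV. dist (?n K) s < (e/2)\<^sup>2 / 2"
      using s e unfolding has_sum_def by (intro tendstoD) auto
    then obtain K0 where K0: "finite K0" "\<And>K. K0 \<subseteq> K \<Longrightarrow> finite K \<Longrightarrow> dist (?n K) s < (e/2)\<^sup>2 / 2"
      unfolding eventually_finite_subsets_at_top by auto
    have near: "dist (?S K) (?S K0) < e/2" if K: "K0 \<subseteq> K" "finite K" for K
    proof -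
      have "(dist (?S K) (?S K0))\<^sup>2 = (norm (?S (K - K0)))\<^sup>2"
        using sum_diff[OF K(2,1), of "\<lambda>k. cscale (a k) (cube_character k)"] by (simp add: dist_norm)
      also have "\<dots> = ?n (K - K0)"
        using K by (intro norm_sum_cube_character) auto
      also have "\<dots> = ?n K - ?n K0"
        using K by (simp add: sum_diff)
      also have "\<dots> < (e/2)\<^sup>2"
        using K0(2)[OF K] K0(2)[OF order_refl K0(1)]
        unfolding dist_real_def by linarith
      finally show ?thesis
        by (rule power2_less_imp_less) (use e in simp)
    qed
    show "\<exists>P. eventually P (finite_subsets_at_top UNIV) \<and> (\<forall>K K'. P K \<and> P K' \<longrightarrow> dist (?S K) (?S K') < e)"
    proof (intro exI conjI allI impI)
      show "\<forall>\<^sub>F K in finite_subsets_at_top UNIV. K0 \<subseteq> K \<and> finite K"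
        unfolding eventually_finite_subsets_at_top using K0(1) by auto
      fix K K' assume "(K0 \<subseteq> K \<and> finite K) \<and> (K0 \<subseteq> K' \<and> finite K')"
      then show "dist (?S K) (?S K') < e"
        using near[of K] near[of K'] dist_triangle_half_l[of "?S K" "?S K0" e "?S K'"] by (simp add: dist_commute)
    qed
  qed
  then obtain G where "filtermap ?S (finite_subsets_at_top UNIV) \<le> nhds G"
    using cauchy_filter_complete_converges[OF _ complete_UNIV, of "filtermap ?S (finite_subsets_at_top UNIV)"]
    by (auto simp: filtermap_bot_iff)
  then show ?thesis
    unfolding summable_on_def has_sum_def filterlim_def by blast
qed

text \<open>
  The property by which \<open>seq_fourier\<close> is chosen. By \<open>fourier_series_limitI\<close> and
  \<open>fourier_series_limitD\<close> it is summability of the orthonormal expansion in \<open>L2\<close>.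
\<close>

definition fourier_series_limit :: "(int^'n::finite \<Rightarrow> complex) \<Rightarrow> (real^'n \<Rightarrow> complex) \<Rightarrow> bool" where
  "fourier_series_limit a g \<longleftrightarrow> g \<in> borel_measurable lborel \<and>
     ((\<lambda>K. \<integral>\<^sup>+\<omega>\<in>unit_cube. ennreal ((norm
          ((\<Sum>k\<in>K. a k * cis (- 2 * pi * (\<omega> \<bullet> of_int_vec k))) - g \<omega>))\<^sup>2) \<partial>lborel)
        \<longlongrightarrow> 0) (finite_subsets_at_top UNIV)"

lemma nn_integral_cube_eq:
  "(\<integral>\<^sup>+\<omega>\<in>unit_cube. ennreal ((norm ((\<Sum>k\<in>K. a k * cis (- 2 * pi * (\<omega> \<bullet> of_int_vec k))) - g \<omega>))\<^sup>2) \<partial>lborel)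
    = (\<integral>\<^sup>+\<omega>. ennreal ((norm (on_cube (\<lambda>w. \<Sum>k\<in>K. a k * character k w) \<omega> - on_cube g \<omega>))\<^sup>2) \<partial>lborel)"
  by (intro nn_integral_cong) (auto simp: on_cube_def character_def indicator_def)

lemma fourier_series_limitI:
  fixes g :: "real^'n::finite \<Rightarrow> complex"
  assumes g: "g \<in> borel_measurable borel" "square_integrable (on_cube g)"
    and sum: "((\<lambda>k. cscale (a k) (cube_character k)) has_sum abs_L2 (on_cube g)) UNIV"
  shows "fourier_series_limit a g"
proof -
  let ?S = "\<lambda>K. \<Sum>k\<in>K. cscale (a k) (cube_character k)"
  have "(?S \<longlongrightarrow> abs_L2 (on_cube g)) (finite_subsets_at_top UNIV)"
    using sum by (simp add: has_sum_def)
  then have "((\<lambda>K. ennreal ((norm (?S K - abs_L2 (on_cube g)))\<^sup>2)) \<longlongrightarrow> ennreal ((norm (abs_L2 (on_cube g) - abs_L2 (on_cube g)))\<^sup>2)) (finite_subsets_at_top UNIV)"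
    by (intro tendsto_intros)
  moreover have "ennreal ((norm (?S K - abs_L2 (on_cube g)))\<^sup>2) =
      (\<integral>\<^sup>+\<omega>\<in>unit_cube. ennreal ((norm ((\<Sum>k\<in>K. a k * cis (- 2 * pi * (\<omega> \<bullet> of_int_vec k))) - g \<omega>))\<^sup>2) \<partial>lborel)" for K
    unfolding nn_integral_cube_eq sum_cube_character diff_abs[OF square_integrable_on_cube_trig g(2)]
    by (intro nn_integral_norm_sq[symmetric] square_integrable_diff square_integrable_on_cube_trig g)
  ultimately show ?thesis
    using g by (simp add: fourier_series_limit_def)
qed

lemma fourier_series_limitD:
  fixes g :: "real^'n::finite \<Rightarrow> complex"
  assumes "fourier_series_limit a g"
  shows "g \<in> borel_measurable borel" "square_integrable (on_cube g)"
    "((\<lambda>k. cscale (a k) (cube_character k)) has_sum abs_L2 (on_cube g)) UNIV"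
proof -
  let ?S = "\<lambda>K. \<Sum>k\<in>K. cscale (a k) (cube_character k)"
  let ?T = "\<lambda>K. on_cube (\<lambda>w. \<Sum>k\<in>K. a k * character k w)"
  show g [measurable]: "g \<in> borel_measurable borel"
    using assms by (simp add: fourier_series_limit_def)
  have [measurable]: "?T K \<in> borel_measurable borel" for K
    using square_integrable_on_cube_trig[where K = K and a = a] by (simp add: square_integrable_def)
  have lim: "((\<lambda>K. \<integral>\<^sup>+\<omega>. ennreal ((norm (?T K \<omega> - on_cube g \<omega>))\<^sup>2) \<partial>lborel) \<longlongrightarrow> 0) (finite_subsets_at_top UNIV)"
    using assms by (simp only: fourier_series_limit_def nn_integral_cube_eq)
  have "\<forall>\<^sub>F K in finite_subsets_at_top UNIV. (\<integral>\<^sup>+\<omega>. ennreal ((norm (?T K \<omega> - on_cube g \<omega>))\<^sup>2) \<partial>lborel) < 1"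
    using lim by (rule order_tendstoD) simp
  then obtain K where K: "(\<integral>\<^sup>+\<omega>. ennreal ((norm (?T K \<omega> - on_cube g \<omega>))\<^sup>2) \<partial>lborel) < 1"
    unfolding eventually_finite_subsets_at_top by blast
  then have "(\<integral>\<^sup>+\<omega>. ennreal ((norm (?T K \<omega> - on_cube g \<omega>))\<^sup>2) \<partial>lborel) < \<infinity>"
    by (rule less_trans) simp
  then have "square_integrable (\<lambda>w. ?T K w - on_cube g w)"
    by (intro square_integrableI_nn) auto
  from square_integrable_diff[OF square_integrable_on_cube_trig[where a = a and K = K] this]
   show sq: "square_integrable (on_cube g)" by simp
  have "ennreal ((norm (?S K - abs_L2 (on_cube g)))\<^sup>2) = (\<integral>\<^sup>+\<omega>. ennreal ((norm (?T K \<omega> - on_cube g \<omega>))\<^sup>2) \<partial>lborel)" for K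
    unfolding sum_cube_character diff_abs[OF square_integrable_on_cube_trig sq]
    by (intro nn_integral_norm_sq[symmetric] square_integrable_diff square_integrable_on_cube_trig sq)
  then have "((\<lambda>K. ennreal ((norm (?S K - abs_L2 (on_cube g)))\<^sup>2)) \<longlongrightarrow> ennreal 0) (finite_subsets_at_top UNIV)"
    using lim by simp
  then have "((\<lambda>K. (norm (?S K - abs_L2 (on_cube g)))\<^sup>2) \<longlongrightarrow> 0) (finite_subsets_at_top UNIV)"
    by (subst (asm) tendsto_ennreal_iff) auto
  then have "((\<lambda>K. sqrt ((norm (?S K - abs_L2 (on_cube g)))\<^sup>2)) \<longlongrightarrow> sqrt 0) (finite_subsets_at_top UNIV)"
    by (rule tendsto_real_sqrt)
  then have "((\<lambda>K. norm (?S K - abs_L2 (on_cube g))) \<longlongrightarrow> 0) (finite_subsets_at_top UNIV)"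
    by simp
  then have "(?S \<longlongrightarrow> abs_L2 (on_cube g)) (finite_subsets_at_top UNIV)"
    by (simp add: LIM_zero_iff tendsto_norm_zero_iff)
  then show "((\<lambda>k. cscale (a k) (cube_character k)) has_sum abs_L2 (on_cube g)) UNIV"
    by (simp add: has_sum_def)
qed

lemma fourier_series_limit_unique:
  assumes "fourier_series_limit a g" "fourier_series_limit a h"
  shows "AE w\<in>unit_cube in lborel. g w = h w"
proof -
  note g = fourier_series_limitD[OF assms(1)] and h = fourier_series_limitD[OF assms(2)]
  have "abs_L2 (on_cube g) = abs_L2 (on_cube h)"
    using g(3) h(3) by (rule has_sum_unique)
  then have "AE w in lborel. on_cube g w = on_cube h w"
    using abs_L2_eq_iff[OF g(2) h(2)] by simp
  then show ?thesis
    by eventually_elim (auto simp: on_cube_def)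
qed

text \<open>
  The sum of the expansion exists in \<open>L2\<close>. Restriction to the cube fixes every term, hence
  also the sum.
\<close>

lemma fourier_series_limit_exists:
  fixes a :: "int^'n::finite \<Rightarrow> complex"
  assumes "l2_seq a"
  shows "\<exists>g. fourier_series_limit a g"
proof -
  obtain G where G: "((\<lambda>k. cscale (a k) (cube_character k)) has_sum G) UNIV"
    using l2_seq_summable_cube_character[OF assms] unfolding summable_on_def by blast
  have ind: "ess_bounded_by 1 (indicator unit_cube :: real^'n \<Rightarrow> complex)"
    by (simp add: ess_bounded_by_def indicator_def)
  note bl = bounded_linear_mult_op[OF ind]
  have proj: "mult_op (indicator unit_cube) (cscale c (cube_character k)) = cscale c (cube_character k)" for c and k :: "int^'n"
  proof -
    have "(\<lambda>w. indicator unit_cube w * on_cube (character k) w) = on_cube (character k)"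
      by (auto simp: on_cube_def)
    then show ?thesis
      by (simp only: mult_op_cscale[OF ind] cube_character_def mult_op_abs[OF ind square_integrable_on_cube_character])
  qed
  have "((\<lambda>k. mult_op (indicator unit_cube) (cscale (a k) (cube_character k))) has_sum mult_op (indicator unit_cube) G) UNIV"
    using has_sum_bounded_linear[OF bl G] by (simp add: o_def)
  moreover have "mult_op (indicator unit_cube) G = abs_L2 (on_cube (rep_L2 G))"
    unfolding mult_op_def by (simp add: on_cube_indicator[abs_def])
  moreover have "square_integrable (on_cube (rep_L2 G))"
    unfolding on_cube_indicator[abs_def] by (rule square_integrable_mult[OF ind square_integrable_rep])
  ultimately have "fourier_series_limit a (rep_L2 G)"
    unfolding proj by (intro fourier_series_limitI) auto
  then show ?thesis by blast
qed

lemma seq_fourier_limit: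
  assumes "l2_seq a"
  shows "fourier_series_limit a (seq_fourier a)"
proof -
  have "seq_fourier a = (SOME g. fourier_series_limit a g)"
    unfolding seq_fourier_def fourier_series_limit_def ..
  then show ?thesis
    using someI_ex[OF fourier_series_limit_exists[OF assms]] by simp
qed

lemma seq_fourier_measurable: "l2_seq a \<Longrightarrow> seq_fourier a \<in> borel_measurable borel"
  using fourier_series_limitD(1)[OF seq_fourier_limit] .

lemma trig_poly_dense_on_cube:
  fixes g :: "real^'n::finite \<Rightarrow> complex"
  assumes g: "g \<in> borel_measurable borel" "\<And>x. norm (g x) \<le> C" and e: "e > 0"
  obtains K c where "finite K" "dist (\<Sum>k\<in>K. cscale (c k) (cube_character k)) (abs_L2 (on_cube g)) < e"
proof -
  obtain p where p: "\<And>n. trig_poly (p n)" "\<And>n x. norm (p n x) \<le> C + 1"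
    "AE x in lborel. (\<lambda>n. p n x) \<longlonglongrightarrow> g (frac_vec x)"
    by (rule bounded_measurable_AE_limit_trig_poly[OF g]) (rule that)
  note [measurable] = g(1) trig_poly_measurable[OF p(1)]
  have "(\<lambda>n. abs_L2 (on_cube (p n))) \<longlonglongrightarrow> abs_L2 (on_cube g)"
  proof (rule L2_dominated_convergence(3)[OF _ _ integrable_cube_const_sq[of "C + 1"]])
    show "AE x in lborel. norm (on_cube (p n) x) \<le> (C + 1) * indicator unit_cube x" for n
      using p(2) by (intro AE_I2) (auto simp: on_cube_def)
    show "AE x in lborel. (\<lambda>n. on_cube (p n) x) \<longlonglongrightarrow> on_cube g x"
      using p(3) by eventually_elim (auto simp: on_cube_def frac_vec_cube)
  qed auto
  then have "\<forall>\<^sub>F n in sequentially. dist (abs_L2 (on_cube (p n))) (abs_L2 (on_cube g)) < e"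
    using e by (rule tendstoD)
  then obtain n where n: "dist (abs_L2 (on_cube (p n))) (abs_L2 (on_cube g)) < e"
    by (auto simp: eventually_sequentially)
  obtain K c where K: "finite K" "p n = (\<lambda>w. \<Sum>k\<in>K. c k * character k w)"
    using p(1)[of n] unfolding trig_poly_def by blast
  show ?thesis
    using that[OF K(1), of c] n unfolding sum_cube_character K(2) by blast
qed

text \<open>
  The inner product of \<open>L2\<close> is the real part of the Hermitian one, so that the imaginary part of a Fourier
  coefficient is the inner product with \<open>\<i>\<close> times the character.
\<close>

definition cube_coeff :: "'n::finite L2 \<Rightarrow> int^'n \<Rightarrow> complex" where
  "cube_coeff G k = Complex (G \<bullet> cube_character k) (G \<bullet> cscale \<i> (cube_character k))"

lemma inner_cube_coeff: "G \<bullet> cscale c (cube_character k) = Re (cube_coeff G k * cnj c)"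
proof -
  have "cscale c (cube_character k) = Re c *\<^sub>R cube_character k + Im c *\<^sub>R cscale \<i> (cube_character k)"
    by (simp add: scaleR_cscale mult.commute flip: L2.scale_left_distrib complex_eq)
  then show ?thesis
    by (simp add: cube_coeff_def inner_add_right)
qed

lemma inner_sum_cube_coeff:
  assumes "finite K"
  shows "G \<bullet> (\<Sum>k\<in>K. cscale (c k) (cube_character k))
    = (\<Sum>k\<in>K. cscale (cube_coeff G k) (cube_character k)) \<bullet> (\<Sum>k\<in>K. cscale (c k) (cube_character k))"
  by (simp only: inner_sum_cube_character[OF assms]) (simp add: inner_sum_right inner_cube_coeff)

lemma cube_coeff_best_approximation:
  assumes K: "finite K"
  shows "norm (G - (\<Sum>k\<in>K. cscale (cube_coeff G k) (cube_character k))) \<le> norm (G - (\<Sum>k\<in>K. cscale (c k) (cube_character k)))"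
proof -
  define B where "B = (\<Sum>k\<in>K. cscale (cube_coeff G k) (cube_character k))"
  define S where "S = (\<Sum>k\<in>K. cscale (c k) (cube_character k))"
  have "G \<bullet> B = B \<bullet> B" "G \<bullet> S = B \<bullet> S"
    unfolding B_def S_def by (rule inner_sum_cube_coeff[OF K])+
  then have "(norm (G - S))\<^sup>2 = (norm (G - B))\<^sup>2 + (norm (B - S))\<^sup>2"
    by (simp add: power2_norm_eq_inner inner_diff_left inner_diff_right inner_commute)
  then have "(norm (G - B))\<^sup>2 \<le> (norm (G - S))\<^sup>2"
    by simp
  then have "norm (G - B) \<le> norm (G - S)"
    by (rule power2_le_imp_le) simp
  then show ?thesis
    unfolding B_def S_def .
qed

lemma l2_seq_cube_coeff: "l2_seq (cube_coeff G)"
proof -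
  have "(\<Sum>k\<in>K. (norm (cube_coeff G k))\<^sup>2) \<le> (norm G)\<^sup>2" if K: "finite K" for K
  proof -
    define B where "B = (\<Sum>k\<in>K. cscale (cube_coeff G k) (cube_character k))"
    have "G \<bullet> B = B \<bullet> B"
      unfolding B_def by (rule inner_sum_cube_coeff[OF K])
    then have "(norm B)\<^sup>2 \<le> norm G * norm B"
      using norm_cauchy_schwarz[of G B] by (simp add: power2_norm_eq_inner)
    then have "norm B \<le> norm G"
      by (cases "norm B = 0") (auto simp: power2_eq_square)
    then have "(norm B)\<^sup>2 \<le> (norm G)\<^sup>2"
      by (intro power_mono) auto
    then show ?thesis
      unfolding B_def norm_sum_cube_character[OF K] .
  qed
  then show ?thesis
    unfolding l2_seq_def by (intro nonneg_bdd_above_summable_on bdd_aboveI2[where M = "(norm G)\<^sup>2"]) auto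
qed

text \<open>
  Some finite trigonometric sum is close to \<open>g\<close> in the mean, and every partial sum of the
  Fourier series over a larger index set is at least as close, being the best approximation.
\<close>

lemma bounded_function_is_seq_fourier:
  fixes g :: "real^'n::finite \<Rightarrow> complex"
  assumes g: "g \<in> borel_measurable borel" "\<And>x. norm (g x) \<le> C"
  obtains b where "bounded_spectrum b" "AE w\<in>unit_cube in lborel. seq_fourier b w = g w"
proof -
  define G where "G = abs_L2 (on_cube g)"
  let ?b = "cube_coeff G"
  let ?S = "\<lambda>b K. \<Sum>k\<in>K. cscale (b k) (cube_character k)"
  have sq: "square_integrable (on_cube g)"
    using g by (intro square_integrable_on_cube) auto
  have "(?S ?b \<longlongrightarrow> G) (finite_subsets_at_top UNIV)"
  proof (rule tendstoI)
    fix e :: real assume "e > 0"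
    then obtain J c where J: "finite J" "dist (?S c J) G < e"
      using trig_poly_dense_on_cube[OF g] unfolding G_def by metis
    have "dist (?S ?b K) G < e" if K: "finite K" "J \<subseteq> K" for K
    proof -
      have "?S c J = ?S (\<lambda>k. if k \<in> J then c k else 0) K"
        using K by (intro sum.mono_neutral_cong_left) auto
      then show ?thesis
        using cube_coeff_best_approximation[OF K(1), of G "\<lambda>k. if k \<in> J then c k else 0"] J(2)
        by (simp add: dist_norm norm_minus_commute)
    qed
    then show "\<forall>\<^sub>F K in finite_subsets_at_top UNIV. dist (?S ?b K) G < e"
      unfolding eventually_finite_subsets_at_top using J(1) by blast
  qed
  then have "fourier_series_limit ?b g"
    using g sq by (intro fourier_series_limitI) (auto simp: has_sum_def G_def)
  then have ae: "AE w\<in>unit_cube in lborel. seq_fourier ?b w = g w"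
    using seq_fourier_limit[OF l2_seq_cube_coeff] by (rule fourier_series_limit_unique[rotated])
  then have "AE w\<in>unit_cube in lborel. norm (seq_fourier ?b w) \<le> C"
    using g(2) by (auto elim: eventually_mono)
  then have "bounded_spectrum ?b"
    unfolding bounded_spectrum_def ess_bounded_def using l2_seq_cube_coeff by blast
  then show ?thesis using that ae by blast
qed

section \<open>The operators of bounded spectrum as Fourier multipliers\<close>

text \<open>
  As \<open>seq_fourier\<close> is determined on the cube only, its periodic extension is taken.
\<close>

definition symbol :: "(int^'n \<Rightarrow> complex) \<Rightarrow> real^'n \<Rightarrow> complex" where
  "symbol a x = seq_fourier a (frac_vec x)"

definition periodic :: "(real^'n \<Rightarrow> complex) \<Rightarrow> bool" where
  "periodic m \<longleftrightarrow> (\<forall>x. m (frac_vec x) = m x)"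

lemma periodic_symbol: "periodic (symbol a)"
  by (simp add: periodic_def symbol_def frac_vec_cube frac_vec_in_cube)

lemma ess_bounded_by_symbol:
  assumes "bounded_spectrum a"
  obtains C where "C \<ge> 0" "ess_bounded_by C (symbol a)"
proof -
  obtain C where "AE w\<in>unit_cube in lborel. norm (seq_fourier a w) \<le> C"
    using assms by (auto simp: bounded_spectrum_def ess_bounded_def)
  then have "AE x in lborel. norm (symbol a x) \<le> C"
    unfolding symbol_def by (subst AE_frac_vec_iff)
  then have "AE x in lborel. norm (symbol a x) \<le> max C 0"
    by eventually_elim auto
  moreover have "symbol a \<in> borel_measurable borel"
    unfolding symbol_def[abs_def] using assms
    by (intro measurable_compose[OF frac_vec_measurable] seq_fourier_measurable)
      (simp add: bounded_spectrum_def)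
  ultimately show ?thesis
    using that[of "max C 0"] by (simp add: ess_bounded_by_def)
qed

lemma AE_fiber_mult_iff:
  "(AE w\<in>unit_cube in lborel. (\<forall>k. fiber h w k = seq_fourier a w * fiber f w k))
    \<longleftrightarrow> (AE x in lborel. rep_L2 (fourier h) x = symbol a x * rep_L2 (fourier f) x)"
  unfolding fiber_def symbol_def
  by (rule AE_unit_cube_iff[of "\<lambda>w x. rep_L2 (fourier h) x = seq_fourier a w * rep_L2 (fourier f) x"])

lemma AE_fiber_nonzero_iff:
  "(AE w\<in>unit_cube in lborel. fiber f w \<noteq> (\<lambda>_. 0) \<longrightarrow> Q w)
    \<longleftrightarrow> (AE x in lborel. rep_L2 (fourier f) x \<noteq> 0 \<longrightarrow> Q (frac_vec x))"
proof -
  have "(fiber f w \<noteq> (\<lambda>_. 0) \<longrightarrow> Q w) \<longleftrightarrow> (\<forall>k. rep_L2 (fourier f) (w + of_int_vec k) \<noteq> 0 \<longrightarrow> Q w)" for w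
    by (auto simp: fun_eq_iff fiber_def)
  then show ?thesis
    using AE_unit_cube_iff[of "\<lambda>w x. rep_L2 (fourier f) x \<noteq> 0 \<longrightarrow> Q w"] by simp
qed

text \<open>
  The fibers of \<open>f\<close> over the cube are the values of the Fourier transform on all translates of the cube, so
  multiplying the fibers by \<open>seq_fourier a\<close> is multiplying the transform by the periodic extension. The
  result is again a Fourier transform by surjectivity.
\<close>

lemma Lambda_eq_fourier_multiplier:
  assumes "bounded_spectrum a"
  shows "Lambda a f = fourier_multiplier (symbol a) f"
proof -
  obtain C where C: "ess_bounded_by C (symbol a)"
    using ess_bounded_by_symbol[OF assms] by blast
  have "(AE x in lborel. rep_L2 (fourier h) x = symbol a x * rep_L2 (fourier f) x)
      \<longleftrightarrow> h = fourier_multiplier (symbol a) f" for h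
  proof -
    have "(AE x in lborel. rep_L2 (fourier h) x = symbol a x * rep_L2 (fourier f) x)
        \<longleftrightarrow> abs_L2 (rep_L2 (fourier h)) = mult_op (symbol a) (fourier f)"
      unfolding mult_op_def
      by (rule abs_L2_eq_iff[symmetric]) (intro square_integrable_rep square_integrable_mult[OF C])+
    also have "\<dots> \<longleftrightarrow> fourier h = fourier (fourier_multiplier (symbol a) f)"
      by (simp add: fourier_multiplier)
    finally show ?thesis by (simp only: fourier_eq_iff)
  qed
  then show ?thesis
    unfolding Lambda_def AE_fiber_mult_iff by simp
qed

lemma fourier_multiplier_cong_AE:
  assumes "ess_bounded_by C m" "ess_bounded_by C' m'"
    and "AE x in lborel. rep_L2 (fourier f) x \<noteq> 0 \<longrightarrow> m x = m' x"
  shows "fourier_multiplier m f = fourier_multiplier m' f"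
  unfolding fourier_multiplier_def using mult_op_cong_AE[OF assms] by simp

lemma fourier_multiplier_one: "fourier_multiplier (\<lambda>_. 1) f = f"
  by (simp add: fourier_multiplier_def mult_op_def)

lemma fourier_multiplier_id_AE:
  assumes "ess_bounded_by C m" "AE x in lborel. rep_L2 (fourier f) x \<noteq> 0 \<longrightarrow> m x = 1"
  shows "fourier_multiplier m f = f"
proof -
  have "ess_bounded_by 1 (\<lambda>_ :: real^'a. 1)"
    by (simp add: ess_bounded_by_def)
  then show ?thesis
    using fourier_multiplier_cong_AE[OF assms(1) _ assms(2)] fourier_multiplier_one by metis
qed

lemma fourier_zero [simp]: "fourier 0 = 0"
  using norm_fourier[of 0] by simp

lemma fourier_multiplier_eq_0_iff:
  assumes m: "ess_bounded_by C m"
  shows "fourier_multiplier m f = 0 \<longleftrightarrow> (AE x in lborel. rep_L2 (fourier f) x \<noteq> 0 \<longrightarrow> m x = 0)"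
proof -
  have "fourier_multiplier m f = 0 \<longleftrightarrow> mult_op m (fourier f) = abs_L2 (\<lambda>_. 0)"
    by (metis fourier_fourier_inv fourier_inv_fourier fourier_multiplier_def fourier_zero zero_L2.abs_eq)
  also have "\<dots> \<longleftrightarrow> (AE x in lborel. m x * rep_L2 (fourier f) x = 0)"
    unfolding mult_op_def
    by (rule abs_L2_eq_iff) (intro square_integrable_mult[OF m] square_integrable_rep square_integrable_zero)+
  also have "\<dots> \<longleftrightarrow> (AE x in lborel. rep_L2 (fourier f) x \<noteq> 0 \<longrightarrow> m x = 0)"
    by (intro AE_cong) auto
  finally show ?thesis .
qed

section \<open>Shift preserving operators commute with periodic multipliers\<close>

lemma fourier_multiplier_trig_sum:
  "fourier_multiplier (\<lambda>w. \<Sum>k\<in>K. a k * character k w) f = (\<Sum>k\<in>K. cscale (a k) (shift k f))"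
proof (induction K rule: infinite_finite_induct)
  case (insert k K)
  let ?s = "\<lambda>w. \<Sum>k\<in>K. a k * character k w" and ?F = "fourier f"
  have bound: "ess_bounded_by (\<Sum>k\<in>J. norm (a k)) (\<lambda>w. \<Sum>k\<in>J. a k * character k w)" for J
    unfolding ess_bounded_by_def
    by (intro conjI AE_I2 order_trans[OF norm_sum]) (auto simp: norm_mult)
  note sq = square_integrable_mult[OF _ square_integrable_rep[of ?F]]
  have "mult_op (\<lambda>w. \<Sum>k\<in>insert k K. a k * character k w) ?F
      = abs_L2 (\<lambda>w. a k * (character k w * rep_L2 ?F w) + ?s w * rep_L2 ?F w)"
    using insert by (simp add: mult_op_def distrib_right mult.assoc)
  also have "\<dots> = cscale (a k) (mult_op (character k) ?F) + mult_op ?s ?F"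
    unfolding mult_op_def
    by (simp add: plus_abs cscale_abs sq[OF ess_bounded_by_character] sq[OF bound] square_integrable_cmult)
  finally show ?case
    using insert
    by (simp add: fourier_multiplier_def[abs_def] fourier_inv_add fourier_inv_cscale shift_eq_fourier_multiplier)
qed (auto simp: fourier_multiplier_eq_0_iff[of 0] ess_bounded_by_def)

locale shift_preserving_operator =
  fixes V :: "'n::finite L2 set" and L :: "'n L2 \<Rightarrow> 'n L2"
  assumes V: "shift_invariant V" and L: "shift_preserving V L"
begin

lemma subspace_V: "L2.subspace V" and closed_V: "closed V"
  and shift_V: "f \<in> V \<Longrightarrow> shift k f \<in> V"
  using V by (auto simp: shift_invariant_def)

lemma zero_V: "0 \<in> V" and add_V: "f \<in> V \<Longrightarrow> g \<in> V \<Longrightarrow> f + g \<in> V"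
  and cscale_V: "f \<in> V \<Longrightarrow> cscale c f \<in> V"
  using L2.subspace_0[OF subspace_V] L2.subspace_add[OF subspace_V] L2.subspace_scale[OF subspace_V]
    by auto

lemma sum_V: "(\<And>i. i \<in> I \<Longrightarrow> u i \<in> V) \<Longrightarrow> sum u I \<in> V"
  by (rule L2.subspace_sum[OF subspace_V])

lemma diff_V: "f \<in> V \<Longrightarrow> g \<in> V \<Longrightarrow> f - g \<in> V"
  by (rule L2.subspace_diff[OF subspace_V])

lemma L_V: "f \<in> V \<Longrightarrow> L f \<in> V"
  and L_add: "f \<in> V \<Longrightarrow> g \<in> V \<Longrightarrow> L (f + g) = L f + L g"
  and L_cscale: "f \<in> V \<Longrightarrow> L (cscale c f) = cscale c (L f)"
  and L_shift: "f \<in> V \<Longrightarrow> L (shift k f) = shift k (L f)"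
  using L by (auto simp: shift_preserving_def)

lemma L_0: "L 0 = 0"
  using L_cscale[OF zero_V, of 0] by simp

lemma L_diff: "f \<in> V \<Longrightarrow> g \<in> V \<Longrightarrow> L (f - g) = L f - L g"
  unfolding diff_cscale by (simp only: L_add L_cscale cscale_V)

lemma L_sum: "(\<And>i. i \<in> I \<Longrightarrow> u i \<in> V) \<Longrightarrow> L (sum u I) = (\<Sum>i\<in>I. L (u i))"
  by (induction I rule: infinite_finite_induct) (auto simp: L_0 L_add sum_V)

lemma L_tendsto:
  assumes u: "\<And>n. u n \<in> V" and f: "f \<in> V" and lim: "u \<longlonglongrightarrow> f"
  shows "(\<lambda>n. L (u n)) \<longlonglongrightarrow> L f"
proof -
  obtain C where C: "\<And>f. f \<in> V \<Longrightarrow> norm (L f) \<le> C * norm f"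
    using L unfolding shift_preserving_def by blast
  have "(\<lambda>n. L (u n) - L f) \<longlonglongrightarrow> 0"
  proof (rule Lim_null_comparison)
    show "\<forall>\<^sub>F n in sequentially. norm (L (u n) - L f) \<le> C * norm (u n - f)"
      using C[OF diff_V[OF u f]] by (simp add: L_diff u f)
    have "(\<lambda>n. C * norm (u n - f)) \<longlonglongrightarrow> C * norm (f - f)"
      by (intro tendsto_intros lim)
    then show "(\<lambda>n. C * norm (u n - f)) \<longlonglongrightarrow> 0" by simp
  qed
  then show ?thesis by (rule LIM_zero_cancel)
qed

text \<open>
  Multipliers with a trigonometric polynomial as symbol are linear combinations of shifts; every bounded
  periodic symbol is a bounded limit of such, which passes to the operators by dominated convergence.
\<close>

lemma fourier_multiplier_commutes:
  assumes m: "ess_bounded_by C m" and C: "C \<ge> 0" and per: "periodic m" and f: "f \<in> V"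
  shows "fourier_multiplier m f \<in> V" "L (fourier_multiplier m f) = fourier_multiplier m (L f)"
proof -
  note [measurable] = ess_bounded_byD(1)[OF m]
  \<comment> \<open>The symbol is bounded almost everywhere only, but the approximation needs a bound everywhere.\<close>
  define g where "g x = (if norm (m x) \<le> C then m x else 0)" for x
  have g: "g \<in> borel_measurable borel" "\<And>x. norm (g x) \<le> C"
    using C unfolding g_def[abs_def] by auto
  obtain p where p: "\<And>n. trig_poly (p n)" "\<And>n x. norm (p n x) \<le> C + 1"
    and lim: "AE x in lborel. (\<lambda>n. p n x) \<longlonglongrightarrow> g (frac_vec x)"
    by (rule bounded_measurable_AE_limit_trig_poly[OF g]) (rule that)
  have lim: "AE x in lborel. (\<lambda>n. p n x) \<longlonglongrightarrow> m x"
    using lim ess_bounded_byD(2)[OF m]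
    by eventually_elim (use per in \<open>simp add: g_def periodic_def\<close>)
  have bound: "ess_bounded_by (C + 1) (p n)" for n
    using p(2) trig_poly_measurable[OF p(1)] by (simp add: ess_bounded_by_def)
  have conv: "(\<lambda>n. fourier_multiplier (p n) h) \<longlonglongrightarrow> fourier_multiplier m h" for h
    by (rule fourier_multiplier_tendsto[OF bound _ lim]) simp
  have poly: "fourier_multiplier (p n) f \<in> V \<and> L (fourier_multiplier (p n) f) = fourier_multiplier (p n) (L f)" for n
  proof -
    obtain K a where "p n = (\<lambda>w. \<Sum>k\<in>K. a k * character k w)"
      using p(1)[of n] unfolding trig_poly_def by blast
    moreover have "L (\<Sum>k\<in>K. cscale (a k) (shift k f)) = (\<Sum>k\<in>K. cscale (a k) (shift k (L f)))"
      using f by (subst L_sum) (auto simp: L_cscale L_shift cscale_V shift_V)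
    ultimately show ?thesis
      using f by (auto simp: fourier_multiplier_trig_sum intro!: sum_V cscale_V shift_V)
  qed
  show V: "fourier_multiplier m f \<in> V"
    by (rule closed_sequentially[OF closed_V _ conv]) (use poly in blast)
  have "(\<lambda>n. L (fourier_multiplier (p n) f)) \<longlonglongrightarrow> L (fourier_multiplier m f)"
    by (rule L_tendsto[OF _ V conv]) (use poly in blast)
  then have "(\<lambda>n. fourier_multiplier (p n) (L f)) \<longlonglongrightarrow> L (fourier_multiplier m f)"
    using poly by simp
  then show "L (fourier_multiplier m f) = fourier_multiplier m (L f)"
    using conv LIMSEQ_unique by blast
qed

lemma eigenspace_iff:
  assumes "bounded_spectrum a"
  shows "f \<in> s_eigenspace V L a \<longleftrightarrow> f \<in> V \<and> L f = fourier_multiplier (symbol a) f"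
  unfolding s_eigenspace_def by (simp add: Lambda_eq_fourier_multiplier[OF assms])

end

section \<open>Spectral lower bound and inversion of the symbol\<close>

definition level_cutoff :: "(real \<Rightarrow> bool) \<Rightarrow> (real^'n \<Rightarrow> complex) \<Rightarrow> real^'n \<Rightarrow> complex" where
  "level_cutoff Q m x = (if Q (norm (m x)) then 1 else 0)"

lemma ess_bounded_by_level_cutoff:
  assumes [measurable]: "m \<in> borel_measurable borel" "Measurable.pred borel Q"
  shows "ess_bounded_by 1 (level_cutoff Q m)"
  unfolding ess_bounded_by_def level_cutoff_def[abs_def] by auto

lemma periodic_level_cutoff: "periodic m \<Longrightarrow> periodic (level_cutoff Q m)"
  by (simp add: periodic_def level_cutoff_def)

instance L2 :: (finite) banach ..

locale invertible_shift_preserving_operator = shift_preserving_operator +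
  assumes bij: "bij_betw L V V"
begin

lemma L_inj: "f \<in> V \<Longrightarrow> g \<in> V \<Longrightarrow> L f = L g \<Longrightarrow> f = g"
  using bij by (auto simp: bij_betw_def inj_on_def)

lemma L_surj: "g \<in> V \<Longrightarrow> \<exists>f\<in>V. L f = g"
  using bij unfolding bij_betw_def by (metis image_iff)

lemma inv_V: "f \<in> V \<Longrightarrow> inv_into V L f \<in> V" and L_inv: "f \<in> V \<Longrightarrow> L (inv_into V L f) = f"
  using bij by (auto simp: bij_betw_def intro: inv_into_into f_inv_into_f)

lemma inv_eq_iff: "f \<in> V \<Longrightarrow> g \<in> V \<Longrightarrow> inv_into V L f = g \<longleftrightarrow> L g = f"
  using L_inv inv_V L_inj by metis

text \<open>
  A gliding hump argument: on the dyadic shell where the symbol has absolute value about \<open>2\<^sup>-\<^sup>j\<close>,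
  \<open>L\<close> shrinks the eigenspace by that factor. If infinitely many shells met the eigenspace, vectors \<open>u j\<close> of
  norm \<open>j\<close> from these shells would have images whose sum converges; the preimage of that
  sum would have the component \<open>u j\<close> on each of these shells, hence norm at least \<open>j\<close> for arbitrarily large \<open>j\<close>.
\<close>

lemma symbol_bounded_below_on_eigenspace:
  assumes a: "bounded_spectrum a"
  obtains c where "c > 0"
    "\<And>f. f \<in> s_eigenspace V L a \<Longrightarrow> AE x in lborel. rep_L2 (fourier f) x \<noteq> 0 \<longrightarrow> c \<le> norm (symbol a x)"
proof -
  let ?m = "symbol a" and ?W = "s_eigenspace V L a"
  obtain C where C: "C \<ge> 0" and m: "ess_bounded_by C ?m"
    using ess_bounded_by_symbol[OF a] .
  note [measurable] = ess_bounded_byD(1)[OF m]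
  define shell where "shell j t \<longleftrightarrow> (1/2)^(Suc j) \<le> t \<and> t < (1/2 :: real)^j" for j t
  have [measurable]: "Measurable.pred borel (shell j)" for j
    unfolding shell_def[abs_def] by measurable
  define P where "P j = fourier_multiplier (level_cutoff (shell j) ?m)" for j
  have cut: "ess_bounded_by 1 (level_cutoff (shell j) ?m)" "periodic (level_cutoff (shell j) ?m)" for j
    by (auto intro: ess_bounded_by_level_cutoff periodic_level_cutoff periodic_symbol)
  note P_comm = fourier_multiplier_commutes[OF cut(1) _ cut(2), folded P_def, simplified]
  have shell_unique: "i = j" if "shell i t" "shell j t" for i j t
  proof (rule ccontr)
    assume "i \<noteq> j"
    moreover have False if "shell i t" "shell j t" "i < j" for i j
    proof -
      have "(1/2::real)^j \<le> (1/2)^(Suc i)"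
        using \<open>i < j\<close> by (intro power_decreasing) auto
      then show False using that by (simp add: shell_def)
    qed
    ultimately show False using that by (metis nat_neq_iff)
  qed
  have PP: "P i (P j f) = (if i = j then P j f else 0)" for i j f
  proof -
    have "P i (P j f) = fourier_multiplier (\<lambda>x. level_cutoff (shell i) ?m x * level_cutoff (shell j) ?m x) f"
      unfolding P_def by (rule fourier_multiplier_mult[OF cut(1) cut(1)])
    also have "\<dots> = (if i = j then P j f else 0)"
    proof (cases "i = j")
      case True
      have "(\<lambda>x. level_cutoff (shell j) ?m x * level_cutoff (shell j) ?m x) = level_cutoff (shell j) ?m"
        by (auto simp: level_cutoff_def)
      then show ?thesis using True by (simp add: P_def)
    next
      case False
      have "level_cutoff (shell i) ?m x * level_cutoff (shell j) ?m x = 0" for x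
        using False shell_unique[of i "norm (?m x)" j] by (auto simp: level_cutoff_def)
      then have "(\<lambda>x. level_cutoff (shell i) ?m x * level_cutoff (shell j) ?m x) = (\<lambda>x. 0)"
        by (rule ext)
      then show ?thesis
        using False fourier_multiplier_eq_0_iff[of 0 "\<lambda>_. 0" f] by (simp add: ess_bounded_by_def)
    qed
    finally show ?thesis .
  qed
  have small: "L (P j f) = P j (L f) \<and> norm (L (P j f)) \<le> (1/2)^j * norm (P j f)" if f: "f \<in> ?W" for f j
  proof -
    have fV: "f \<in> V" and Lf: "L f = fourier_multiplier ?m f"
      using f eigenspace_iff[OF a] by auto
    let ?s = "\<lambda>x. ?m x * level_cutoff (shell j) ?m x"
    have s: "ess_bounded_by ((1/2)^j) ?s"
      unfolding ess_bounded_by_def level_cutoff_def[abs_def] shell_def by (auto simp: norm_mult)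
    have "L (P j f) = P j (fourier_multiplier ?m f)"
      using P_comm(2)[OF fV] Lf by simp
    also have "\<dots> = fourier_multiplier ?m (P j f)"
      unfolding P_def by (simp add: fourier_multiplier_mult[OF cut(1) m] fourier_multiplier_mult[OF m cut(1)] mult.commute)
    also have "\<dots> = fourier_multiplier ?m (P j (P j f))"
      by (simp add: PP)
    also have "\<dots> = fourier_multiplier ?s (P j f)"
      unfolding P_def by (rule fourier_multiplier_mult[OF m cut(1)])
    finally show ?thesis
      using norm_fourier_multiplier_le[OF s, of "P j f"] P_comm(2)[OF fV] by simp
  qed
  have "\<exists>u. u \<in> V \<and> P j u = u \<and> norm (L u) \<le> (1/2)^j * norm u \<and>
      ((\<exists>f\<in>?W. P j f \<noteq> 0) \<longrightarrow> norm u = real j) \<and> norm u \<le> real j" for j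
  proof (cases "\<exists>f\<in>?W. P j f \<noteq> 0")
    case True
    then obtain f where f: "f \<in> ?W" "P j f \<noteq> 0" by blast
    define r where "r = complex_of_real (real j / norm (P j f))"
    have fV: "f \<in> V" using f eigenspace_iff[OF a] by auto
    have "norm (cscale r (P j f)) = real j"
      using f(2) unfolding norm_cscale r_def norm_of_real by simp
    moreover have "norm (L (cscale r (P j f))) \<le> (1/2)^j * norm (cscale r (P j f))"
      using mult_left_mono[OF conjunct2[OF small[OF f(1), of j]], of "norm r"]
      by (simp add: L_cscale[OF P_comm(1)[OF fV]] norm_cscale mult_ac)
    moreover have "P j (cscale r (P j f)) = cscale r (P j f)"
      using fourier_multiplier_cscale[OF cut(1)[of j], of r "P j f"] PP[of j j f] by (simp add: P_def)
    ultimately show ?thesis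
      using cscale_V[OF P_comm(1)[OF fV]] by (intro exI[of _ "cscale r (P j f)"]) auto
  next
    case False
    have "P j 0 = 0"
      using fourier_multiplier_cscale[OF cut(1)[of j], of 0 0] by (simp add: P_def)
    then show ?thesis
      using False zero_V L_0 by (intro exI[of _ 0]) auto
  qed
  then obtain u where u: "\<And>j. u j \<in> V" "\<And>j. P j (u j) = u j" "\<And>j. norm (L (u j)) \<le> (1/2)^j * norm (u j)"
    and bad: "\<And>j f. f \<in> ?W \<Longrightarrow> P j f \<noteq> 0 \<Longrightarrow> norm (u j) = real j" and norm_u: "\<And>j. norm (u j) \<le> real j"
    by metis
  have summ: "summable (\<lambda>j. L (u j))"
  proof (rule summable_comparison_test')
    show "summable (\<lambda>j. real (Suc j) * (1/2)^j)"
      using geometric_deriv_sums[of "1/2 :: real"] by (auto simp: sums_iff)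
    show "norm (L (u j)) \<le> real (Suc j) * (1/2)^j" for j
    proof -
      have "(1/2)^j * norm (u j) \<le> (1/2)^j * real (Suc j)"
        using norm_u[of j] by (intro mult_left_mono) auto
      then show ?thesis
        using u(3)[of j] by (simp only: mult.commute)
    qed
  qed
  define g where "g = (\<Sum>j. L (u j))"
  have g: "(\<lambda>n. \<Sum>j<n. L (u j)) \<longlonglongrightarrow> g"
    unfolding g_def by (rule summable_LIMSEQ[OF summ])
  have "g \<in> V"
    by (rule closed_sequentially[OF closed_V _ g]) (intro sum_V L_V u)
  then obtain h where h: "h \<in> V" "L h = g"
    using L_surj by blast
  have Ph: "P j h = u j" for j
  proof (rule L_inj)
    have bl: "bounded_linear (P j)"
      unfolding P_def
      by (rule L2_bounded_linearI[where C = 1])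
        (simp_all add: fourier_multiplier_add[OF cut(1)] fourier_multiplier_cscale[OF cut(1)] norm_fourier_multiplier_le[OF cut(1), simplified])
    have "L (P j h) = P j g"
      using P_comm(2)[OF h(1)] h(2) by simp
    also have "\<dots> = (\<Sum>i. P j (L (u i)))"
      unfolding g_def by (rule bounded_linear.suminf[OF bl summ])
    also have "\<dots> = (\<Sum>i. if i = j then L (u j) else 0)"
    proof (rule suminf_cong)
      fix i
      have "P j (L (u i)) = L (P j (P i (u i)))"
        by (simp only: P_comm(2)[OF u(1)] u(2))
      also have "\<dots> = (if i = j then L (u j) else 0)"
        unfolding PP by (auto simp: L_0 u(2))
      finally show "P j (L (u i)) = (if i = j then L (u j) else 0)" .
    qed
    also have "\<dots> = L (u j)"
      by (subst suminf_finite[of "{j}"]) auto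
    finally show "L (P j h) = L (u j)" .
  qed (use P_comm(1) h u in auto)
  have good: "P j f = 0" if "f \<in> ?W" "real j > norm h" for j f
  proof (rule ccontr)
    assume "P j f \<noteq> 0"
    then have "norm (P j h) = real j"
      using bad[OF that(1)] Ph by simp
    moreover have "norm (P j h) \<le> 1 * norm h"
      unfolding P_def by (rule norm_fourier_multiplier_le[OF cut(1)]) simp
    ultimately show False using that(2) by simp
  qed
  obtain J :: nat where J: "norm h < real J"
    using reals_Archimedean2 by blast
  show ?thesis
  proof (rule that[of "(1/2)^J"])
    fix f assume f: "f \<in> ?W"
    then have fV: "f \<in> V" and Lf: "L f = fourier_multiplier ?m f"
      using eigenspace_iff[OF a] by auto
    have "AE x in lborel. rep_L2 (fourier f) x \<noteq> 0 \<longrightarrow> level_cutoff (shell j) ?m x = 0" if "j \<ge> J" for j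
      using good[OF f, of j] J that fourier_multiplier_eq_0_iff[OF cut(1)[of j], of f] by (simp add: P_def)
    then have shells: "AE x in lborel. \<forall>j. j \<ge> J \<longrightarrow> rep_L2 (fourier f) x \<noteq> 0 \<longrightarrow> level_cutoff (shell j) ?m x = 0"
      by (simp add: AE_all_countable)
    \<comment> \<open>The part of \<open>f\<close> on the zero set of the symbol is in the kernel of \<open>L\<close>.\<close>
    let ?z = "level_cutoff (\<lambda>t. t = 0) ?m"
    have z: "ess_bounded_by 1 ?z" "periodic ?z"
      by (auto intro: ess_bounded_by_level_cutoff periodic_level_cutoff periodic_symbol)
    note z_comm = fourier_multiplier_commutes[OF z(1) _ z(2) fV, simplified]
    have "L (fourier_multiplier ?z f) = fourier_multiplier (\<lambda>x. ?z x * ?m x) f"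
      using z_comm(2) Lf by (simp add: fourier_multiplier_mult[OF z(1) m])
    also have "(\<lambda>x. ?z x * ?m x) = (\<lambda>x. 0)"
      by (auto simp: level_cutoff_def)
    also have "fourier_multiplier (\<lambda>x. 0) f = 0"
      using fourier_multiplier_eq_0_iff[of 0 "\<lambda>_. 0" f] by (simp add: ess_bounded_by_def)
    finally have "fourier_multiplier ?z f = 0"
      using L_inj[OF z_comm(1) zero_V] L_0 by simp
    then have zero: "AE x in lborel. rep_L2 (fourier f) x \<noteq> 0 \<longrightarrow> ?z x = 0"
      using fourier_multiplier_eq_0_iff[OF z(1)] by simp
    show "AE x in lborel. rep_L2 (fourier f) x \<noteq> 0 \<longrightarrow> (1/2)^J \<le> norm (?m x)"
      using shells zero
    proof eventually_elim
      case (elim x)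
      show ?case
      proof (intro impI leI notI)
        assume x: "rep_L2 (fourier f) x \<noteq> 0" and less: "norm (?m x) < (1/2)^J"
        have pos: "norm (?m x) > 0"
          using elim(2) x by (auto simp: level_cutoff_def split: if_splits)
        obtain n where n: "(1/2::real)^n < norm (?m x)"
          using real_arch_pow_inv[OF pos, of "1/2"] by auto
        define N where "N = (LEAST n. (1/2::real)^n \<le> norm (?m x))"
        have N: "(1/2)^N \<le> norm (?m x)"
          unfolding N_def by (rule LeastI[of _ n]) (use n in simp)
        have "N > J"
        proof (rule ccontr)
          assume "\<not> N > J"
          then have "(1/2::real)^J \<le> (1/2)^N" by (intro power_decreasing) auto
          then show False using N less by linarith
        qed
        then obtain j where j: "N = Suc j" "j \<ge> J" by (cases N) auto
        have "\<not> (1/2::real)^j \<le> norm (?m x)"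
          using not_less_Least[of j "\<lambda>n. (1/2::real)^n \<le> norm (?m x)"] j(1) by (simp add: N_def)
        then have "shell j (norm (?m x))"
          using N j(1) by (simp add: shell_def)
        then show False
          using elim(1) j(2) x by (auto simp: level_cutoff_def)
      qed
    qed
  qed simp
qed

text \<open>
  Let \<open>A\<close> and \<open>B\<close> be the two multipliers, which commute with \<open>L\<close>. If \<open>L f = A f\<close>, then \<open>L (B f) = B (A f) = f\<close>
  because of the condition on the fibers of \<open>f\<close>. Conversely, \<open>L (B f) = f\<close> means \<open>B (L f) = f\<close>, so that the fibers of
  \<open>f\<close> vanish where the symbol of \<open>b\<close> does; hence \<open>A (B f) = f\<close> and \<open>L f = A (L (B f)) = A f\<close>.
\<close>

lemma eigenspace_inverse:
  assumes a: "bounded_spectrum a" and b: "bounded_spectrum b"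
    and inv: "AE x in lborel. symbol b x \<noteq> 0 \<longrightarrow> symbol a x * symbol b x = 1"
    and supp: "\<And>f. f \<in> s_eigenspace V L a \<Longrightarrow> AE x in lborel. rep_L2 (fourier f) x \<noteq> 0 \<longrightarrow> symbol b x \<noteq> 0"
  shows "s_eigenspace V (inv_into V L) b = s_eigenspace V L a"
proof (intro set_eqI iffI)
  let ?A = "fourier_multiplier (symbol a)" and ?B = "fourier_multiplier (symbol b)"
  let ?ab = "\<lambda>x. symbol a x * symbol b x"
  obtain Ca where Ca: "Ca \<ge> 0" "ess_bounded_by Ca (symbol a)" using ess_bounded_by_symbol[OF a] .
  obtain Cb where Cb: "Cb \<ge> 0" "ess_bounded_by Cb (symbol b)" using ess_bounded_by_symbol[OF b] .
  note A = fourier_multiplier_commutes[OF Ca(2,1) periodic_symbol]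
  note B = fourier_multiplier_commutes[OF Cb(2,1) periodic_symbol]
  note ab = ess_bounded_by_mult[OF Ca(2) Cb(2)]
  have AB: "?A (?B f) = fourier_multiplier ?ab f" "?B (?A f) = fourier_multiplier ?ab f" for f
    using fourier_multiplier_mult[OF Ca(2) Cb(2), of f] fourier_multiplier_mult[OF Cb(2) Ca(2), of f]
    by (simp_all add: mult.commute)
  {
    fix f assume f: "f \<in> s_eigenspace V L a"
    then have fV: "f \<in> V" and Lf: "L f = ?A f"
      using eigenspace_iff[OF a] by auto
    have "AE x in lborel. rep_L2 (fourier f) x \<noteq> 0 \<longrightarrow> ?ab x = 1"
      using inv supp[OF f] by eventually_elim auto
    then have "L (?B f) = f"
      using B(2)[OF fV] Lf AB(2) fourier_multiplier_id_AE[OF ab] by simp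
    then have "inv_into V L f = ?B f"
      using inv_eq_iff[OF fV B(1)[OF fV]] by simp
    then show "f \<in> s_eigenspace V (inv_into V L) b"
      using fV by (simp add: s_eigenspace_def Lambda_eq_fourier_multiplier[OF b])
  next
    fix f assume "f \<in> s_eigenspace V (inv_into V L) b"
    then have fV: "f \<in> V" and "inv_into V L f = ?B f"
      by (auto simp: s_eigenspace_def Lambda_eq_fourier_multiplier[OF b])
    then have LB: "L (?B f) = f"
      using inv_eq_iff[OF fV B(1)[OF fV]] by simp
    then have "?B (L f) = f"
      using B(2)[OF fV] by simp
    then have "fourier f = mult_op (symbol b) (fourier (L f))"
      by (metis fourier_multiplier)
    then have "AE x in lborel. rep_L2 (fourier f) x = symbol b x * rep_L2 (fourier (L f)) x"
      using rep_mult_op[OF Cb(2), of "fourier (L f)"] by simp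
    then have "AE x in lborel. rep_L2 (fourier f) x \<noteq> 0 \<longrightarrow> ?ab x = 1"
      using inv by eventually_elim auto
    then have "?A (?B f) = f"
      using AB(1) fourier_multiplier_id_AE[OF ab] by simp
    then have "L f = ?A f"
      using A(2)[OF B(1)[OF fV]] LB by simp
    then show "f \<in> s_eigenspace V L a"
      using fV eigenspace_iff[OF a] by simp
  }
qed

end

lemma direct_sum_cong:
  assumes "\<And>j. j < m \<Longrightarrow> W j = W' j"
  shows "direct_sum V m W = direct_sum V m W'"
proof -
  have "(\<forall>j<m. f j \<in> W j) \<longleftrightarrow> (\<forall>j<m. f j \<in> W' j)" for f
    using assms by auto
  then show ?thesis
    unfolding direct_sum_def by (simp only:)
qed

lemma s_diagonalization_inverse:
  assumes "s_diagonalization V L a" "length b = length a"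
    and "\<And>j. j < length a \<Longrightarrow> bounded_spectrum (b ! j)"
    and "\<And>j. j < length a \<Longrightarrow> s_eigenspace V L' (b ! j) = s_eigenspace V L (a ! j)"
  shows "s_diagonalization V L' b"
  using assms direct_sum_cong[of "length a" "\<lambda>j. s_eigenspace V L' (b ! j)" "\<lambda>j. s_eigenspace V L (a ! j)" V]
  by (simp add: s_diagonalization_def s_eigenvalue_def)

context invertible_shift_preserving_operator
begin

lemma eigenspace_of_inverse_symbol:
  assumes a: "bounded_spectrum a" and b: "bounded_spectrum b"
    and inv: "AE w\<in>unit_cube in lborel. seq_fourier b w = inverse (seq_fourier a w)"
  shows "s_eigenspace V (inv_into V L) b = s_eigenspace V L a"
proof (rule eigenspace_inverse[OF a b])
  have inv': "AE x in lborel. symbol b x = inverse (symbol a x)"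
    unfolding symbol_def using inv by (subst AE_frac_vec_iff)
  then show "AE x in lborel. symbol b x \<noteq> 0 \<longrightarrow> symbol a x * symbol b x = 1"
    by eventually_elim auto
  fix f assume f: "f \<in> s_eigenspace V L a"
  obtain c where c: "c > 0"
    "\<And>f. f \<in> s_eigenspace V L a \<Longrightarrow> AE x in lborel. rep_L2 (fourier f) x \<noteq> 0 \<longrightarrow> c \<le> norm (symbol a x)"
    using symbol_bounded_below_on_eigenspace[OF a] by blast
  show "AE x in lborel. rep_L2 (fourier f) x \<noteq> 0 \<longrightarrow> symbol b x \<noteq> 0"
    using inv' c(2)[OF f] by eventually_elim (use c(1) in auto)
qed

text \<open>
  Where the symbol is small it need not have a bounded inverse, but no fiber of the eigenspace lives there, so
  that the inverse may be replaced by zero. If the inverse is essentially bounded, the threshold can be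
  chosen so small that nothing is cut off.
\<close>

lemma inverse_symbol_exists:
  assumes a: "bounded_spectrum a"
  shows "\<exists>b. bounded_spectrum b \<and> s_eigenspace V (inv_into V L) b = s_eigenspace V L a \<and>
    (\<forall>f\<in>s_eigenspace V L a. AE w\<in>unit_cube in lborel. fiber f w \<noteq> (\<lambda>_. 0) \<longrightarrow>
        seq_fourier b w = inverse (seq_fourier a w)) \<and>
    (ess_bounded (\<lambda>w. inverse (seq_fourier a w)) \<longrightarrow>
        (AE w\<in>unit_cube in lborel. seq_fourier b w = inverse (seq_fourier a w)))"
proof -
  let ?a = "seq_fourier a"
  have [measurable]: "?a \<in> borel_measurable borel"
    using a by (intro seq_fourier_measurable) (simp add: bounded_spectrum_def)
  obtain c where c: "c > 0"
    "\<And>f. f \<in> s_eigenspace V L a \<Longrightarrow> AE x in lborel. rep_L2 (fourier f) x \<noteq> 0 \<longrightarrow> c \<le> norm (symbol a x)"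
    using symbol_bounded_below_on_eigenspace[OF a] by blast
  obtain d where d: "d > 0" "ess_bounded (\<lambda>w. inverse (?a w)) \<Longrightarrow> AE w\<in>unit_cube in lborel. ?a w = 0 \<or> d \<le> norm (?a w)"
  proof (cases "ess_bounded (\<lambda>w. inverse (?a w))")
    case True
    then obtain M where M: "AE w\<in>unit_cube in lborel. norm (inverse (?a w)) \<le> M"
      by (auto simp: ess_bounded_def)
    have "inverse (\<bar>M\<bar> + 1) \<le> norm z" if "norm (inverse z) \<le> M" "z \<noteq> 0" for z :: complex
      using le_imp_inverse_le[of "inverse (norm z)" "\<bar>M\<bar> + 1"] that by (simp add: norm_inverse)
    with M have "AE w\<in>unit_cube in lborel. ?a w = 0 \<or> inverse (\<bar>M\<bar> + 1) \<le> norm (?a w)"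
      by (auto elim!: eventually_mono)
    then show ?thesis using that[of "inverse (\<bar>M\<bar> + 1)"] by simp
  next
    case False
    then show ?thesis using that[of 1] by simp
  qed
  define e where "e = min c d"
  define g where "g w = (if e \<le> norm (?a w) then inverse (?a w) else 0)" for w
  have e: "e > 0" using c(1) d(1) by (simp add: e_def)
  have "g \<in> borel_measurable borel"
    unfolding g_def[abs_def] by measurable
  moreover have "norm (g w) \<le> inverse e" for w
    using e by (auto simp: g_def norm_inverse intro: le_imp_inverse_le)
  ultimately obtain b where b: "bounded_spectrum b" "AE w\<in>unit_cube in lborel. seq_fourier b w = g w"
    using bounded_function_is_seq_fourier by blast
  have sb: "AE x in lborel. symbol b x = (if e \<le> norm (symbol a x) then inverse (symbol a x) else 0)"
    using b(2) unfolding symbol_def g_def by (subst AE_frac_vec_iff)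
  show ?thesis
  proof (intro exI[of _ b] conjI impI)
    show "bounded_spectrum b" by (rule b(1))
    show "s_eigenspace V (inv_into V L) b = s_eigenspace V L a"
    proof (rule eigenspace_inverse[OF a b(1)])
      show "AE x in lborel. symbol b x \<noteq> 0 \<longrightarrow> symbol a x * symbol b x = 1"
        using sb by eventually_elim auto
      fix f assume "f \<in> s_eigenspace V L a"
      from sb c(2)[OF this] show "AE x in lborel. rep_L2 (fourier f) x \<noteq> 0 \<longrightarrow> symbol b x \<noteq> 0"
        by eventually_elim (use e in \<open>auto simp: e_def\<close>)
    qed
    show "\<forall>f\<in>s_eigenspace V L a. AE w\<in>unit_cube in lborel. fiber f w \<noteq> (\<lambda>_. 0) \<longrightarrow>
        seq_fourier b w = inverse (?a w)"
      unfolding AE_fiber_nonzero_iff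
    proof
      fix f assume "f \<in> s_eigenspace V L a"
      from sb c(2)[OF this] show "AE x in lborel. rep_L2 (fourier f) x \<noteq> 0 \<longrightarrow> seq_fourier b (frac_vec x) = inverse (?a (frac_vec x))"
        by eventually_elim (auto simp: e_def symbol_def)
    qed
    show "AE w\<in>unit_cube in lborel. seq_fourier b w = inverse (?a w)"
      if "ess_bounded (\<lambda>w. inverse (?a w))"
      using b(2) d(2)[OF that] by eventually_elim (auto simp: g_def e_def)
  qed
qed

end

theorem proposition6p3:
  fixes V :: "'n::finite L2 set" and L :: "'n L2 \<Rightarrow> 'n L2"
  assumes "shift_invariant V" and "finitely_generated V"
    and "shift_preserving V L" and "bij_betw L V V"
  shows "(s_diagonalizable V L \<longrightarrow> s_diagonalizable V (inv_into V L)) \<and>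
    (\<forall>a. s_diagonalization V L a \<longrightarrow>
      (\<forall>b. length b = length a \<and>
           (\<forall>j<length a. bounded_spectrum (b ! j) \<and>
              (AE \<omega> in lborel. \<omega> \<in> unit_cube \<longrightarrow>
                 seq_fourier (b ! j) \<omega> = inverse (seq_fourier (a ! j) \<omega>)))
         \<longrightarrow> s_diagonalization V (inv_into V L) b \<and>
             (\<forall>j<length a. s_eigenspace V (inv_into V L) (b ! j) = s_eigenspace V L (a ! j))) \<and>
      (\<exists>b. length b = length a \<and>
           s_diagonalization V (inv_into V L) b \<and>
           (\<forall>j<length a.
              s_eigenspace V (inv_into V L) (b ! j) = s_eigenspace V L (a ! j) \<and>
              (\<forall>f\<in>s_eigenspace V L (a ! j). AE \<omega> in lborel. \<omega> \<in> unit_cube \<longrightarrow>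
                 fiber f \<omega> \<noteq> (\<lambda>_. 0) \<longrightarrow>
                 seq_fourier (b ! j) \<omega> = inverse (seq_fourier (a ! j) \<omega>)) \<and>
              (ess_bounded (\<lambda>\<omega>. inverse (seq_fourier (a ! j) \<omega>)) \<longrightarrow>
                 (AE \<omega> in lborel. \<omega> \<in> unit_cube \<longrightarrow>
                    seq_fourier (b ! j) \<omega> = inverse (seq_fourier (a ! j) \<omega>))))))"
proof -
  interpret invertible_shift_preserving_operator V L
    by standard (use assms in auto)
  have first: "s_diagonalization V (inv_into V L) b \<and>
      (\<forall>j<length a. s_eigenspace V (inv_into V L) (b ! j) = s_eigenspace V L (a ! j))"
    if a: "s_diagonalization V L a" and b: "length b = length a"
      "\<forall>j<length a. bounded_spectrum (b ! j) \<and> (AE \<omega>\<in>unit_cube in lborel.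
         seq_fourier (b ! j) \<omega> = inverse (seq_fourier (a ! j) \<omega>))" for a b
  proof -
    have "s_eigenspace V (inv_into V L) (b ! j) = s_eigenspace V L (a ! j)" if "j < length a" for j
      using a b that by (intro eigenspace_of_inverse_symbol) (auto simp: s_diagonalization_def s_eigenvalue_def)
    then show ?thesis
      using s_diagonalization_inverse[OF a b(1)] b(2) by blast
  qed
  let ?P = "\<lambda>aj b. s_eigenspace V (inv_into V L) b = s_eigenspace V L aj \<and>
       (\<forall>f\<in>s_eigenspace V L aj. AE \<omega>\<in>unit_cube in lborel. fiber f \<omega> \<noteq> (\<lambda>_. 0) \<longrightarrow>
          seq_fourier b \<omega> = inverse (seq_fourier aj \<omega>)) \<and>
       (ess_bounded (\<lambda>\<omega>. inverse (seq_fourier aj \<omega>)) \<longrightarrow>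
          (AE \<omega>\<in>unit_cube in lborel. seq_fourier b \<omega> = inverse (seq_fourier aj \<omega>)))"
  have second: "\<exists>b. length b = length a \<and> s_diagonalization V (inv_into V L) b \<and>
      (\<forall>j<length a. ?P (a ! j) (b ! j))"
    if a: "s_diagonalization V L a" for a
  proof -
    have "\<forall>j. \<exists>b. j < length a \<longrightarrow> bounded_spectrum b \<and> ?P (a ! j) b"
    proof
      fix j
      show "\<exists>b. j < length a \<longrightarrow> bounded_spectrum b \<and> ?P (a ! j) b"
      proof (cases "j < length a")
        case True
        then have "bounded_spectrum (a ! j)"
          using a by (simp add: s_diagonalization_def s_eigenvalue_def)
        from inverse_symbol_exists[OF this] show ?thesis
          by (elim exE) (intro exI impI)
      qed simp
    qed
    then have "\<exists>b. \<forall>j. j < length a \<longrightarrow> bounded_spectrum (b j) \<and> ?P (a ! j) (b j)"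
      by (rule choice)
    then obtain b where b: "\<And>j. j < length a \<Longrightarrow> bounded_spectrum (b j) \<and> ?P (a ! j) (b j)" by blast
    let ?b = "map b [0..<length a]"
    have P: "bounded_spectrum (?b ! j) \<and> ?P (a ! j) (?b ! j)" if "j < length a" for j
    proof -
      have nth: "?b ! j = b j" using that by simp
      show ?thesis unfolding nth by (rule b[OF that])
    qed
    have len: "length ?b = length a" by simp
    have "s_diagonalization V (inv_into V L) ?b"
      by (rule s_diagonalization_inverse[OF a len]) (use P in blast)+
    then show ?thesis
      using P len by blast
  qed
  show ?thesis
    using first second unfolding s_diagonalizable_def by blast
qed

end
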